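(* Let $\mathcal G$ and $\mathcal H$ be Lie groupoids, and let $P_1$ and $P_2$ be Hilsum--Skandalis morphisms from $\mathcal G$ to $\mathcal H$. Then the set $\mathsf{Mor}_{\mathsf{HS}_{\mathcal G,\mathcal H}}(P_1,P_2)$ of morphisms of Hilsum--Skandalis morphisms from $P_1$ to $P_2$ is in one-to-one correspondence with the set $C^{\infty}_{\mathcal G}(P_1\odot P_2,\mathcal H)^{\mathcal H^2}$ of Hilsum--Skandalis generalized gauge transformations between $P_1$ and $P_2$.
   Context: Lie groupoids: a groupoid has a set of arrows $\mathcal G$, a set of objects $X_{\mathcal G}$, surjective source and target maps $s_{\mathcal G},t_{\mathcal G}:\mathcal G\to X_{\mathcal G}$, a unit map $\iota_{\mathcal G}:X_{\mathcal G}\to\mathcal G$, an inversion $g\mapsto g^{-1}$, and an associative product $g_1g_2$ defined iff $s_{\mathcal G}(g_1)=t_{\mathcal G}(g_2)$, with $s_{\mathcal G}(g_1g_2)=s_{\mathcal G}(g_2)$, $t_{\mathcal G}(g_1g_2)=t_{\mathcal G}(g_1)$ and the usual unit and inverse laws. It is a Lie groupoid if $X_{\mathcal G}$ is a smooth Hausdorff manifold, $\mathcal G$ is a smooth manifold (possibly non-Hausdorff, not second countable), $s_{\mathcal G}$ is a surjective submersion with Hausdorff fibres, and all other structure maps are smooth. Right action of $\mathcal H$ on a manifold $P$ with momentum $\varepsilon$: smooth maps $\varepsilon:P\to X_{\mathcal H}$ and $(p,h)\mapsto ph$ from $P\times_\varepsilon\mathcal H=\{(p,h): \varepsilon(p)=t_{\mathcal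 H}(h)\}$ to $P$ with $\varepsilon(ph)=s_{\mathcal H}(h)$, $(ph)h'=p(hh')$ whenever defined, and $p\,\iota_{\mathcal H}(\varepsilon(p))=p$. Left action of $\mathcal G$ on $P$ with momentum $\pi$: smooth maps $\pi:P\to X_{\mathcal G}$ and $(g,p)\mapsto gp$ defined on $\{(g,p):s_{\mathcal G}(g)=\pi(p)\}$ with $\pi(gp)=t_{\mathcal G}(g)$, $g(g'p)=(gg')p$ whenever defined, $\iota_{\mathcal G}(\pi(p))p=p$. Principal $\mathcal H$-bundle $(P,\pi,\varepsilon,M)$ over $M$: smooth manifolds $P$ (possibly non-Hausdorff) and $M$ (Hausdorff), a right $\mathcal H$-action on $P$ with momentum $\varepsilon$, and a surjective submersion $\pi:P\to M$ with $\pi(ph)=\pi(p)$ such that $P\times_\varepsilon\mathcal H\to P\times_MP$, $(p,h)\mapsto(p,ph)$, is a diffeomorphism, where $P\times_MP=\{(p,q):\pi(p)=\pi(q)\}$. Hilsum--Skandalis (HS) morphism from $\mathcal G$ to $\mathcal H$: a principal $\mathcal H$-bundle $(P,\pi,\varepsilon,X_{\mathcal G})$ over $X_{\mathcal G}$ together with a left $\mathcal G$-action on $P$ with momentum $\pi$, such that $\varepsilon(gp)=\varepsilon(p)$ and $(gp)h=g(ph)$ whenever $s_{\mathcal G}(g)=\pi(p)$, $t_{\mathcal H}(h)=\varepsilon(p)$. Morphism of HS morphisms from $(P_1,\pi_1,\varepsilon_1)$ to $(P_2,\pi_2,\varepsilon_2)$ (morphism of the category $\mathsf{HS}_{\mathcal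 G,\mathcal H}$): a smooth map $\sigma:P_1\to P_2$ with $\pi_2\circ\sigma=\pi_1$, $\varepsilon_2\circ\sigma=\varepsilon_1$, $\sigma(ph)=\sigma(p)h$ whenever $t_{\mathcal H}(h)=\varepsilon_1(p)$, and $\sigma(gp)=g\sigma(p)$ whenever $s_{\mathcal G}(g)=\pi_1(p)$. $P_1\odot P_2=\{(p_1,p_2)\in P_1\times P_2:\pi_1(p_1)=\pi_2(p_2)\}$. HS generalized gauge transformation between $P_1$ and $P_2$: a smooth map $K:P_1\odot P_2\to\mathcal H$ with $s_{\mathcal H}(K(p_1,p_2))=\varepsilon_1(p_1)$, $t_{\mathcal H}(K(p_1,p_2))=\varepsilon_2(p_2)$, $K(p_1h_1,p_2h_2)=h_2^{-1}K(p_1,p_2)h_1$ whenever $t_{\mathcal H}(h_i)=\varepsilon_i(p_i)$, and $K(gp_1,gp_2)=K(p_1,p_2)$ whenever $s_{\mathcal G}(g)=\pi_1(p_1)=\pi_2(p_2)$. The set of these is $C^{\infty}_{\mathcal G}(P_1\odot P_2,\mathcal H)^{\mathcal H^2}$. *)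

theory Defs
  imports "HOL-Analysis.Analysis"
begin

section \<open>Smooth manifolds\<close>

text \<open>
  Charts take values in an open subset of a linear subspace \<open>L\<close> of a Euclidean space type, and
  \<open>L\<close> is part of the chart.  So every dimension, including 0 (which no Euclidean space type has),
  is available, and a slice of a chart is again a chart.  The dimension of a manifold
  is locally constant.  Manifolds are not assumed to be Hausdorff or second countable.
\<close>

text \<open>Functions of class \<open>C\<^sup>k\<close> on a relatively open subset \<open>W\<close> of \<open>L\<close>. Derivatives are taken within
  \<open>L\<close>, so that \<open>D x\<close> is determined on \<open>L\<close> only.\<close>

primrec Ck_on ::
    "nat \<Rightarrow> 'e::euclidean_space set \<Rightarrow> 'e set \<Rightarrow> ('e \<Rightarrow> 'f::euclidean_space) \<Rightarrow> bool" where
  "Ck_on 0 L W f \<longleftrightarrow> continuous_on W f"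
| "Ck_on (Suc k) L W f \<longleftrightarrow>
     (\<exists>D. (\<forall>x\<in>W. (f has_derivative D x) (at x within L)) \<and>
          (\<forall>v\<in>L. Ck_on k L W (\<lambda>x. D x v)))"

definition smooth_on ::
    "'e::euclidean_space set \<Rightarrow> 'e set \<Rightarrow> ('e \<Rightarrow> 'f::euclidean_space) \<Rightarrow> bool" where
  "smooth_on L W f \<longleftrightarrow> (\<forall>k. Ck_on k L W f)"

text \<open>A chart \<open>(U, L, \<phi>)\<close> has domain \<open>U\<close>, model space \<open>L\<close> and coordinate map \<open>\<phi>\<close>.\<close>

type_synonym ('a, 'e) chart = "'a set \<times> 'e set \<times> ('a \<Rightarrow> 'e)"

definition is_chart :: "'a topology \<Rightarrow> ('a, 'e::euclidean_space) chart \<Rightarrow> bool" where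
  "is_chart T = (\<lambda>(U, L, \<phi>).
     openin T U \<and> subspace L \<and> openin (top_of_set L) (\<phi> ` U) \<and>
     homeomorphic_map (subtopology T U) (top_of_set (\<phi> ` U)) \<phi>)"

definition compatible_charts ::
    "('a, 'e::euclidean_space) chart \<Rightarrow> ('a, 'e) chart \<Rightarrow> bool" where
  "compatible_charts = (\<lambda>(U, L, \<phi>) (V, M, \<psi>).
     smooth_on L (\<phi> ` (U \<inter> V)) (\<psi> \<circ> inv_into U \<phi>) \<and>
     smooth_on M (\<psi> ` (U \<inter> V)) (\<phi> \<circ> inv_into V \<psi>))"

record ('a, 'e) mfd =
  topo :: "'a topology"
  atlas :: "('a, 'e) chart set"

abbreviation pts :: "('a, 'e) mfd \<Rightarrow> 'a set" where
  "pts M \<equiv> topspace (topo M)"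

definition smooth_manifold :: "('a, 'e::euclidean_space) mfd \<Rightarrow> bool" where
  "smooth_manifold M \<longleftrightarrow>
     (\<forall>c\<in>atlas M. is_chart (topo M) c) \<and>
     (\<Union>(U, L, \<phi>)\<in>atlas M. U) = pts M \<and>
     (\<forall>c\<in>atlas M. \<forall>d\<in>atlas M. compatible_charts c d)"

abbreviation hausdorff_manifold :: "('a, 'e::euclidean_space) mfd \<Rightarrow> bool" where
  "hausdorff_manifold M \<equiv> smooth_manifold M \<and> Hausdorff_space (topo M)"

definition max_atlas :: "('a, 'e::euclidean_space) mfd \<Rightarrow> ('a, 'e) chart set" where
  "max_atlas M = {c. is_chart (topo M) c \<and> (\<forall>d\<in>atlas M. compatible_charts c d)}"

definition smooth_map ::
    "('a, 'e::euclidean_space) mfd \<Rightarrow> ('b, 'f::euclidean_space) mfd \<Rightarrow> ('a \<Rightarrow> 'b) \<Rightarrow> bool" where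
  "smooth_map M N f \<longleftrightarrow>
     continuous_map (topo M) (topo N) f \<and>
     (\<forall>(U, L, \<phi>)\<in>atlas M. \<forall>(V, K, \<psi>)\<in>atlas N.
        smooth_on L (\<phi> ` (U \<inter> f -` V)) (\<psi> \<circ> f \<circ> inv_into U \<phi>))"

definition submersion ::
    "('a, 'e::euclidean_space) mfd \<Rightarrow> ('b, 'f::euclidean_space) mfd \<Rightarrow> ('a \<Rightarrow> 'b) \<Rightarrow> bool" where
  "submersion M N f \<longleftrightarrow>
     smooth_map M N f \<and>
     (\<forall>(U, L, \<phi>)\<in>atlas M. \<forall>(V, K, \<psi>)\<in>atlas N. \<forall>p\<in>U. f p \<in> V \<longrightarrow>
        (\<exists>D. (\<psi> \<circ> f \<circ> inv_into U \<phi> has_derivative D) (at (\<phi> p) within L) \<and> D ` L = K))"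

definition surjective_submersion ::
    "('a, 'e::euclidean_space) mfd \<Rightarrow> ('b, 'f::euclidean_space) mfd \<Rightarrow> ('a \<Rightarrow> 'b) \<Rightarrow> bool" where
  "surjective_submersion M N f \<longleftrightarrow> submersion M N f \<and> f ` pts M = pts N"

definition diffeomorphism ::
    "('a, 'e::euclidean_space) mfd \<Rightarrow> ('b, 'f::euclidean_space) mfd \<Rightarrow> ('a \<Rightarrow> 'b) \<Rightarrow> bool" where
  "diffeomorphism M N f \<longleftrightarrow>
     bij_betw f (pts M) (pts N) \<and> smooth_map M N f \<and> smooth_map N M (inv_into (pts M) f)"

definition product_manifold ::
    "('a, 'e::euclidean_space) mfd \<Rightarrow> ('b, 'f::euclidean_space) mfd \<Rightarrow> ('a \<times> 'b, 'e \<times> 'f) mfd" where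
  "product_manifold M N =
     \<lparr>topo = prod_topology (topo M) (topo N),
      atlas = {(U \<times> V, L \<times> K, map_prod \<phi> \<psi>) | U L \<phi> V K \<psi>.
                 (U, L, \<phi>) \<in> atlas M \<and> (V, K, \<psi>) \<in> atlas N}\<rparr>"

text \<open>
  The structure induced on a subset \<open>S\<close> of \<open>M\<close>: the subspace topology and the restrictions to \<open>S\<close> of
  the slice charts for \<open>S\<close>.  The set \<open>S\<close> is an embedded submanifold iff the slice charts cover it;
  only then is the result a manifold.
\<close>

definition submanifold :: "('a, 'e::euclidean_space) mfd \<Rightarrow> 'a set \<Rightarrow> ('a, 'e) mfd" where
  "submanifold M S =
     \<lparr>topo = subtopology (topo M) S,
      atlas = {(U \<inter> S, L', \<phi>) | U L L' \<phi>.
                 (U, L, \<phi>) \<in> max_atlas M \<and> subspace L' \<and> L' \<subseteq> L \<and>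
                 \<phi> ` (U \<inter> S) = \<phi> ` U \<inter> L'}\<rparr>"

text \<open>The fibre product of \<open>f : M \<rightarrow> X\<close> and \<open>g : N \<rightarrow> X\<close>. Wherever it is used below, one of
  \<open>f\<close>, \<open>g\<close> is a submersion (for the target map of a Lie groupoid, because it is the source map
  composed with inversion), so that it is an embedded submanifold of the product.\<close>

definition fibre_product ::
    "('a, 'e::euclidean_space) mfd \<Rightarrow> ('b, 'f::euclidean_space) mfd \<Rightarrow>
     ('a \<Rightarrow> 'x) \<Rightarrow> ('b \<Rightarrow> 'x) \<Rightarrow> ('a \<times> 'b, 'e \<times> 'f) mfd" where
  "fibre_product M N f g =
     submanifold (product_manifold M N) {(p, q). p \<in> pts M \<and> q \<in> pts N \<and> f p = g q}"


section \<open>Lie groupoids\<close>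

record ('g, 'e, 'x, 'f) groupoid =
  Arr :: "('g, 'e) mfd"
  Obj :: "('x, 'f) mfd"
  src :: "'g \<Rightarrow> 'x"
  tgt :: "'g \<Rightarrow> 'x"
  unt :: "'x \<Rightarrow> 'g"
  ginv :: "'g \<Rightarrow> 'g"
  mul :: "'g \<Rightarrow> 'g \<Rightarrow> 'g"

locale groupoid =
  fixes G :: "('g, 'e, 'x, 'f) groupoid"
  assumes src_surj: "src G ` pts (Arr G) = pts (Obj G)"
    and tgt_surj: "tgt G ` pts (Arr G) = pts (Obj G)"
    and unt_closed: "x \<in> pts (Obj G) \<Longrightarrow> unt G x \<in> pts (Arr G)"
    and src_unt: "x \<in> pts (Obj G) \<Longrightarrow> src G (unt G x) = x"
    and tgt_unt: "x \<in> pts (Obj G) \<Longrightarrow> tgt G (unt G x) = x"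
    and mul_closed: "\<lbrakk>g \<in> pts (Arr G); h \<in> pts (Arr G); src G g = tgt G h\<rbrakk>
          \<Longrightarrow> mul G g h \<in> pts (Arr G)"
    and src_mul: "\<lbrakk>g \<in> pts (Arr G); h \<in> pts (Arr G); src G g = tgt G h\<rbrakk>
          \<Longrightarrow> src G (mul G g h) = src G h"
    and tgt_mul: "\<lbrakk>g \<in> pts (Arr G); h \<in> pts (Arr G); src G g = tgt G h\<rbrakk>
          \<Longrightarrow> tgt G (mul G g h) = tgt G g"
    and mul_assoc: "\<lbrakk>g \<in> pts (Arr G); h \<in> pts (Arr G); k \<in> pts (Arr G);
            src G g = tgt G h; src G h = tgt G k\<rbrakk>
          \<Longrightarrow> mul G (mul G g h) k = mul G g (mul G h k)"
    and unt_mul: "g \<in> pts (Arr G) \<Longrightarrow> mul G (unt G (tgt G g)) g = g"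
    and mul_unt: "g \<in> pts (Arr G) \<Longrightarrow> mul G g (unt G (src G g)) = g"
    and ginv_closed: "g \<in> pts (Arr G) \<Longrightarrow> ginv G g \<in> pts (Arr G)"
    and src_ginv: "g \<in> pts (Arr G) \<Longrightarrow> src G (ginv G g) = tgt G g"
    and tgt_ginv: "g \<in> pts (Arr G) \<Longrightarrow> tgt G (ginv G g) = src G g"
    and ginv_mul: "g \<in> pts (Arr G) \<Longrightarrow> mul G (ginv G g) g = unt G (src G g)"
    and mul_ginv: "g \<in> pts (Arr G) \<Longrightarrow> mul G g (ginv G g) = unt G (tgt G g)"

locale lie_groupoid = groupoid G
  for G :: "('g, 'e::euclidean_space, 'x, 'f::euclidean_space) groupoid" +
  assumes Obj_manifold: "hausdorff_manifold (Obj G)"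
    and Arr_manifold: "smooth_manifold (Arr G)"
    and src_submersion: "surjective_submersion (Arr G) (Obj G) (src G)"
    and src_fibre_Hausdorff: "x \<in> pts (Obj G) \<Longrightarrow>
          Hausdorff_space (subtopology (topo (Arr G)) {g \<in> pts (Arr G). src G g = x})"
    and tgt_smooth: "smooth_map (Arr G) (Obj G) (tgt G)"
    and unt_smooth: "smooth_map (Obj G) (Arr G) (unt G)"
    and ginv_smooth: "smooth_map (Arr G) (Arr G) (ginv G)"
    and mul_smooth: "smooth_map (fibre_product (Arr G) (Arr G) (src G) (tgt G)) (Arr G)
          (\<lambda>(g, h). mul G g h)"


section \<open>Actions and principal bundles\<close>

locale right_action =
  fixes H :: "('h, 'e::euclidean_space, 'y, 'f::euclidean_space) groupoid"
    and P :: "('p, 'd::euclidean_space) mfd"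
    and \<epsilon> :: "'p \<Rightarrow> 'y"
    and act :: "'p \<Rightarrow> 'h \<Rightarrow> 'p"
  assumes mom_smooth: "smooth_map P (Obj H) \<epsilon>"
    and act_smooth: "smooth_map (fibre_product P (Arr H) \<epsilon> (tgt H)) P (\<lambda>(p, h). act p h)"
    and mom_act: "\<lbrakk>p \<in> pts P; h \<in> pts (Arr H); \<epsilon> p = tgt H h\<rbrakk> \<Longrightarrow> \<epsilon> (act p h) = src H h"
    and act_act: "\<lbrakk>p \<in> pts P; h \<in> pts (Arr H); h' \<in> pts (Arr H);
            \<epsilon> p = tgt H h; src H h = tgt H h'\<rbrakk>
          \<Longrightarrow> act (act p h) h' = act p (mul H h h')"
    and act_unt: "p \<in> pts P \<Longrightarrow> act p (unt H (\<epsilon> p)) = p"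

locale left_action =
  fixes G :: "('g, 'e::euclidean_space, 'x, 'f::euclidean_space) groupoid"
    and P :: "('p, 'd::euclidean_space) mfd"
    and \<pi> :: "'p \<Rightarrow> 'x"
    and act :: "'g \<Rightarrow> 'p \<Rightarrow> 'p"
  assumes mom_smooth: "smooth_map P (Obj G) \<pi>"
    and act_smooth: "smooth_map (fibre_product (Arr G) P (src G) \<pi>) P (\<lambda>(g, p). act g p)"
    and mom_act: "\<lbrakk>g \<in> pts (Arr G); p \<in> pts P; src G g = \<pi> p\<rbrakk> \<Longrightarrow> \<pi> (act g p) = tgt G g"
    and act_act: "\<lbrakk>g \<in> pts (Arr G); g' \<in> pts (Arr G); p \<in> pts P;
            src G g = tgt G g'; src G g' = \<pi> p\<rbrakk>
          \<Longrightarrow> act g (act g' p) = act (mul G g g') p"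
    and act_unt: "p \<in> pts P \<Longrightarrow> act (unt G (\<pi> p)) p = p"

locale principal_bundle = right_action H P \<epsilon> ract
  for H :: "('h, 'e::euclidean_space, 'y, 'f::euclidean_space) groupoid"
    and P :: "('p, 'd::euclidean_space) mfd"
    and \<pi> :: "'p \<Rightarrow> 'x"
    and \<epsilon> :: "'p \<Rightarrow> 'y"
    and ract :: "'p \<Rightarrow> 'h \<Rightarrow> 'p"
    and M :: "('x, 'c::euclidean_space) mfd" +
  assumes total_manifold: "smooth_manifold P"
    and base_manifold: "hausdorff_manifold M"
    and proj_submersion: "surjective_submersion P M \<pi>"
    and proj_act: "\<lbrakk>p \<in> pts P; h \<in> pts (Arr H); \<epsilon> p = tgt H h\<rbrakk> \<Longrightarrow> \<pi> (ract p h) = \<pi> p"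
    and principal: "diffeomorphism (fibre_product P (Arr H) \<epsilon> (tgt H)) (fibre_product P P \<pi> \<pi>)
          (\<lambda>(p, h). (p, ract p h))"


section \<open>Hilsum--Skandalis morphisms\<close>

record ('p, 'd, 'g, 'x, 'h, 'y) hs_bundle =
  Tot :: "('p, 'd) mfd"
  proj :: "'p \<Rightarrow> 'x"
  mom :: "'p \<Rightarrow> 'y"
  ract :: "'p \<Rightarrow> 'h \<Rightarrow> 'p"
  lact :: "'g \<Rightarrow> 'p \<Rightarrow> 'p"

locale hs_morphism =
  principal_bundle H "Tot P" "proj P" "mom P" "ract P" "Obj G" +
  left: left_action G "Tot P" "proj P" "lact P"
  for G :: "('g, 'e1::euclidean_space, 'x, 'f1::euclidean_space) groupoid"
    and H :: "('h, 'e2::euclidean_space, 'y, 'f2::euclidean_space) groupoid"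
    and P :: "('p, 'd::euclidean_space, 'g, 'x, 'h, 'y) hs_bundle" +
  assumes mom_lact: "\<lbrakk>g \<in> pts (Arr G); p \<in> pts (Tot P); src G g = proj P p\<rbrakk>
          \<Longrightarrow> mom P (lact P g p) = mom P p"
    and lact_ract: "\<lbrakk>g \<in> pts (Arr G); p \<in> pts (Tot P); h \<in> pts (Arr H);
            src G g = proj P p; tgt H h = mom P p\<rbrakk>
          \<Longrightarrow> ract P (lact P g p) h = lact P g (ract P p h)"

text \<open>Maps are represented by functions that are \<open>undefined\<close> outside their domain, so that distinct
  elements of the following two sets are distinct as maps.\<close>

definition hs_mor ::
    "('g, 'e1::euclidean_space, 'x, 'f1::euclidean_space) groupoid \<Rightarrow>
     ('h, 'e2::euclidean_space, 'y, 'f2::euclidean_space) groupoid \<Rightarrow>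
     ('p, 'd1::euclidean_space, 'g, 'x, 'h, 'y) hs_bundle \<Rightarrow>
     ('q, 'd2::euclidean_space, 'g, 'x, 'h, 'y) hs_bundle \<Rightarrow> ('p \<Rightarrow> 'q) set" where
  "hs_mor G H P1 P2 = {\<sigma> \<in> extensional (pts (Tot P1)).
     smooth_map (Tot P1) (Tot P2) \<sigma> \<and>
     (\<forall>p\<in>pts (Tot P1). proj P2 (\<sigma> p) = proj P1 p) \<and>
     (\<forall>p\<in>pts (Tot P1). mom P2 (\<sigma> p) = mom P1 p) \<and>
     (\<forall>p\<in>pts (Tot P1). \<forall>h\<in>pts (Arr H). tgt H h = mom P1 p \<longrightarrow>
        \<sigma> (ract P1 p h) = ract P2 (\<sigma> p) h) \<and>
     (\<forall>p\<in>pts (Tot P1). \<forall>g\<in>pts (Arr G). src G g = proj P1 p \<longrightarrow>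
        \<sigma> (lact P1 g p) = lact P2 g (\<sigma> p))}"

definition odot ::
    "('p, 'd1::euclidean_space, 'g, 'x, 'h, 'y) hs_bundle \<Rightarrow>
     ('q, 'd2::euclidean_space, 'g, 'x, 'h, 'y) hs_bundle \<Rightarrow> ('p \<times> 'q, 'd1 \<times> 'd2) mfd" where
  "odot P1 P2 = fibre_product (Tot P1) (Tot P2) (proj P1) (proj P2)"

definition hs_gauge ::
    "('g, 'e1::euclidean_space, 'x, 'f1::euclidean_space) groupoid \<Rightarrow>
     ('h, 'e2::euclidean_space, 'y, 'f2::euclidean_space) groupoid \<Rightarrow>
     ('p, 'd1::euclidean_space, 'g, 'x, 'h, 'y) hs_bundle \<Rightarrow>
     ('q, 'd2::euclidean_space, 'g, 'x, 'h, 'y) hs_bundle \<Rightarrow> ('p \<times> 'q \<Rightarrow> 'h) set" where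
  "hs_gauge G H P1 P2 = {K \<in> extensional (pts (odot P1 P2)).
     smooth_map (odot P1 P2) (Arr H) K \<and>
     (\<forall>(p1, p2)\<in>pts (odot P1 P2). src H (K (p1, p2)) = mom P1 p1) \<and>
     (\<forall>(p1, p2)\<in>pts (odot P1 P2). tgt H (K (p1, p2)) = mom P2 p2) \<and>
     (\<forall>(p1, p2)\<in>pts (odot P1 P2). \<forall>h1\<in>pts (Arr H). \<forall>h2\<in>pts (Arr H).
        tgt H h1 = mom P1 p1 \<longrightarrow> tgt H h2 = mom P2 p2 \<longrightarrow>
        K (ract P1 p1 h1, ract P2 p2 h2) = mul H (mul H (ginv H h2) (K (p1, p2))) h1) \<and>
     (\<forall>(p1, p2)\<in>pts (odot P1 P2). \<forall>g\<in>pts (Arr G). src G g = proj P1 p1 \<longrightarrow>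
        K (lact P1 g p1, lact P2 g p2) = K (p1, p2))}"

end

theory Submission
  imports Defs
begin

text \<open>The fibres of a principal \<open>H\<close>-bundle are torsors, so two points \<open>q, q'\<close> of the same fibre have a
  quotient: the unique arrow \<open>h\<close> with \<open>q h = q'\<close>.  A morphism \<open>\<sigma>\<close> preserves the projections to the
  objects of \<open>G\<close>, hence \<open>q\<close> and \<open>\<sigma> p\<close> lie in one fibre for every \<open>(p, q)\<close> in \<open>P1 \<odot> P2\<close>, and
  \<open>K (p, q)\<close> is defined by \<open>q K(p, q) = \<sigma> p\<close>.  Conversely, equivariance of a gauge transformation
  \<open>K\<close> makes \<open>q K(p, q)\<close> independent of \<open>q\<close>, and this common value is \<open>\<sigma> p\<close>.  The two
  constructions are inverse to each other, and the equivariance conditions of one side translate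
  into those of the other by the groupoid laws (\<open>gauge_of_in_hs_gauge\<close>, \<open>mor_of_in_hs_mor\<close>).

  The analytic content is smoothness.  The map \<open>K\<close> is smooth because the quotient map is a component
  of the inverse of the diffeomorphism \<open>(q, h) \<mapsto> (q, q h)\<close> (\<open>smooth_map_division\<close>).  The map \<open>\<sigma>\<close> is
  smooth because locally \<open>\<sigma> p = s(x) K(p, s(x))\<close>, where \<open>x\<close> is the projection of \<open>p\<close> and \<open>s\<close> is a
  smooth local section of the projection of \<open>P2\<close> (\<open>submersion_local_section\<close>).

  Both arguments compose smooth maps through fibre products.  Smoothness of a map on a fibre product
  is tested in slice charts, so it can be used only where slice charts exist; that they cover every
  fibre product along a submersion is \<open>charted_fibre_product\<close>.  Slice charts and local sections come
  from one source, the inverse function theorem for smooth maps on an open subset of a linear subspace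
  (\<open>local_diffeomorphism_subspace\<close>).  It is applied only to maps whose derivative at the
  base point is the identity: such a map is built in each case from a linear right inverse of the
  derivative of the submersion.\<close>


section \<open>Calculus on open subsets of linear subspaces\<close>

lemma at_within_openin:
  assumes "openin (top_of_set L) W" "x \<in> W"
  shows "at x within W = at x within L"
proof -
  obtain S where "open S" "W = L \<inter> S"
    using assms(1) by (auto simp: openin_open)
  with assms(2) show ?thesis
    by (intro at_within_nhd[where S = S]) auto
qed

lemma has_derivative_cong_openin:
  assumes "openin (top_of_set L) W" "x \<in> W" "\<And>y. y \<in> W \<Longrightarrow> f y = g y"
    and "(f has_derivative D) (at x within L)"
  shows "(g has_derivative D) (at x within L)"
  using has_derivative_transform[of x W g f D] assms at_within_openin[OF assms(1,2)] by auto

text \<open>Restricting to a line through \<open>x\<close> in a direction \<open>v \<in> L\<close> determines \<open>D v\<close>.  Off \<open>L\<close> the map \<open>D\<close> is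
  arbitrary, which is why derivatives obtained in different ways are compared on \<open>L\<close> only.\<close>

lemma has_derivative_subspace_unique:
  assumes "subspace L" "x \<in> L" "v \<in> L"
    and D: "(f has_derivative D) (at x within L)" "(f has_derivative D') (at x within L)"
  shows "D v = D' v"
proof -
  have line: "((\<lambda>t::real. x + t *\<^sub>R v) has_derivative (\<lambda>t. t *\<^sub>R v)) (at 0)"
    by (auto intro!: derivative_eq_intros)
  have sub: "range (\<lambda>t::real. x + t *\<^sub>R v) \<subseteq> L"
    using assms(1-3) by (auto intro: subspace_add subspace_scale)
  have "((\<lambda>t. f (x + t *\<^sub>R v)) has_derivative (\<lambda>t. D'' (t *\<^sub>R v))) (at 0)"
    if "(f has_derivative D'') (at x within L)" for D''
    using has_derivative_in_compose[OF line, of f D''] has_derivative_subset[OF that sub] by simp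
  from has_derivative_unique[OF this[OF D(1)] this[OF D(2)]] show ?thesis
    by (metis scaleR_one)
qed

text \<open>The projection serves to extend maps from \<open>L\<close> to the whole space and to move the values of a
  derivative into a subspace; its explicit form expands a vector in an orthonormal basis.\<close>

lemma subspace_projection:
  fixes J :: "'a::euclidean_space set"
  assumes "subspace J"
  obtains B p where "finite B" "B \<subseteq> J" "p = (\<lambda>w. \<Sum>b\<in>B. (w \<bullet> b) *\<^sub>R b)"
    "bounded_linear p" "\<And>w. p w \<in> J" "\<And>w. w \<in> J \<Longrightarrow> p w = w"
proof -
  obtain B where B: "B \<subseteq> J" "pairwise orthogonal B" "\<And>x. x \<in> B \<Longrightarrow> norm x = 1"
      "independent B" "span B = J"
    using orthonormal_basis_subspace[OF assms] by metis
  have fin: "finite B" using B(4) independent_imp_finite by blast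
  define p where "p = (\<lambda>w. \<Sum>b\<in>B. (w \<bullet> b) *\<^sub>R b)"
  have bl: "bounded_linear p"
    unfolding p_def
    by (intro bounded_linear_sum bounded_linear_compose[OF bounded_linear_scaleR_left bounded_linear_inner_left])
  have pJ: "p w \<in> J" for w
    unfolding p_def using B(1) assms by (intro subspace_sum subspace_scale) auto
  have pb: "p b = b" if "b \<in> B" for b
  proof -
    have "(b \<bullet> c) *\<^sub>R c = (if c = b then b else 0)" if "c \<in> B" for c
      using B(2,3) \<open>b \<in> B\<close> that
      by (auto simp: pairwise_def orthogonal_def dot_square_norm)
    then have "p b = (\<Sum>c\<in>B. if c = b then b else 0)"
      unfolding p_def by (intro sum.cong) auto
    then show ?thesis using fin that by simp
  qed
  have "p w = w" if "w \<in> J" for w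
  proof -
    have "w \<in> span B" using that B(5) by simp
    then show ?thesis
      by (induction rule: span_induct_alt)
        (auto simp: pb linear_0 linear_add linear_scale bounded_linear.linear[OF bl])
  qed
  from that[OF fin B(1) p_def bl pJ this] show ?thesis .
qed

text \<open>Since \<open>f\<close> takes values in \<open>J\<close>, it is unchanged by projection to \<open>J\<close>, and so is its derivative in
  directions in \<open>L\<close>.  Projecting also forces the values in directions outside \<open>L\<close> into \<open>J\<close>.\<close>

lemma derivative_into_subspace:
  fixes f :: "'e::euclidean_space \<Rightarrow> 'f::euclidean_space"
  assumes "subspace J" "openin (top_of_set L) W" "x \<in> W" "f ` W \<subseteq> J"
    and D: "(f has_derivative D) (at x within L)"
  obtains D' where "(f has_derivative D') (at x within L)" "range D' \<subseteq> J"
proof -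
  obtain p where p: "bounded_linear p" "\<And>w. p w \<in> J" "\<And>w. w \<in> J \<Longrightarrow> p w = w"
    using subspace_projection[OF assms(1)] by metis
  have "((\<lambda>z. p (f z)) has_derivative (\<lambda>v. p (D v))) (at x within L)"
    using bounded_linear.has_derivative[OF p(1) D] .
  then have "(f has_derivative (\<lambda>v. p (D v))) (at x within L)"
    by (rule has_derivative_cong_openin[OF assms(2,3), rotated]) (use p(3) assms(4) in auto)
  then show ?thesis by (rule that) (use p(2) in auto)
qed

lemma has_derivative_compose_subspace:
  assumes W: "openin (top_of_set L) W" "x \<in> W" and "f ` W \<subseteq> J"
    and f: "(f has_derivative D) (at x within L)"
    and g: "(g has_derivative E) (at (f x) within J)"
  shows "((\<lambda>x. g (f x)) has_derivative (\<lambda>v. E (D v))) (at x within L)"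
proof -
  have "(f has_derivative D) (at x within W)"
    using f at_within_openin[OF W] by simp
  from has_derivative_in_compose[OF this has_derivative_subset[OF g assms(3)]]
  show ?thesis using at_within_openin[OF W] by simp
qed

lemma Ck_on_SucI:
  assumes "\<And>x. x \<in> W \<Longrightarrow> (f has_derivative D x) (at x within L)"
    and "\<And>v. v \<in> L \<Longrightarrow> Ck_on k L W (\<lambda>x. D x v)"
  shows "Ck_on (Suc k) L W f"
  unfolding Ck_on.simps using assms by (intro exI[of _ D]) simp

lemma Ck_on_SucE:
  assumes "Ck_on (Suc k) L W f"
  obtains D where "\<forall>x\<in>W. (f has_derivative D x) (at x within L)"
    "\<forall>v\<in>L. Ck_on k L W (\<lambda>x. D x v)"
  using assms unfolding Ck_on.simps by (elim exE conjE) (rule that)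

lemma Ck_on_cong:
  assumes "openin (top_of_set L) W" "\<And>x. x \<in> W \<Longrightarrow> f x = g x" "Ck_on k L W f"
  shows "Ck_on k L W g"
proof (cases k)
  case 0
  then show ?thesis using assms continuous_on_cong[of W W f g] by auto
next
  case (Suc n)
  obtain D where "\<forall>x\<in>W. (f has_derivative D x) (at x within L)"
      "\<forall>v\<in>L. Ck_on n L W (\<lambda>x. D x v)"
    using assms(3) unfolding Suc by (rule Ck_on_SucE)
  note D = this[rule_format]
  show ?thesis
    unfolding Suc
    by (rule Ck_on_SucI[OF has_derivative_cong_openin[OF assms(1) _ assms(2) D(1)] D(2)])
qed

lemma Ck_on_mono:
  assumes "Ck_on k L W f" "L' \<subseteq> L" "W' \<subseteq> W"
  shows "Ck_on k L' W' f"
  using assms(1)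
proof (induction k arbitrary: f)
  case 0
  then show ?case using continuous_on_subset assms(3) by auto
next
  case (Suc k)
  obtain D where "\<forall>x\<in>W. (f has_derivative D x) (at x within L)"
      "\<forall>v\<in>L. Ck_on k L W (\<lambda>x. D x v)"
    using Suc.prems by (rule Ck_on_SucE)
  note D = this[rule_format]
  show ?case
  proof (rule Ck_on_SucI)
    show "(f has_derivative D x) (at x within L')" if "x \<in> W'" for x
      using has_derivative_subset[OF D(1) assms(2)] assms(3) that by (simp add: subset_iff)
    show "Ck_on k L' W' (\<lambda>x. D x v)" if "v \<in> L'" for v
      using Suc.IH[OF D(2)] assms(2) that by (simp add: subset_iff)
  qed
qed

lemma Ck_on_Suc_imp:
  assumes "Ck_on (Suc k) L W f" "W \<subseteq> L"
  shows "Ck_on k L W f"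
  using assms(1)
proof (induction k arbitrary: f)
  case 0
  obtain D where "\<forall>x\<in>W. (f has_derivative D x) (at x within L)"
    using 0 by (rule Ck_on_SucE)
  note D = this[rule_format]
  have "continuous (at x within W) f" if "x \<in> W" for x
    using has_derivative_continuous[OF has_derivative_subset[OF D assms(2)]] that .
  then show ?case by (simp add: continuous_on_eq_continuous_within)
next
  case (Suc k)
  obtain D where "\<forall>x\<in>W. (f has_derivative D x) (at x within L)"
      "\<forall>v\<in>L. Ck_on (Suc k) L W (\<lambda>x. D x v)"
    using Suc.prems by (rule Ck_on_SucE)
  note D = this[rule_format]
  show ?case
    by (rule Ck_on_SucI[OF D(1) Suc.IH[OF D(2)]])
qed

text \<open>Derivatives chosen near different points agree on \<open>L\<close> where both are defined.  Therefore the
  diagonal choice \<open>x \<mapsto> D x x\<close> coincides near each point \<open>z\<close> with the single family \<open>D z\<close>.\<close>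

lemma Ck_on_local:
  assumes "subspace L" "openin (top_of_set L) W"
    and "\<And>x. x \<in> W \<Longrightarrow> \<exists>W'. openin (top_of_set L) W' \<and> x \<in> W' \<and> W' \<subseteq> W \<and> Ck_on k L W' f"
  shows "Ck_on k L W f"
  using assms(3)
proof (induction k arbitrary: f)
  case 0
  show ?case
    unfolding Ck_on.simps continuous_on_eq_continuous_within
  proof
    fix x assume "x \<in> W"
    with 0 obtain W' where W': "openin (top_of_set L) W'" "x \<in> W'" "W' \<subseteq> W" "continuous_on W' f"
      by auto
    then show "continuous (at x within W) f"
      using at_within_openin[of L W' x] at_within_openin[of L W x] \<open>x \<in> W\<close> assms(2)
      by (metis continuous_on_eq_continuous_within)
  qed
next
  case (Suc k)

  define P where "P = (\<lambda>W' D. openin (top_of_set L) W' \<and> W' \<subseteq> W \<and>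
    (\<forall>y\<in>W'. (f has_derivative D y) (at y within L)) \<and> (\<forall>v\<in>L. Ck_on k L W' (\<lambda>y. D y v)))"
  have "\<exists>W' D. x \<in> W' \<and> P W' D" if "x \<in> W" for x
  proof -
    obtain W' where "openin (top_of_set L) W'" "x \<in> W'" "W' \<subseteq> W" "Ck_on (Suc k) L W' f"
      using Suc.prems[OF \<open>x \<in> W\<close>] by (elim exE conjE) (rule that)
    moreover from this(4) obtain D where "\<forall>y\<in>W'. (f has_derivative D y) (at y within L)"
      "\<forall>v\<in>L. Ck_on k L W' (\<lambda>y. D y v)"
      by (rule Ck_on_SucE)
    ultimately have "x \<in> W' \<and> P W' D" unfolding P_def by simp
    then show ?thesis by (intro exI)
  qed
  then obtain N D where ND: "\<And>x. x \<in> W \<Longrightarrow> x \<in> N x \<and> P (N x) (D x)"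
    by metis
  have "(f has_derivative D x x) (at x within L)" if "x \<in> W" for x
    using ND[OF that] unfolding P_def by simp
  moreover have "Ck_on k L W (\<lambda>x. D x x v)" if v: "v \<in> L" for v
  proof (rule Suc.IH)
    fix z assume z: "z \<in> W"
    have Nz: "Ck_on k L (N z) (\<lambda>y. D z y v)" "openin (top_of_set L) (N z)" "N z \<subseteq> W" "z \<in> N z"
      using ND[OF z] v unfolding P_def by simp_all
    have "D z y v = D y y v" if "y \<in> N z" for y
    proof (rule has_derivative_subspace_unique[OF assms(1) _ v, where f = f and x = y])
      show "y \<in> L" using \<open>openin (top_of_set L) (N z)\<close> that openin_imp_subset by blast
      show "(f has_derivative D z y) (at y within L)"
        using ND[OF z] that unfolding P_def by simp
      have "y \<in> W" using \<open>N z \<subseteq> W\<close> that by blast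
      then show "(f has_derivative D y y) (at y within L)"
        using ND[of y] unfolding P_def by simp
    qed
    from Ck_on_cong[OF Nz(2) this Nz(1)] Nz(2-4)
    show "\<exists>W'. openin (top_of_set L) W' \<and> z \<in> W' \<and> W' \<subseteq> W \<and> Ck_on k L W' (\<lambda>x. D x x v)"
      by (intro exI[of _ "N z"] conjI)
  qed
  ultimately show ?case by (rule Ck_on_SucI)
qed

lemma Ck_on_const: "Ck_on k L W (\<lambda>x. c)"
proof (induction k arbitrary: c)
  case (Suc k)
  show ?case by (rule Ck_on_SucI[OF has_derivative_const Suc])
qed auto

lemma Ck_on_bounded_linear:
  assumes "bounded_linear f"
  shows "Ck_on k L W f"
proof (cases k)
  case 0
  then show ?thesis using assms by (simp add: linear_continuous_on)
next
  case (Suc n)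
  show ?thesis
    unfolding Suc
    by (rule Ck_on_SucI[OF bounded_linear_imp_has_derivative[OF assms] Ck_on_const])
qed

lemma Ck_on_linear_compose:
  assumes "bounded_linear h" "Ck_on k L W f"
  shows "Ck_on k L W (\<lambda>x. h (f x))"
  using assms(2)
proof (induction k arbitrary: f)
  case 0
  then show ?case using assms(1) by (simp add: bounded_linear.continuous_on)
next
  case (Suc k)
  obtain D where "\<forall>x\<in>W. (f has_derivative D x) (at x within L)"
      "\<forall>v\<in>L. Ck_on k L W (\<lambda>x. D x v)"
    using Suc.prems by (rule Ck_on_SucE)
  note D = this[rule_format]
  show ?case
    by (rule Ck_on_SucI[OF bounded_linear.has_derivative[OF assms(1) D(1)] Suc.IH[OF D(2)]])
qed

lemma Ck_on_add:
  assumes "Ck_on k L W f" "Ck_on k L W g"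
  shows "Ck_on k L W (\<lambda>x. f x + g x)"
  using assms
proof (induction k arbitrary: f g)
  case 0
  then show ?case by (simp add: continuous_on_add)
next
  case (Suc k)
  obtain D where "\<forall>x\<in>W. (f has_derivative D x) (at x within L)"
      "\<forall>v\<in>L. Ck_on k L W (\<lambda>x. D x v)"
    using Suc.prems(1) by (rule Ck_on_SucE)
  note D = this[rule_format]
  obtain E where "\<forall>x\<in>W. (g has_derivative E x) (at x within L)"
      "\<forall>v\<in>L. Ck_on k L W (\<lambda>x. E x v)"
    using Suc.prems(2) by (rule Ck_on_SucE)
  note E = this[rule_format]
  show ?case
    by (rule Ck_on_SucI[OF has_derivative_add[OF D(1) E(1)] Suc.IH[OF D(2) E(2)]])
qed

lemma Ck_on_diff:
  assumes "Ck_on k L W f" "Ck_on k L W g"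
  shows "Ck_on k L W (\<lambda>x. f x - g x)"
  using Ck_on_add[OF assms(1) Ck_on_linear_compose[OF bounded_linear_minus[OF bounded_linear_ident] assms(2)]]
  by simp

lemma Ck_on_sum:
  assumes "finite B" "\<And>b. b \<in> B \<Longrightarrow> Ck_on k L W (f b)"
  shows "Ck_on k L W (\<lambda>x. \<Sum>b\<in>B. f b x)"
  using assms
  by (induction B rule: finite_induct) (auto intro!: Ck_on_const Ck_on_add)

lemma Ck_on_scaleR:
  fixes f :: "'e::euclidean_space \<Rightarrow> real"
  assumes "Ck_on k L W f" "Ck_on k L W g" "W \<subseteq> L"
  shows "Ck_on k L W (\<lambda>x. f x *\<^sub>R g x)"
  using assms(1,2)
proof (induction k arbitrary: f g)
  case 0
  then show ?case by (simp add: continuous_on_scaleR)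
next
  case (Suc k)
  obtain D where "\<forall>x\<in>W. (f has_derivative D x) (at x within L)"
      "\<forall>v\<in>L. Ck_on k L W (\<lambda>x. D x v)"
    using Suc.prems(1) by (rule Ck_on_SucE)
  note D = this[rule_format]
  obtain E where "\<forall>x\<in>W. (g has_derivative E x) (at x within L)"
      "\<forall>v\<in>L. Ck_on k L W (\<lambda>x. E x v)"
    using Suc.prems(2) by (rule Ck_on_SucE)
  note E = this[rule_format]
  note fg = Suc.prems[THEN Ck_on_Suc_imp, OF assms(3)]
  show ?case
    by (rule Ck_on_SucI[OF has_derivative_scaleR[OF D(1) E(1)]
          Ck_on_add[OF Suc.IH[OF fg(1) E(2)] Suc.IH[OF D(2) fg(2)]]])
qed

lemma Ck_on_Pair:
  assumes "Ck_on k L W f" "Ck_on k L W g"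
  shows "Ck_on k L W (\<lambda>x. (f x, g x))"
  using Ck_on_add[OF Ck_on_linear_compose[OF bounded_linear_Pair[OF bounded_linear_ident bounded_linear_zero] assms(1)]
      Ck_on_linear_compose[OF bounded_linear_Pair[OF bounded_linear_zero bounded_linear_ident] assms(2)]]
  by simp

text \<open>In the chain rule \<open>v \<mapsto> E (f x) (D x v)\<close> the linear map and its argument both depend on \<open>x\<close>.
  Expanding \<open>D x v\<close> in an orthonormal basis of \<open>J\<close> yields a finite sum of products of scalar functions
  with functions \<open>E (f x) b\<close>, to which the induction hypothesis applies.  The expansion is legitimate
  once the values of \<open>D x\<close> have been projected to \<open>J\<close>.\<close>

lemma Ck_on_compose:
  fixes f :: "'e::euclidean_space \<Rightarrow> 'f::euclidean_space"
    and g :: "'f \<Rightarrow> 'k::euclidean_space"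
  assumes "subspace L" "subspace J" "openin (top_of_set L) W" "V \<subseteq> J"
    and "Ck_on k L W f" "f ` W \<subseteq> V" "Ck_on k J V g"
  shows "Ck_on k L W (\<lambda>x. g (f x))"
  using assms(5,7)
proof (induction k arbitrary: g)
  case 0
  then show ?case using assms(6) continuous_on_compose2 by auto
next
  case (Suc k)
  obtain B p where B: "finite B" "B \<subseteq> J" "p = (\<lambda>w. \<Sum>b\<in>B. (w \<bullet> b) *\<^sub>R b)"
    and p: "bounded_linear p" "\<And>w. p w \<in> J" "\<And>w. w \<in> J \<Longrightarrow> p w = w"
    using subspace_projection[OF assms(2)] by blast
  have WL: "W \<subseteq> L" using assms(3) openin_imp_subset by blast
  have fk: "Ck_on k L W f" using Ck_on_Suc_imp[OF Suc.prems(1) WL] .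
  obtain D where "\<forall>x\<in>W. (f has_derivative D x) (at x within L)"
      "\<forall>v\<in>L. Ck_on k L W (\<lambda>x. D x v)"
    using Suc.prems(1) by (rule Ck_on_SucE)
  note D = this[rule_format]
  obtain E where "\<forall>y\<in>V. (g has_derivative E y) (at y within J)"
      "\<forall>v\<in>J. Ck_on k J V (\<lambda>y. E y v)"
    using Suc.prems(2) by (rule Ck_on_SucE)
  note E = this[rule_format]
  let ?C = "\<lambda>x v. \<Sum>b\<in>B. (D x v \<bullet> b) *\<^sub>R E (f x) b"
  have "((\<lambda>x. g (f x)) has_derivative ?C x) (at x within L)" if x: "x \<in> W" for x
  proof -
    have lin: "linear (E (f x))"
      using E(1)[of "f x"] assms(6) x by (auto dest: has_derivative_linear)
    have "((\<lambda>z. p (f z)) has_derivative (\<lambda>v. p (D x v))) (at x within L)"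
      using bounded_linear.has_derivative[OF p(1) D(1)[OF x]] .
    then have f: "(f has_derivative (\<lambda>v. p (D x v))) (at x within L)"
      by (rule has_derivative_cong_openin[OF assms(3) x, rotated]) (use p(3) assms(4,6) in auto)
    have "f x \<in> V" using assms(6) x by blast
    from has_derivative_compose_subspace[OF assms(3) x order_trans[OF assms(6,4)] f E(1)[OF this]]
    have "((\<lambda>x. g (f x)) has_derivative (\<lambda>v. E (f x) (p (D x v)))) (at x within L)" .
    also have "(\<lambda>v. E (f x) (p (D x v))) = ?C x"
      by (simp add: B(3) linear_sum[OF lin] linear_scale[OF lin])
    finally show ?thesis .
  qed
  moreover have "Ck_on k L W (\<lambda>x. ?C x v)" if "v \<in> L" for v
  proof (intro Ck_on_sum B(1) Ck_on_scaleR WL)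
    fix b assume "b \<in> B"
    show "Ck_on k L W (\<lambda>x. D x v \<bullet> b)"
      using Ck_on_linear_compose[OF bounded_linear_inner_left D(2)[OF that]] .
    show "Ck_on k L W (\<lambda>x. E (f x) b)"
      using Suc.IH[OF fk, of "\<lambda>y. E y b"] E(2) B(2) \<open>b \<in> B\<close> by auto
  qed
  ultimately show ?case by (rule Ck_on_SucI)
qed

section \<open>The inverse function theorem for smooth maps\<close>

text \<open>A product rule for a factor \<open>c\<close> that vanishes at the point in question: continuity of the other
  factor is then enough.  It is used below to differentiate the inverse of the derivative before that
  inverse is known to be differentiable.\<close>

lemma has_derivative_scaleR_vanishing:
  fixes c :: "'a::real_normed_vector \<Rightarrow> real" and e :: "'a \<Rightarrow> 'b::real_normed_vector"
  assumes c: "(c has_derivative c') (at y)" and c0: "c y = 0" and e: "continuous (at y) e"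
  shows "((\<lambda>z. c z *\<^sub>R e z) has_derivative (\<lambda>u. c' u *\<^sub>R e y)) (at y)"
proof -
  have bl: "bounded_linear c'" using c by (rule has_derivative_bounded_linear)
  obtain K where K: "\<And>u. norm (c' u) \<le> norm u * K" "K \<ge> 0"
    using bounded_linear.nonneg_bounded[OF bl] by blast
  let ?q = "\<lambda>z. (1 / norm (z - y)) *\<^sub>R (c z - c' (z - y))"
  let ?r = "\<lambda>z. (1 / norm (z - y)) *\<^sub>R (c' (z - y) *\<^sub>R (e z - e y))"
  have e0: "((\<lambda>z. e z - e y) \<longlongrightarrow> 0) (at y)"
    using e by (simp add: continuous_at LIM_zero)
  have "(?q \<longlongrightarrow> 0) (at y)"
    using c c0 by (auto simp: has_derivative_within)
  from tendsto_scaleR[OF this e0] have q: "((\<lambda>z. ?q z *\<^sub>R (e z - e y)) \<longlongrightarrow> 0) (at y)"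
    by simp
  have "norm (?r z) \<le> K * norm (e z - e y)" for z
  proof (cases "z = y")
    case True
    then show ?thesis using K(2) by simp
  next
    case False
    have "norm (c' (z - y)) / norm (z - y) \<le> K"
      using K(1)[of "z - y"] False by (simp add: divide_le_eq mult.commute)
    from mult_right_mono[OF this norm_ge_zero[of "e z - e y"]] show ?thesis
      by simp
  qed
  moreover have "((\<lambda>z. K * norm (e z - e y)) \<longlongrightarrow> 0) (at y)"
    using tendsto_mult[OF tendsto_const tendsto_norm[OF e0]] by simp
  ultimately have r: "(?r \<longlongrightarrow> 0) (at y)"
    using Lim_null_comparison[of ?r "\<lambda>z. K * norm (e z - e y)" "at y"] by simp
  have split: "?q z *\<^sub>R (e z - e y) + ?r z = (1 / norm (z - y)) *\<^sub>R (c z *\<^sub>R (e z - e y))" for z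
    by (simp add: diff_divide_distrib scaleR_left_diff_distrib)
  have "((\<lambda>z. (1 / norm (z - y)) *\<^sub>R (c z *\<^sub>R (e z - e y))) \<longlongrightarrow> 0) (at y)"
    using tendsto_add[OF q r] by (simp only: split add_0_left)
  then have "((\<lambda>z. c z *\<^sub>R (e z - e y)) has_derivative (\<lambda>u. 0)) (at y)"
    using c0 by (simp add: has_derivative_within)
  from has_derivative_add[OF has_derivative_scaleR_left[OF c, of "e y"] this]
  show ?thesis by (simp add: scaleR_right_diff_distrib)
qed

text \<open>In the definition of smoothness the derivative may depend on the order \<open>k\<close>; by uniqueness on \<open>L\<close>
  one derivative works for all orders.\<close>

lemma smooth_on_derivative:
  assumes "subspace L" "openin (top_of_set L) W" "smooth_on L W f"
  obtains D where "\<forall>x\<in>W. (f has_derivative D x) (at x within L)"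
    "\<forall>v\<in>L. smooth_on L W (\<lambda>x. D x v)"
proof -
  obtain D where "\<forall>x\<in>W. (f has_derivative D x) (at x within L)"
    using assms(3) unfolding smooth_on_def by (meson Ck_on_SucE)
  note D = this[rule_format]
  have "Ck_on k L W (\<lambda>x. D x v)" if v: "v \<in> L" for k v
  proof -
    have "Ck_on (Suc k) L W f" using assms(3) by (simp add: smooth_on_def)
    then obtain D' where "\<forall>x\<in>W. (f has_derivative D' x) (at x within L)"
      "\<forall>v\<in>L. Ck_on k L W (\<lambda>x. D' x v)"
      by (rule Ck_on_SucE)
    note D' = this[rule_format]
    have "D' x v = D x v" if "x \<in> W" for x
      using has_derivative_subspace_unique[OF assms(1) _ v D'(1) D] that assms(2)
      by (meson openin_imp_subset subsetD)
    from Ck_on_cong[OF assms(2) this D'(2)[OF v]] show ?thesis .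
  qed
  then show ?thesis
    using that[of D] D by (simp add: smooth_on_def)
qed

lemma linear_euclidean_expand:
  fixes f :: "'a::euclidean_space \<Rightarrow> 'b::real_vector"
  assumes "linear f"
  shows "f v = (\<Sum>b\<in>Basis. (v \<bullet> b) *\<^sub>R f b)"
proof -
  have "f v = f (\<Sum>b\<in>Basis. (v \<bullet> b) *\<^sub>R b)" by (simp add: euclidean_representation)
  then show ?thesis by (simp only: linear_sum[OF assms] linear_scale[OF assms])
qed

text \<open>Write \<open>E y\<close> for the derivative of the inverse \<open>g\<close>, that is, for the inverse of \<open>D (g y)\<close>.  With
  \<open>w = E y v\<close> one has \<open>E z v = E y v - E z (D (g z) w - D (g y) w)\<close>.  The argument of \<open>E z\<close> on the right
  is differentiable in \<open>z\<close> and vanishes at \<open>z = y\<close>, so the continuity of \<open>E\<close>, which follows from the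
  bound \<open>C\<close>, gives the derivative of \<open>E\<close> in terms of \<open>E\<close>, \<open>g\<close> and second derivatives.  Hence \<open>E\<close> gains
  one order of differentiability over \<open>E\<close> and \<open>g\<close>, and induction on the order applies to both at once.\<close>

lemma Ck_on_inverse:
  fixes g :: "'a::euclidean_space \<Rightarrow> 'a"
  assumes "open U" "open V" and gV: "g ` V \<subseteq> U"
    and linD: "\<And>x. x \<in> U \<Longrightarrow> linear (D x)"
    and smD: "\<And>v. smooth_on UNIV U (\<lambda>x. D x v)"
    and gE: "\<And>y. y \<in> V \<Longrightarrow> (g has_derivative E y) (at y)"
    and DE: "\<And>y v. y \<in> V \<Longrightarrow> D (g y) (E y v) = v"
    and ED: "\<And>y v. y \<in> V \<Longrightarrow> E y (D (g y) v) = v"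
    and bd: "\<And>y v. y \<in> V \<Longrightarrow> norm (E y v) \<le> C * norm v"
  shows "Ck_on k UNIV V g \<and> (\<forall>v. Ck_on k UNIV V (\<lambda>y. E y v))"
proof -
  have linE: "linear (E y)" if "y \<in> V" for y
    using gE[OF that] has_derivative_linear by blast
  have contg: "continuous_on V g"
    using gE by (auto simp: continuous_on_eq_continuous_at[OF \<open>open V\<close>] intro: has_derivative_continuous)
  have E_eq: "E z v = E y v - E z (D (g z) (E y v) - D (g y) (E y v))" if "y \<in> V" "z \<in> V" for y z v
    using that by (simp add: linear_diff[OF linE] DE ED)
  have contD: "continuous_on V (\<lambda>y. D (g y) w)" for w
  proof -
    have "continuous_on U (\<lambda>x. D x w)"
      using smD[of w] unfolding smooth_on_def by (metis Ck_on.simps(1))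
    then show ?thesis using continuous_on_compose2[OF _ contg gV] by blast
  qed
  have contE: "continuous (at y) (\<lambda>z. E z v)" if y: "y \<in> V" for y v
  proof -
    let ?h = "\<lambda>z. D (g z) (E y v) - D (g y) (E y v)"
    have "continuous (at y) (\<lambda>z. D (g z) (E y v))"
      using contD continuous_on_eq_continuous_at[OF \<open>open V\<close>] y by blast
    then have "((\<lambda>z. C * norm (?h z)) \<longlongrightarrow> C * norm (0::'a)) (at y)"
      by (intro tendsto_intros LIM_zero) (simp add: continuous_at)
    moreover have "\<forall>\<^sub>F z in at y. norm (E z (?h z)) \<le> C * norm (?h z)"
      using eventually_at_in_open'[OF \<open>open V\<close> y] by eventually_elim (rule bd)
    ultimately have "((\<lambda>z. E z (?h z)) \<longlongrightarrow> 0) (at y)"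
      using Lim_null_comparison by fastforce
    then have "((\<lambda>z. E y v - E z (?h z)) \<longlongrightarrow> E y v - 0) (at y)"
      by (intro tendsto_intros)
    moreover have "\<forall>\<^sub>F z in at y. E y v - E z (?h z) = E z v"
      using eventually_at_in_open'[OF \<open>open V\<close> y]
      by eventually_elim (rule E_eq[OF y, symmetric])
    ultimately show ?thesis
      unfolding continuous_at by (simp add: tendsto_cong)
  qed
  show ?thesis
  proof (induction k)
    case 0
    show ?case
      using contg contE by (simp add: continuous_on_eq_continuous_at[OF \<open>open V\<close>])
  next
    case (Suc k)
    then have gk: "Ck_on k UNIV V g" and Ek: "\<And>v. Ck_on k UNIV V (\<lambda>y. E y v)" by auto
    have g: "Ck_on (Suc k) UNIV V g"
      by (rule Ck_on_SucI[OF gE Ek])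
    have "\<forall>b. \<exists>D'. (\<forall>x\<in>U. ((\<lambda>x. D x b) has_derivative D' x) (at x)) \<and>
        (\<forall>v\<in>UNIV. Ck_on k UNIV U (\<lambda>x. D' x v))"
    proof
      fix b
      have "Ck_on (Suc k) UNIV U (\<lambda>x. D x b)" using smD[of b] by (simp only: smooth_on_def)
      then show "\<exists>D'. (\<forall>x\<in>U. ((\<lambda>x. D x b) has_derivative D' x) (at x)) \<and>
        (\<forall>v\<in>UNIV. Ck_on k UNIV U (\<lambda>x. D' x v))"
        unfolding Ck_on.simps .
    qed
    from choice[OF this] obtain D' where
      D': "\<forall>b. (\<forall>x\<in>U. ((\<lambda>x. D x b) has_derivative D' b x) (at x)) \<and>
        (\<forall>v\<in>UNIV. Ck_on k UNIV U (\<lambda>x. D' b x v))"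
      by (elim exE)
    note D' = D'[rule_format, THEN conjunct1, rule_format] D'[rule_format, THEN conjunct2, rule_format, OF UNIV_I]
    let ?H = "\<lambda>y v u. \<Sum>b\<in>Basis. (E y v \<bullet> b) *\<^sub>R D' b (g y) (E y u)"
    have "Ck_on (Suc k) UNIV V (\<lambda>y. E y v)" for v
    proof (rule Ck_on_SucI)
      fix y assume y: "y \<in> V"
      define w where "w = E y v"
      let ?h = "\<lambda>z. D (g z) w - D (g y) w"
      have gy: "g y \<in> U" using gV y by blast
      have "((\<lambda>z. \<Sum>b\<in>Basis. (w \<bullet> b) *\<^sub>R D (g z) b) has_derivative (\<lambda>u. ?H y v u)) (at y)"
        unfolding w_def
        by (intro has_derivative_sum has_derivative_scaleR_right
            has_derivative_compose[OF gE[OF y] D'(1)[OF gy]])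
      then have "((\<lambda>z. D (g z) w) has_derivative (\<lambda>u. ?H y v u)) (at y)"
        by (rule has_derivative_transform_within_open[OF _ \<open>open V\<close> y])
          (use linear_euclidean_expand[OF linD] gV in auto)
      then have h: "(?h has_derivative (\<lambda>u. ?H y v u)) (at y)"
        using has_derivative_diff[OF _ has_derivative_const] by fastforce
      have "((\<lambda>z. \<Sum>d\<in>Basis. (?h z \<bullet> d) *\<^sub>R E z d) has_derivative
          (\<lambda>u. \<Sum>d\<in>Basis. (?H y v u \<bullet> d) *\<^sub>R E y d)) (at y)"
        by (intro has_derivative_sum has_derivative_scaleR_vanishing contE y
            has_derivative_inner_left h) simp
      from has_derivative_diff[OF has_derivative_const[of "E y v"] this]
      show "((\<lambda>z. E z v) has_derivative (\<lambda>u. 0 - (\<Sum>d\<in>Basis. (?H y v u \<bullet> d) *\<^sub>R E y d)))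
          (at y)"
      proof (rule has_derivative_transform_within_open[OF _ \<open>open V\<close> y])
        fix z assume z: "z \<in> V"
        show "E y v - (\<Sum>d\<in>Basis. (?h z \<bullet> d) *\<^sub>R E z d) = E z v"
          using E_eq[OF y z, of v] linear_euclidean_expand[OF linE[OF z], of "?h z"]
          by (simp add: w_def)
      qed
    next
      fix u :: 'a
      have "Ck_on k UNIV V (\<lambda>y. \<Sum>b\<in>Basis. (E y v \<bullet> b) *\<^sub>R
          (\<Sum>c\<in>Basis. (E y u \<bullet> c) *\<^sub>R D' b (g y) c))"
        by (intro Ck_on_sum Ck_on_scaleR Ck_on_linear_compose[OF bounded_linear_inner_left] Ek
            Ck_on_compose[OF subspace_UNIV subspace_UNIV _ _ gk gV D'(2)])
          (auto simp: \<open>open V\<close>)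
      from this have H: "Ck_on k UNIV V (\<lambda>y. ?H y v u)"
      proof (rule Ck_on_cong[rotated 2])
        show "openin (top_of_set UNIV) V" using \<open>open V\<close> by simp
        fix y assume "y \<in> V"
        have "linear (D' b (g y))" for b
          using D'(1) gV \<open>y \<in> V\<close> has_derivative_linear by blast
        then show "(\<Sum>b\<in>Basis. (E y v \<bullet> b) *\<^sub>R (\<Sum>c\<in>Basis. (E y u \<bullet> c) *\<^sub>R D' b (g y) c)) = ?H y v u"
          using linear_euclidean_expand[of "D' _ (g y)" "E y u"] by metis
      qed
      show "Ck_on k UNIV V (\<lambda>y. 0 - (\<Sum>d\<in>Basis. (?H y v u \<bullet> d) *\<^sub>R E y d))"
        by (intro Ck_on_diff Ck_on_const Ck_on_sum Ck_on_scaleR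
            Ck_on_linear_compose[OF bounded_linear_inner_left] Ek H) auto
    qed
    with g show ?case by blast
  qed
qed

text \<open>With \<open>p\<close> the projection to \<open>L\<close>, the map \<open>F z = f (p z) + (z - p z)\<close> extends \<open>f\<close> to an open subset of
  the whole space and has the identity as derivative at \<open>x0\<close>.  A local inverse of \<open>F\<close> maps points
  of \<open>L\<close> to points of \<open>L\<close>, because \<open>F\<close> leaves the component orthogonal to \<open>L\<close> unchanged.\<close>

lemma local_diffeomorphism_subspace:
  fixes f :: "'e::euclidean_space \<Rightarrow> 'e"
  assumes L: "subspace L" and W: "openin (top_of_set L) W" "x0 \<in> W"
    and f: "smooth_on L W f" "f ` W \<subseteq> L"
    and f0: "(f has_derivative D0) (at x0 within L)" "\<And>v. v \<in> L \<Longrightarrow> D0 v = v"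
  obtains W' g where "openin (top_of_set L) W'" "W' \<subseteq> W" "x0 \<in> W'"
    "openin (top_of_set L) (f ` W')" "smooth_on L (f ` W') g" "\<forall>x\<in>W'. g (f x) = x"
proof -
  obtain p :: "'e \<Rightarrow> 'e" where p: "bounded_linear p" "\<And>w. p w \<in> L" "\<And>w. w \<in> L \<Longrightarrow> p w = w"
    using subspace_projection[OF L] by metis
  have WL: "W \<subseteq> L" using W(1) openin_imp_subset by blast
  have x0L: "x0 \<in> L" using W(2) WL by blast
  obtain S where S: "open S" "W = L \<inter> S" using W(1) by (auto simp: openin_open)
  define F where "F = (\<lambda>z. f (p z) + (z - p z))"
  define U0 where "U0 = p -` S"
  have U0: "open U0"
    unfolding U0_def using S(1) linear_continuous_on[OF p(1)] by (simp add: open_vimage)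
  have pU0: "p ` U0 \<subseteq> W" using p(2) S(2) by (auto simp: U0_def)
  have "smooth_on UNIV U0 F"
    unfolding F_def smooth_on_def
  proof
    fix k
    have "Ck_on k L W f" using f(1) by (simp add: smooth_on_def)
    from Ck_on_compose[OF subspace_UNIV L _ WL Ck_on_bounded_linear[OF p(1)] pU0 this]
    have "Ck_on k UNIV U0 (\<lambda>z. f (p z))" by (simp add: U0)
    from Ck_on_add[OF this Ck_on_bounded_linear[OF bounded_linear_sub[OF bounded_linear_ident p(1)]]]
    show "Ck_on k UNIV U0 (\<lambda>z. f (p z) + (z - p z))" .
  qed
  then obtain D where "\<forall>x\<in>U0. (F has_derivative D x) (at x within UNIV)"
      "\<forall>v\<in>UNIV. smooth_on UNIV U0 (\<lambda>x. D x v)"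
    using smooth_on_derivative[OF subspace_UNIV, of U0 F] U0 by (metis open_openin subtopology_UNIV)
  then have D: "\<And>x. x \<in> U0 \<Longrightarrow> (F has_derivative D x) (at x)" "\<And>v. smooth_on UNIV U0 (\<lambda>x. D x v)"
    by simp_all
  define f' where "f' = (\<lambda>x. Blinfun (D x))"
  have f'D: "blinfun_apply (f' x) = D x" if "x \<in> U0" for x
    using D(1)[OF that] by (simp add: f'_def bounded_linear_Blinfun_apply has_derivative_bounded_linear)
  have contf': "continuous_on U0 f'"
  proof (rule continuous_on_blinfun_componentwise)
    fix i :: 'e
    have "continuous_on U0 (\<lambda>x. D x i)"
      using D(2)[of i] unfolding smooth_on_def by (metis Ck_on.simps(1))
    then show "continuous_on U0 (\<lambda>x. f' x i)"
      using f'D by (simp cong: continuous_on_cong)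
  qed
  have x0U: "x0 \<in> U0" using W(2) S(2) p(3) WL by (auto simp: U0_def)
  have D0: "D x0 v = v" for v
  proof -
    have "(f has_derivative D0) (at (p x0) within p ` UNIV)"
      using f0(1) p(2,3) x0L has_derivative_subset by (metis image_subsetI)
    from has_derivative_in_compose[OF bounded_linear_imp_has_derivative[OF p(1)] this]
    have "(F has_derivative (\<lambda>v. D0 (p v) + (v - p v))) (at x0)"
      unfolding F_def
      by (intro has_derivative_add has_derivative_diff has_derivative_ident
          bounded_linear_imp_has_derivative p(1))
    from has_derivative_unique[OF D(1)[OF x0U] this] show ?thesis
      by (simp add: f0(2) p(2))
  qed
  have f'0: "f' x0 = id_blinfun"
    using f'D[OF x0U] D0 by (intro blinfun_eqI) simp
  \<comment> \<open>On this neighbourhood the inverses of the derivatives have norm at most 2, which is the bound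
    required for the smoothness of the inverse.\<close>
  define U where "U = {x \<in> U0. dist (f' x) id_blinfun < 1/2}"
  have U: "open U" "x0 \<in> U" "U \<subseteq> U0"
  proof -
    have "continuous_on U0 (\<lambda>x. dist (f' x) id_blinfun)"
      by (intro continuous_intros contf')
    from continuous_open_preimage[OF this U0 open_lessThan[of "1/2"]]
    show "open U" by (simp add: U_def vimage_def Int_def)
  qed (use x0U f'0 in \<open>auto simp: U_def\<close>)
  have invf: "id_blinfun o\<^sub>L f' x0 = id_blinfun"
    by (intro blinfun_eqI) (simp add: f'0)
  obtain U' V g g' where IF: "open U'" "U' \<subseteq> U" "x0 \<in> U'" "open V" "F x0 \<in> V" "homeomorphism U' V F g"
    "\<And>y. y \<in> V \<Longrightarrow> (g has_derivative (g' y)) (at y)"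
    "\<And>y. y \<in> V \<Longrightarrow> g' y = inv (blinfun_apply (f'(g y)))"
    "\<And>y. y \<in> V \<Longrightarrow> bij (blinfun_apply (f'(g y)))"
    by (rule inverse_function_theorem[OF \<open>open U\<close> _ continuous_on_subset[OF contf' \<open>U \<subseteq> U0\<close>] \<open>x0 \<in> U\<close> invf,
          of F]) (use D(1) f'D U(3) in auto)
  have gV: "g ` V \<subseteq> U" using IF(2,6) by (auto simp: homeomorphism_def)
  have DE: "D (g y) (g' y v) = v" and ED: "g' y (D (g y) v) = v" if "y \<in> V" for y v
    using IF(8,9)[OF that] f'D gV U(3) that
    by (metis bij_inv_eq_iff image_subset_iff subsetD)+
  have bd: "norm (g' y v) \<le> 2 * norm v" if "y \<in> V" for y v
  proof -
    let ?w = "g' y v"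
    have gU: "g y \<in> U" using gV that by blast
    have "norm (D (g y) ?w - ?w) = norm ((f' (g y) - id_blinfun) ?w)"
      using f'D gU U(3) by (simp add: blinfun.diff_left subset_iff)
    also have "\<dots> \<le> norm (f' (g y) - id_blinfun) * norm ?w" by (rule norm_blinfun)
    also have "\<dots> \<le> 1/2 * norm ?w"
      using gU by (intro mult_right_mono) (auto simp: U_def dist_norm)
    finally have "norm (v - ?w) \<le> 1/2 * norm ?w" using DE that by simp
    moreover have "norm ?w \<le> norm (v - ?w) + norm v"
      using norm_triangle_ineq4[of v "v - ?w"] by simp
    ultimately show ?thesis by simp
  qed
  have gsm: "Ck_on k UNIV V g" for k
  proof -
    have linD: "linear (D x)" if "x \<in> U" for x using D(1) U(3) that has_derivative_linear by blast
    have smD: "smooth_on UNIV U (\<lambda>x. D x v)" for v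
      using D(2)[of v] Ck_on_mono[OF _ order_refl U(3)] by (auto simp: smooth_on_def)
    show ?thesis
      by (rule Ck_on_inverse[THEN conjunct1, OF \<open>open U\<close> \<open>open V\<close> gV linD smD IF(7) DE ED bd])
  qed
  define W' where "W' = L \<inter> U'"
  have fF: "F x = f x" if "x \<in> L" for x using p(3)[OF that] by (simp add: F_def)
  have W'W: "W' \<subseteq> W" using IF(2) U(3) p(3) S(2) by (auto simp: W'_def U0_def)
  have img: "f ` W' = L \<inter> V"
  proof
    show "f ` W' \<subseteq> L \<inter> V"
    proof
      fix y assume "y \<in> f ` W'"
      then obtain x where x: "x \<in> W'" "y = f x" by blast
      then have "F x \<in> V" using IF(6) unfolding homeomorphism_def W'_def by blast
      then have "y \<in> V" using fF[of x] x by (simp add: W'_def)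
      moreover have "y \<in> L" using f(2) W'W x by blast
      ultimately show "y \<in> L \<inter> V" by blast
    qed
    show "L \<inter> V \<subseteq> f ` W'"
    proof
      fix y assume y: "y \<in> L \<inter> V"
      then have z: "g y \<in> U'" "F (g y) = y"
        using IF(6) unfolding homeomorphism_def by blast+
      have "p (g y) \<in> W" using pU0 z(1) IF(2) U(3) by blast
      then have "f (p (g y)) \<in> L" using f(2) by blast
      then have "y - f (p (g y)) \<in> L" using y L by (simp add: subspace_diff)
      moreover have "y - f (p (g y)) = g y - p (g y)"
        using z(2) unfolding F_def by (metis add_diff_cancel_left')
      ultimately have "g y - p (g y) \<in> L" by simp
      then have "g y \<in> L" using L p(2)[of "g y"] subspace_add by fastforce
      then show "y \<in> f ` W'" using z fF by (auto simp: W'_def intro!: image_eqI[of _ _ "g y"])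
    qed
  qed
  show ?thesis
  proof (rule that[of W' g])
    show "openin (top_of_set L) W'"
      unfolding W'_def using IF(1) by (rule openin_open_Int)
    show "openin (top_of_set L) (f ` W')"
      unfolding img using IF(4) by (rule openin_open_Int)
    show "smooth_on L (f ` W') g"
      using Ck_on_mono[OF gsm subset_UNIV Int_lower2] by (simp add: smooth_on_def img)
    show "\<forall>x\<in>W'. g (f x) = x"
      using IF(6) fF by (auto simp: W'_def homeomorphism_def)
  qed (use W'W IF(3) x0L in \<open>auto simp: W'_def\<close>)
qed

lemma smooth_onD: "smooth_on L W f \<Longrightarrow> Ck_on k L W f"
  by (simp add: smooth_on_def)

lemma smooth_onI: "(\<And>k. Ck_on k L W f) \<Longrightarrow> smooth_on L W f"
  by (simp add: smooth_on_def)

lemma smooth_on_cong: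
  assumes "openin (top_of_set L) W" "\<And>x. x \<in> W \<Longrightarrow> f x = g x" "smooth_on L W f"
  shows "smooth_on L W g"
  by (rule smooth_onI[OF Ck_on_cong[OF assms(1,2) smooth_onD[OF assms(3)]]])

lemma smooth_on_mono:
  assumes "smooth_on L W f" "L' \<subseteq> L" "W' \<subseteq> W"
  shows "smooth_on L' W' f"
  by (rule smooth_onI[OF Ck_on_mono[OF smooth_onD[OF assms(1)] assms(2,3)]])

lemma smooth_on_local:
  assumes "subspace L" "openin (top_of_set L) W"
    and "\<And>x. x \<in> W \<Longrightarrow> \<exists>W'. openin (top_of_set L) W' \<and> x \<in> W' \<and> W' \<subseteq> W \<and> smooth_on L W' f"
  shows "smooth_on L W f"
  unfolding smooth_on_def
proof
  fix k
  show "Ck_on k L W f"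
  proof (rule Ck_on_local[OF assms(1,2)])
    fix x assume "x \<in> W"
    from assms(3)[OF this] obtain W' where "openin (top_of_set L) W'" "x \<in> W'" "W' \<subseteq> W" "smooth_on L W' f"
      by (elim exE conjE) (rule that)
    then show "\<exists>W'. openin (top_of_set L) W' \<and> x \<in> W' \<and> W' \<subseteq> W \<and> Ck_on k L W' f"
      by (intro exI[of _ W']) (simp add: smooth_on_def)
  qed
qed

lemma smooth_on_compose:
  assumes "subspace L" "subspace J" "openin (top_of_set L) W" "V \<subseteq> J"
    and "smooth_on L W f" "f ` W \<subseteq> V" "smooth_on J V g"
  shows "smooth_on L W (\<lambda>x. g (f x))"
  by (rule smooth_onI[OF Ck_on_compose[OF assms(1-4) smooth_onD[OF assms(5)] assms(6) smooth_onD[OF assms(7)]]])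

lemma smooth_on_Pair:
  assumes "smooth_on L W f" "smooth_on L W g"
  shows "smooth_on L W (\<lambda>x. (f x, g x))"
  by (rule smooth_onI[OF Ck_on_Pair[OF assms[THEN smooth_onD]]])

lemma smooth_on_add:
  assumes "smooth_on L W f" "smooth_on L W g"
  shows "smooth_on L W (\<lambda>x. f x + g x)"
  by (rule smooth_onI[OF Ck_on_add[OF assms[THEN smooth_onD]]])

lemma smooth_on_diff:
  assumes "smooth_on L W f" "smooth_on L W g"
  shows "smooth_on L W (\<lambda>x. f x - g x)"
  by (rule smooth_onI[OF Ck_on_diff[OF assms[THEN smooth_onD]]])

lemma smooth_on_const: "smooth_on L W (\<lambda>x. c)"
  by (rule smooth_onI[OF Ck_on_const])

lemma smooth_on_bounded_linear: "bounded_linear f \<Longrightarrow> smooth_on L W f"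
  by (rule smooth_onI[OF Ck_on_bounded_linear])

lemma smooth_on_linear_compose:
  assumes "bounded_linear h" "smooth_on L W f"
  shows "smooth_on L W (\<lambda>x. h (f x))"
  by (rule smooth_onI[OF Ck_on_linear_compose[OF assms(1) smooth_onD[OF assms(2)]]])

lemma smooth_on_imp_continuous_on: "smooth_on L W f \<Longrightarrow> continuous_on W f"
  unfolding smooth_on_def by (metis Ck_on.simps(1))

section \<open>Charts and smooth maps\<close>

text \<open>Everything about a chart is expressed here by open subsets of the manifold and of \<open>L\<close>, without
  the intermediate subspace topologies on \<open>U\<close> and \<open>\<phi> ` U\<close>.\<close>

lemma is_chart_iff:
  "is_chart T (U, L, \<phi>) \<longleftrightarrow>
     openin T U \<and> subspace L \<and> inj_on \<phi> U \<and>
     (\<forall>O'. openin T O' \<longrightarrow> O' \<subseteq> U \<longrightarrow> openin (top_of_set L) (\<phi> ` O')) \<and>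
     (\<forall>W. openin (top_of_set L) W \<longrightarrow> openin T (U \<inter> \<phi> -` W))" (is "?l \<longleftrightarrow> ?r")
proof
  assume l: ?l
  then have U: "openin T U" "subspace L" "openin (top_of_set L) (\<phi> ` U)"
    and hom: "homeomorphic_map (subtopology T U) (top_of_set (\<phi> ` U)) \<phi>"
    by (auto simp: is_chart_def)
  have sp: "topspace (subtopology T U) = U" using openin_subset[OF U(1)] by auto
  have "inj_on \<phi> U" using homeomorphic_imp_injective_map[OF hom] sp by simp
  moreover have "openin (top_of_set L) (\<phi> ` O')" if "openin T O'" "O' \<subseteq> U" for O'
  proof -
    have "openin (subtopology T U) O'" using that by (simp add: openin_subset_topspace_eq openin_open_subtopology[OF U(1)])
    then have "openin (top_of_set (\<phi> ` U)) (\<phi> ` O')"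
      using homeomorphic_imp_open_map[OF hom] by (simp add: open_map_def)
    then show ?thesis using U(3) openin_trans by blast
  qed
  moreover have "openin T (U \<inter> \<phi> -` W)" if "openin (top_of_set L) W" for W
  proof -
    have "openin (top_of_set (\<phi> ` U)) (\<phi> ` U \<inter> W)"
      using that U(3) by (meson openin_Int openin_subset_trans openin_imp_subset Int_lower1)
    then have "openin (subtopology T U) {x \<in> U. \<phi> x \<in> \<phi> ` U \<inter> W}"
      using openin_continuous_map_preimage[OF homeomorphic_imp_continuous_map[OF hom]]
      unfolding sp by blast
    also have "{x \<in> U. \<phi> x \<in> \<phi> ` U \<inter> W} = U \<inter> \<phi> -` W" by auto
    finally show ?thesis using U(1) openin_open_subtopology by blast
  qed
  ultimately show ?r using U by blast
next
  assume r: ?r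
  then have U: "openin T U" "subspace L" "inj_on \<phi> U"
    and op: "\<And>O'. openin T O' \<Longrightarrow> O' \<subseteq> U \<Longrightarrow> openin (top_of_set L) (\<phi> ` O')"
    and pre: "\<And>W. openin (top_of_set L) W \<Longrightarrow> openin T (U \<inter> \<phi> -` W)"
    by blast+
  have sp: "topspace (subtopology T U) = U" using openin_subset[OF U(1)] by auto
  have im: "openin (top_of_set L) (\<phi> ` U)" using op[OF U(1)] by simp
  have "homeomorphic_map (subtopology T U) (top_of_set (\<phi> ` U)) \<phi>"
  proof (rule bijective_open_imp_homeomorphic_map)
    show "continuous_map (subtopology T U) (top_of_set (\<phi> ` U)) \<phi>"
      unfolding continuous_map_def sp
    proof (intro conjI allI impI)
      fix W assume "openin (top_of_set (\<phi> ` U)) W"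
      then have "openin T (U \<inter> \<phi> -` W)" using pre im openin_trans by blast
      moreover have "{x \<in> U. \<phi> x \<in> W} = U \<inter> \<phi> -` W" by blast
      ultimately show "openin (subtopology T U) {x \<in> U. \<phi> x \<in> W}"
        using openin_open_subtopology[OF U(1)] by simp
    qed simp
    show "open_map (subtopology T U) (top_of_set (\<phi> ` U)) \<phi>"
      unfolding open_map_def
    proof (intro allI impI)
      fix O' assume "openin (subtopology T U) O'"
      then have "openin T O'" "O' \<subseteq> U" using openin_open_subtopology[OF U(1)] by blast+
      from openin_subset_trans[OF op[OF this] image_mono[OF this(2)] openin_imp_subset[OF im]]
      show "openin (top_of_set (\<phi> ` U)) (\<phi> ` O')" .
    qed
  qed (use sp U in auto)
  with U im show ?l by (simp add: is_chart_def)
qed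

lemma is_chartD:
  assumes "is_chart T (U, L, \<phi>)"
  shows "openin T U" "subspace L" "inj_on \<phi> U"
    "\<And>O'. openin T O' \<Longrightarrow> O' \<subseteq> U \<Longrightarrow> openin (top_of_set L) (\<phi> ` O')"
    "\<And>W. openin (top_of_set L) W \<Longrightarrow> openin T (U \<inter> \<phi> -` W)"
    "\<phi> ` U \<subseteq> L" "U \<subseteq> topspace T"
proof -
  show *: "openin T U" "subspace L" "inj_on \<phi> U"
    "\<And>O'. openin T O' \<Longrightarrow> O' \<subseteq> U \<Longrightarrow> openin (top_of_set L) (\<phi> ` O')"
    "\<And>W. openin (top_of_set L) W \<Longrightarrow> openin T (U \<inter> \<phi> -` W)"
    using assms unfolding is_chart_iff by blast+
  show "\<phi> ` U \<subseteq> L" using *(4)[OF *(1)] openin_imp_subset by blast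
  show "U \<subseteq> topspace T" using *(1) openin_subset by blast
qed

text \<open>The structure that a manifold induces on any subset satisfies \<open>charts\<close>; it satisfies
  \<open>charted\<close> exactly when the subset is an embedded submanifold.\<close>

definition charts :: "('a, 'e::euclidean_space) mfd \<Rightarrow> bool" where
  "charts M \<longleftrightarrow> (\<forall>c\<in>atlas M. is_chart (topo M) c)"

definition charted :: "('a, 'e::euclidean_space) mfd \<Rightarrow> bool" where
  "charted M \<longleftrightarrow> charts M \<and> (\<forall>p\<in>pts M. \<exists>U L \<phi>. (U, L, \<phi>) \<in> atlas M \<and> p \<in> U)"

lemma charts_chart: "charts M \<Longrightarrow> (U, L, \<phi>) \<in> atlas M \<Longrightarrow> is_chart (topo M) (U, L, \<phi>)"
  by (auto simp: charts_def)

lemma charted_imp_charts: "charted M \<Longrightarrow> charts M"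
  by (simp add: charted_def)

lemma charted_chart_at:
  assumes "charted M" "p \<in> pts M"
  obtains U L \<phi> where "(U, L, \<phi>) \<in> atlas M" "p \<in> U"
  using assms by (auto simp: charted_def)

lemma smooth_manifold_imp_charted:
  assumes "smooth_manifold M"
  shows "charted M"
  unfolding charted_def charts_def
proof (intro conjI ballI)
  show "is_chart (topo M) c" if "c \<in> atlas M" for c
    using assms that by (simp add: smooth_manifold_def)
  fix p assume "p \<in> pts M"
  then have "p \<in> (\<Union>(U, L, \<phi>)\<in>atlas M. U)" using assms by (simp add: smooth_manifold_def)
  then show "\<exists>U L \<phi>. (U, L, \<phi>) \<in> atlas M \<and> p \<in> U" by auto
qed

lemma openin_chart_preimage:
  assumes "continuous_map T T' f" "openin T U" "openin T' V"
  shows "openin T (U \<inter> f -` V)"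
proof -
  have "U \<inter> f -` V = U \<inter> {x \<in> topspace T. f x \<in> V}"
    using openin_subset[OF assms(2)] by auto
  then show ?thesis
    using openin_continuous_map_preimage[OF assms(1,3)] assms(2) by auto
qed

lemma smooth_map_continuous: "smooth_map M N f \<Longrightarrow> continuous_map (topo M) (topo N) f"
  by (simp add: smooth_map_def)

lemma smooth_map_in_charts:
  assumes "smooth_map M N f" "(U, L, \<phi>) \<in> atlas M" "(V, K, \<psi>) \<in> atlas N"
  shows "smooth_on L (\<phi> ` (U \<inter> f -` V)) (\<psi> \<circ> f \<circ> inv_into U \<phi>)"
  using assms unfolding smooth_map_def by fastforce

lemma smooth_mapI:
  assumes "continuous_map (topo M) (topo N) f"
    and "\<And>U L \<phi> V K \<psi>. (U, L, \<phi>) \<in> atlas M \<Longrightarrow> (V, K, \<psi>) \<in> atlas N \<Longrightarrow>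
      smooth_on L (\<phi> ` (U \<inter> f -` V)) (\<psi> \<circ> f \<circ> inv_into U \<phi>)"
  shows "smooth_map M N f"
  unfolding smooth_map_def using assms by auto

lemma smooth_map_closed: "smooth_map M N f \<Longrightarrow> p \<in> pts M \<Longrightarrow> f p \<in> pts N"
  using smooth_map_continuous continuous_map_image_subset_topspace by blast

text \<open>Near a given point the composite factors through a chart of \<open>N\<close> around the image point, so the charts
  of \<open>N\<close> have to cover \<open>N\<close>: a point that lies in no chart would not be tested by the smoothness of
  \<open>f\<close> and \<open>g\<close>.\<close>

lemma smooth_map_compose:
  assumes M: "charts M" and N: "charted N" and Q: "charts Q"
    and f: "smooth_map M N f" and g: "smooth_map N Q g"
  shows "smooth_map M Q (g \<circ> f)"
proof (rule smooth_mapI)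
  show cont: "continuous_map (topo M) (topo Q) (g \<circ> f)"
    using continuous_map_compose[OF smooth_map_continuous[OF f] smooth_map_continuous[OF g]] .
  fix U L \<phi> V K \<psi> assume c: "(U, L, \<phi>) \<in> atlas M" "(V, K, \<psi>) \<in> atlas Q"
  note U = is_chartD[OF charts_chart[OF M c(1)]] and V = is_chartD[OF charts_chart[OF Q c(2)]]
  let ?O = "U \<inter> (g \<circ> f) -` V"
  have O: "openin (topo M) ?O" using openin_chart_preimage[OF cont U(1) V(1)] .
  show "smooth_on L (\<phi> ` ?O) (\<psi> \<circ> (g \<circ> f) \<circ> inv_into U \<phi>)"
  proof (rule smooth_on_local[OF U(2)])
    show "openin (top_of_set L) (\<phi> ` ?O)" using U(4)[OF O] by blast
    fix x assume "x \<in> \<phi> ` ?O"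
    then obtain m where m: "m \<in> ?O" "x = \<phi> m" by blast
    then have "f m \<in> pts N" using smooth_map_closed[OF f] U(7) by blast
    then obtain W J \<kappa> where W: "(W, J, \<kappa>) \<in> atlas N" "f m \<in> W"
      using charted_chart_at[OF N] by metis
    note Wc = is_chartD[OF charts_chart[OF charted_imp_charts[OF N] W(1)]]
    let ?O' = "?O \<inter> f -` W"
    have O': "openin (topo M) ?O'" using openin_chart_preimage[OF smooth_map_continuous[OF f] O Wc(1)] .
    have op: "openin (top_of_set L) (\<phi> ` ?O')" using U(4)[OF O'] by blast
    have inv: "inv_into U \<phi> (\<phi> z) = z" if "z \<in> U" for z using U(3) that by simp
    have "smooth_on L (\<phi> ` ?O') (\<lambda>x. (\<psi> \<circ> g \<circ> inv_into W \<kappa>) ((\<kappa> \<circ> f \<circ> inv_into U \<phi>) x))"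
    proof (rule smooth_on_compose[OF U(2) Wc(2) op])
      show "smooth_on L (\<phi> ` ?O') (\<kappa> \<circ> f \<circ> inv_into U \<phi>)"
        using smooth_map_in_charts[OF f c(1) W(1)] by (rule smooth_on_mono) auto
      show "smooth_on J (\<kappa> ` (W \<inter> g -` V)) (\<psi> \<circ> g \<circ> inv_into W \<kappa>)"
        using smooth_map_in_charts[OF g W(1) c(2)] .
      show "\<kappa> ` (W \<inter> g -` V) \<subseteq> J" using Wc(6) by blast
      show "(\<kappa> \<circ> f \<circ> inv_into U \<phi>) ` (\<phi> ` ?O') \<subseteq> \<kappa> ` (W \<inter> g -` V)"
        using inv by auto
    qed
    then have "smooth_on L (\<phi> ` ?O') (\<psi> \<circ> (g \<circ> f) \<circ> inv_into U \<phi>)"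
      by (rule smooth_on_cong[OF op, rotated]) (use inv Wc(3) in auto)
    then show "\<exists>W'. openin (top_of_set L) W' \<and> x \<in> W' \<and> W' \<subseteq> \<phi> ` ?O \<and>
        smooth_on L W' (\<psi> \<circ> (g \<circ> f) \<circ> inv_into U \<phi>)"
      using op m W(2) by (intro exI[of _ "\<phi> ` ?O'"]) auto
  qed
qed

lemma smooth_map_cong:
  assumes M: "charts M" and N: "charts N" and f: "smooth_map M N f"
    and fg: "\<And>p. p \<in> pts M \<Longrightarrow> f p = g p"
  shows "smooth_map M N g"
proof (rule smooth_mapI)
  show cont: "continuous_map (topo M) (topo N) g"
    using smooth_map_continuous[OF f] fg continuous_map_eq by blast
  fix U L \<phi> V K \<psi> assume c: "(U, L, \<phi>) \<in> atlas M" "(V, K, \<psi>) \<in> atlas N"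
  note U = is_chartD[OF charts_chart[OF M c(1)]] and V = is_chartD[OF charts_chart[OF N c(2)]]
  have eq: "U \<inter> f -` V = U \<inter> g -` V" using U(7) fg by auto
  have op: "openin (top_of_set L) (\<phi> ` (U \<inter> g -` V))"
    using U(4)[OF openin_chart_preimage[OF cont U(1) V(1)]] by blast
  show "smooth_on L (\<phi> ` (U \<inter> g -` V)) (\<psi> \<circ> g \<circ> inv_into U \<phi>)"
    using smooth_map_in_charts[OF f c] unfolding eq
    by (rule smooth_on_cong[OF op, rotated]) (use U(3,7) fg in auto)
qed

section \<open>Maximal atlases\<close>

lemma compatible_chartsD:
  assumes "compatible_charts (U, L, \<phi>) (V, M, \<psi>)"
  shows "smooth_on L (\<phi> ` (U \<inter> V)) (\<psi> \<circ> inv_into U \<phi>)"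
    "smooth_on M (\<psi> ` (U \<inter> V)) (\<phi> \<circ> inv_into V \<psi>)"
  using assms by (auto simp: compatible_charts_def)

lemma atlas_subset_max_atlas: "smooth_manifold M \<Longrightarrow> atlas M \<subseteq> max_atlas M"
  by (auto simp: smooth_manifold_def max_atlas_def)

lemma max_atlas_is_chart: "c \<in> max_atlas M \<Longrightarrow> is_chart (topo M) c"
  by (simp add: max_atlas_def)

lemma max_atlas_compatible: "c \<in> max_atlas M \<Longrightarrow> d \<in> atlas M \<Longrightarrow> compatible_charts c d"
  by (simp add: max_atlas_def)

text \<open>Composing with this map shows that smooth maps into a manifold are smooth in all charts of its maximal
  atlas, which are the ones from which slice charts are made.\<close>

lemma smooth_map_id_max_atlas:
  shows "smooth_map M (M\<lparr>atlas := max_atlas M\<rparr>) id"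
proof (rule smooth_mapI)
  fix U L \<phi> V K \<psi>
  assume "(U, L, \<phi>) \<in> atlas M" "(V, K, \<psi>) \<in> atlas (M\<lparr>atlas := max_atlas M\<rparr>)"
  then have "compatible_charts (V, K, \<psi>) (U, L, \<phi>)"
    by (simp add: max_atlas_compatible)
  from compatible_chartsD(2)[OF this]
  show "smooth_on L (\<phi> ` (U \<inter> id -` V)) (\<psi> \<circ> id \<circ> inv_into U \<phi>)"
    by (simp add: Int_commute)
qed simp

lemma smooth_manifold_id:
  assumes "smooth_manifold M"
  shows "smooth_map M M id"
proof (rule smooth_mapI)
  fix U L \<phi> V K \<psi>
  assume "(U, L, \<phi>) \<in> atlas M" "(V, K, \<psi>) \<in> atlas M"
  then have "compatible_charts (U, L, \<phi>) (V, K, \<psi>)"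
    using assms unfolding smooth_manifold_def by blast
  from compatible_chartsD(1)[OF this]
  show "smooth_on L (\<phi> ` (U \<inter> id -` V)) (\<psi> \<circ> id \<circ> inv_into U \<phi>)" by simp
qed simp

text \<open>The charts of an atlas are mutually compatible iff the identity is smooth.  For products this
  reduces compatibility of charts to smoothness of the two projections.\<close>

lemma smooth_manifoldI:
  assumes "charted M" "smooth_map M M id"
  shows "smooth_manifold M"
proof -
  have ch: "is_chart (topo M) c" if "c \<in> atlas M" for c
    using assms(1) that by (simp add: charted_def charts_def)
  have "compatible_charts c d" if cd: "c \<in> atlas M" "d \<in> atlas M" for c d
  proof -
    obtain U L \<phi> V K \<psi> where eq: "c = (U, L, \<phi>)" "d = (V, K, \<psi>)" using prod_cases3 by metis
    show ?thesis
      using smooth_map_in_charts[OF assms(2) cd[unfolded eq]]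
        smooth_map_in_charts[OF assms(2) cd(2,1)[unfolded eq]]
      by (simp add: eq compatible_charts_def Int_commute)
  qed
  moreover have "(\<Union>(U, L, \<phi>)\<in>atlas M. U) = pts M"
  proof
    show "(\<Union>(U, L, \<phi>)\<in>atlas M. U) \<subseteq> pts M"
      using ch is_chartD(7) by fastforce
    show "pts M \<subseteq> (\<Union>(U, L, \<phi>)\<in>atlas M. U)"
    proof
      fix p assume "p \<in> pts M"
      then obtain U L \<phi> where "(U, L, \<phi>) \<in> atlas M" "p \<in> U"
        using charted_chart_at[OF assms(1)] by metis
      then show "p \<in> (\<Union>(U, L, \<phi>)\<in>atlas M. U)" by (intro UN_I[of "(U, L, \<phi>)"]) auto
    qed
  qed
  ultimately show ?thesis using ch by (simp add: smooth_manifold_def)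
qed

text \<open>This is the source of new charts: a chart may be restricted to an open subset and followed by a
  diffeomorphism \<open>\<theta>\<close> between open subsets of its model space.\<close>

lemma max_atlas_reparametrize:
  assumes M: "charts M" and c: "(U, L, \<phi>) \<in> max_atlas M"
    and W: "openin (top_of_set L) W" "W \<subseteq> \<phi> ` U"
    and \<theta>: "smooth_on L W \<theta>" "openin (top_of_set L) (\<theta> ` W)"
    and g: "smooth_on L (\<theta> ` W) g" "\<And>x. x \<in> W \<Longrightarrow> g (\<theta> x) = x"
  shows "(U \<inter> \<phi> -` W, L, \<theta> \<circ> \<phi>) \<in> max_atlas M"
proof -
  note U = is_chartD[OF max_atlas_is_chart[OF c]]
  let ?U = "U \<inter> \<phi> -` W"
  have oU: "openin (topo M) ?U" using U(5)[OF W(1)] .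
  have inj: "inj_on (\<theta> \<circ> \<phi>) ?U"
    using U(3) g(2) by (intro inj_onI) (metis comp_apply Int_iff inj_onD vimage_eq)
  have WL: "W \<subseteq> L" "\<theta> ` W \<subseteq> L" using W(1) \<theta>(2) openin_imp_subset by blast+
  have chart: "is_chart (topo M) (?U, L, \<theta> \<circ> \<phi>)"
    unfolding is_chart_iff
  proof (intro conjI allI impI)
    fix O' assume O': "openin (topo M) O'" "O' \<subseteq> ?U"
    then have o: "openin (top_of_set L) (\<phi> ` O')" using U(4) by blast
    have "(\<theta> \<circ> \<phi>) ` O' = \<theta> ` W \<inter> g -` (\<phi> ` O')"
      using O'(2) g(2) by force
    moreover have "openin (top_of_set (\<theta> ` W)) (\<theta> ` W \<inter> g -` (\<phi> ` O'))"
    proof (rule continuous_openin_preimage[OF smooth_on_imp_continuous_on[OF g(1)], of W])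
      show "g \<in> \<theta> ` W \<rightarrow> W" using g(2) by auto
      show "openin (top_of_set W) (\<phi> ` O')"
        using o O'(2) WL by (intro openin_subset_trans[OF o]) auto
    qed
    ultimately show "openin (top_of_set L) ((\<theta> \<circ> \<phi>) ` O')"
      using \<theta>(2) openin_trans by metis
  next
    fix Y assume Y: "openin (top_of_set L) Y"
    have "openin (top_of_set W) (W \<inter> \<theta> -` Y)"
      using continuous_openin_preimage[OF smooth_on_imp_continuous_on[OF \<theta>(1)] _ Y] WL(2) by blast
    then have "openin (top_of_set L) (W \<inter> \<theta> -` Y)" using W(1) openin_trans by blast
    from U(5)[OF this] show "openin (topo M) (?U \<inter> (\<theta> \<circ> \<phi>) -` Y)"
      by (simp add: vimage_comp[symmetric] Int_assoc)
  qed (use oU U inj in auto)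
  have "compatible_charts (?U, L, \<theta> \<circ> \<phi>) d" if d: "d \<in> atlas M" for d
  proof -
    obtain V K \<psi> where deq: "d = (V, K, \<psi>)" using prod_cases3 by metis
    note V = is_chartD[OF charts_chart[OF M d[unfolded deq]]]
    have cd: "compatible_charts (U, L, \<phi>) (V, K, \<psi>)"
      using c d deq by (simp add: max_atlas_compatible)
    note C = is_chartD[OF chart]
    have UV: "openin (topo M) (?U \<inter> V)" using oU V(1) by blast
    have o1: "openin (top_of_set L) ((\<theta> \<circ> \<phi>) ` (?U \<inter> V))" using C(4)[OF UV] by blast
    have inv: "inv_into ?U (\<theta> \<circ> \<phi>) ((\<theta> \<circ> \<phi>) z) = z" if "z \<in> ?U" for z
      using inv_into_f_f[OF inj that] .
    have "smooth_on L ((\<theta> \<circ> \<phi>) ` (?U \<inter> V)) (\<lambda>x. (\<psi> \<circ> inv_into U \<phi>) (g x))"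
    proof (rule smooth_on_compose[OF U(2) U(2) o1 _ _ _ compatible_chartsD(1)[OF cd]])
      show "smooth_on L ((\<theta> \<circ> \<phi>) ` (?U \<inter> V)) g"
        using g(1) by (rule smooth_on_mono) auto
      show "g ` (\<theta> \<circ> \<phi>) ` (?U \<inter> V) \<subseteq> \<phi> ` (U \<inter> V)" using g(2) by auto
    qed (use U(6) in blast)
    then have 1: "smooth_on L ((\<theta> \<circ> \<phi>) ` (?U \<inter> V)) (\<psi> \<circ> inv_into ?U (\<theta> \<circ> \<phi>))"
    proof (rule smooth_on_cong[OF o1, rotated])
      fix x assume "x \<in> (\<theta> \<circ> \<phi>) ` (?U \<inter> V)"
      then obtain z where z: "z \<in> ?U" "x = (\<theta> \<circ> \<phi>) z" by blast
      then show "(\<psi> \<circ> inv_into U \<phi>) (g x) = (\<psi> \<circ> inv_into ?U (\<theta> \<circ> \<phi>)) x"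
        using inv[OF z(1)] g(2) U(3) by auto
    qed
    have o2: "openin (top_of_set K) (\<psi> ` (?U \<inter> V))" using V(4)[OF UV] by blast
    have "smooth_on K (\<psi> ` (?U \<inter> V)) (\<lambda>x. \<theta> ((\<phi> \<circ> inv_into V \<psi>) x))"
    proof (rule smooth_on_compose[OF V(2) U(2) o2 WL(1) _ _ \<theta>(1)])
      show "smooth_on K (\<psi> ` (?U \<inter> V)) (\<phi> \<circ> inv_into V \<psi>)"
        using compatible_chartsD(2)[OF cd] by (rule smooth_on_mono) auto
      show "(\<phi> \<circ> inv_into V \<psi>) ` \<psi> ` (?U \<inter> V) \<subseteq> W" using V(3) by auto
    qed
    then have 2: "smooth_on K (\<psi> ` (?U \<inter> V)) (\<theta> \<circ> \<phi> \<circ> inv_into V \<psi>)"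
      by (simp add: comp_def)
    show ?thesis using 1 2 by (simp add: deq compatible_charts_def)
  qed
  with chart show ?thesis by (simp add: max_atlas_def)
qed

lemma max_atlas_restrict:
  assumes M: "charts M" and c: "(U, L, \<phi>) \<in> max_atlas M" and O: "openin (topo M) O'"
  shows "(U \<inter> O', L, \<phi>) \<in> max_atlas M"
proof -
  note U = is_chartD[OF max_atlas_is_chart[OF c]]
  have op: "openin (top_of_set L) (\<phi> ` (U \<inter> O'))"
    using U(4)[of "U \<inter> O'"] U(1) O by blast
  have "(U \<inter> \<phi> -` (\<phi> ` (U \<inter> O')), L, (\<lambda>x. x) \<circ> \<phi>) \<in> max_atlas M"
    using op
    by (intro max_atlas_reparametrize[OF M c op, where g = "\<lambda>x. x"] smooth_on_bounded_linear
        bounded_linear_ident) auto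
  moreover have "U \<inter> \<phi> -` (\<phi> ` (U \<inter> O')) = U \<inter> O'"
    using U(3) by (auto dest: inj_onD)
  ultimately show ?thesis by (simp add: comp_def)
qed

section \<open>Submanifolds\<close>

lemma submanifold_simps [simp]:
  "topo (submanifold M S) = subtopology (topo M) S"
  by (simp add: submanifold_def)

lemma atlas_submanifoldE:
  assumes "(V, K, \<phi>) \<in> atlas (submanifold M S)"
  obtains U L where "V = U \<inter> S" "(U, L, \<phi>) \<in> max_atlas M" "subspace K" "K \<subseteq> L"
    "\<phi> ` (U \<inter> S) = \<phi> ` U \<inter> K"
  using assms by (auto simp: submanifold_def)

lemma atlas_submanifoldI:
  assumes "(U, L, \<phi>) \<in> max_atlas M" "subspace K" "K \<subseteq> L" "\<phi> ` (U \<inter> S) = \<phi> ` U \<inter> K"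
  shows "(U \<inter> S, K, \<phi>) \<in> atlas (submanifold M S)"
  using assms by (auto simp: submanifold_def)

text \<open>The slice condition \<open>\<phi> ` (U \<inter> S) = \<phi> ` U \<inter> K\<close> says that \<open>S\<close> corresponds to \<open>K\<close> in the chart,
  so open sets of \<open>S\<close> and of \<open>K\<close> are the traces of corresponding open sets.\<close>

lemma charts_submanifold: "charts (submanifold M S)"
  unfolding charts_def
proof
  fix c assume c: "c \<in> atlas (submanifold M S)"
  obtain V K \<phi> where ceq: "c = (V, K, \<phi>)" using prod_cases3 by metis
  obtain U L where U: "V = U \<inter> S" "(U, L, \<phi>) \<in> max_atlas M" "subspace K" "K \<subseteq> L"
    "\<phi> ` (U \<inter> S) = \<phi> ` U \<inter> K"
    using atlas_submanifoldE[OF c[unfolded ceq]] by metis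
  note C = is_chartD[OF max_atlas_is_chart[OF U(2)]]
  have "is_chart (subtopology (topo M) S) (U \<inter> S, K, \<phi>)"
    unfolding is_chart_iff
  proof (intro conjI allI impI)
    show "openin (subtopology (topo M) S) (U \<inter> S)"
      using C(1) by (auto simp: openin_subtopology)
    show "inj_on \<phi> (U \<inter> S)" using C(3) inj_on_subset by blast
    fix O' assume "openin (subtopology (topo M) S) O'" "O' \<subseteq> U \<inter> S"
    then obtain N where N: "openin (topo M) N" "O' = N \<inter> S" by (auto simp: openin_subtopology)
    have "openin (topo M) (U \<inter> N)" using C(1) N(1) by blast
    from C(4)[OF this] have "openin (top_of_set L) (\<phi> ` (U \<inter> N))" by blast
    then have "openin (top_of_set K) (K \<inter> \<phi> ` (U \<inter> N))"
      using U(4) by (auto simp: openin_open)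
    moreover have "K \<inter> \<phi> ` (U \<inter> N) = \<phi> ` O'"
    proof
      show "\<phi> ` O' \<subseteq> K \<inter> \<phi> ` (U \<inter> N)" using N(2) U(5) \<open>O' \<subseteq> U \<inter> S\<close> by blast
      show "K \<inter> \<phi> ` (U \<inter> N) \<subseteq> \<phi> ` O'"
      proof
        fix y assume y: "y \<in> K \<inter> \<phi> ` (U \<inter> N)"
        then obtain x where x: "x \<in> U" "x \<in> N" "y = \<phi> x" by blast
        then have "y \<in> \<phi> ` (U \<inter> S)" using U(5) y by blast
        then obtain x' where "x' \<in> U" "x' \<in> S" "y = \<phi> x'" by blast
        then have "x \<in> S" using C(3) x by (metis inj_onD)
        then show "y \<in> \<phi> ` O'" using x N(2) by blast
      qed
    qed
    ultimately show "openin (top_of_set K) (\<phi> ` O')" by simp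
  next
    fix W assume "openin (top_of_set K) W"
    then obtain T where T: "open T" "W = K \<inter> T" by (auto simp: openin_open)
    have "openin (topo M) (U \<inter> \<phi> -` (L \<inter> T))" using C(5)[OF openin_open_Int[OF T(1)]] .
    moreover have "U \<inter> S \<inter> \<phi> -` W = (U \<inter> \<phi> -` (L \<inter> T)) \<inter> S"
      using U(4,5) C(6) T(2) by blast
    ultimately show "openin (subtopology (topo M) S) (U \<inter> S \<inter> \<phi> -` W)"
      by (auto simp: openin_subtopology)
  qed (rule U(3))
  then show "is_chart (topo (submanifold M S)) c" by (simp add: ceq U(1))
qed

lemma smooth_map_into_submanifold:
  assumes R: "charts R" and N: "charted N" and f: "smooth_map R N f" and S: "f ` pts R \<subseteq> S"
  shows "smooth_map R (submanifold N S) f"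
proof (rule smooth_mapI)
  show "continuous_map (topo R) (topo (submanifold N S)) f"
    using smooth_map_continuous[OF f] S by (simp add: continuous_map_in_subtopology Pi_iff image_subset_iff)
  fix U L \<phi> V K \<psi>
  assume c: "(U, L, \<phi>) \<in> atlas R" and d: "(V, K, \<psi>) \<in> atlas (submanifold N S)"
  obtain V' K' where V: "V = V' \<inter> S" "(V', K', \<psi>) \<in> max_atlas N"
    using atlas_submanifoldE[OF d] by metis
  have "charts (N\<lparr>atlas := max_atlas N\<rparr>)"
    by (simp add: charts_def max_atlas_is_chart)
  from smooth_map_compose[OF R N this f smooth_map_id_max_atlas]
  have "smooth_map R (N\<lparr>atlas := max_atlas N\<rparr>) f" by simp
  from smooth_map_in_charts[OF this c] V(2)
  have "smooth_on L (\<phi> ` (U \<inter> f -` V')) (\<psi> \<circ> f \<circ> inv_into U \<phi>)" by simp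
  moreover have "U \<inter> f -` V = U \<inter> f -` V'"
    using S is_chartD(7)[OF charts_chart[OF R c]] V(1) by blast
  ultimately show "smooth_on L (\<phi> ` (U \<inter> f -` V)) (\<psi> \<circ> f \<circ> inv_into U \<phi>)" by simp
qed

text \<open>A slice chart is a restriction of a chart of the maximal atlas, and the latter is compatible with
  the charts of \<open>N\<close>.\<close>

lemma smooth_map_inclusion:
  assumes N: "charts N"
  shows "smooth_map (submanifold N S) N id"
proof (rule smooth_mapI)
  show "continuous_map (topo (submanifold N S)) (topo N) id" by (simp add: continuous_map_from_subtopology)
  fix U L \<phi> V K \<psi>
  assume c: "(U, L, \<phi>) \<in> atlas (submanifold N S)" and d: "(V, K, \<psi>) \<in> atlas N"
  obtain U' L' where U: "U = U' \<inter> S" "(U', L', \<phi>) \<in> max_atlas N" "subspace L" "L \<subseteq> L'"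
    using atlas_submanifoldE[OF c] by metis
  note C' = is_chartD[OF max_atlas_is_chart[OF U(2)]]
  note C = is_chartD[OF charts_chart[OF charts_submanifold c]]
  have "openin (topo (submanifold N S)) (U \<inter> V)"
    using U(1) C'(1) is_chartD(1)[OF charts_chart[OF N d]] by (auto simp: openin_subtopology)
  from C(4)[OF this] have op: "openin (top_of_set L) (\<phi> ` (U \<inter> V))" by blast
  have "smooth_on L' (\<phi> ` (U' \<inter> V)) (\<psi> \<circ> inv_into U' \<phi>)"
    by (rule compatible_chartsD(1)[OF max_atlas_compatible[OF U(2) d]])
  then have "smooth_on L (\<phi> ` (U \<inter> V)) (\<psi> \<circ> inv_into U' \<phi>)"
    by (rule smooth_on_mono) (use U(1,4) in auto)
  then have "smooth_on L (\<phi> ` (U \<inter> V)) (\<psi> \<circ> inv_into U \<phi>)"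
  proof (rule smooth_on_cong[OF op, rotated])
    fix x assume "x \<in> \<phi> ` (U \<inter> V)"
    then obtain z where "z \<in> U" "x = \<phi> z" by blast
    then show "(\<psi> \<circ> inv_into U' \<phi>) x = (\<psi> \<circ> inv_into U \<phi>) x"
      using inv_into_f_f[OF C(3)] inv_into_f_f[OF C'(3)] U(1) by simp
  qed
  then show "smooth_on L (\<phi> ` (U \<inter> id -` V)) (\<psi> \<circ> id \<circ> inv_into U \<phi>)" by simp
qed

lemma smooth_map_from_submanifold:
  assumes "charted N" "charts Q" "smooth_map N Q f"
  shows "smooth_map (submanifold N S) Q f"
  using smooth_map_compose[OF charts_submanifold assms(1,2) smooth_map_inclusion assms(3)] assms(1)
  by (simp add: charted_def)

lemma charted_open_submanifold:
  assumes M: "smooth_manifold M" and O: "openin (topo M) O'"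
  shows "charted (submanifold M O')"
  unfolding charted_def
proof (intro conjI charts_submanifold ballI)
  fix p assume "p \<in> pts (submanifold M O')"
  then have p: "p \<in> pts M" "p \<in> O'" by auto
  obtain U L \<phi> where U: "(U, L, \<phi>) \<in> atlas M" "p \<in> U"
    using charted_chart_at[OF smooth_manifold_imp_charted[OF M] p(1)] by metis
  have max: "(U, L, \<phi>) \<in> max_atlas M" using U(1) atlas_subset_max_atlas[OF M] by blast
  note C = is_chartD[OF max_atlas_is_chart[OF max]]
  have "charts M" using smooth_manifold_imp_charted[OF M] charted_imp_charts by blast
  from max_atlas_restrict[OF this max O]
  have "(U \<inter> O', L, \<phi>) \<in> max_atlas M" .
  then have "(U \<inter> O' \<inter> O', L, \<phi>) \<in> atlas (submanifold M O')"
    by (rule atlas_submanifoldI) (use C(2,6) in auto)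
  then show "\<exists>U L \<phi>. (U, L, \<phi>) \<in> atlas (submanifold M O') \<and> p \<in> U" using U(2) p(2) by blast
qed

lemma smooth_map_local:
  assumes M: "smooth_manifold M" and Q: "charts Q"
    and loc: "\<And>p. p \<in> pts M \<Longrightarrow> \<exists>O'. openin (topo M) O' \<and> p \<in> O' \<and> smooth_map (submanifold M O') Q f"
  shows "smooth_map M Q f"
proof (rule smooth_mapI)
  have Mc: "charted M" using smooth_manifold_imp_charted[OF M] .
  have cont: "f p \<in> pts Q \<and> (\<forall>V. openin (topo Q) V \<longrightarrow> f p \<in> V \<longrightarrow>
      (\<exists>N. openin (topo M) N \<and> p \<in> N \<and> N \<subseteq> {x \<in> pts M. f x \<in> V}))" if p: "p \<in> pts M" for p
  proof -
    obtain O' where O': "openin (topo M) O'" "p \<in> O'" "smooth_map (submanifold M O') Q f"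
      using loc[OF p] by metis
    have c: "continuous_map (subtopology (topo M) O') (topo Q) f"
      using smooth_map_continuous[OF O'(3)] by simp
    have "f p \<in> pts Q" using smooth_map_closed[OF O'(3)] O'(2) p by simp
    moreover have "\<exists>N. openin (topo M) N \<and> p \<in> N \<and> N \<subseteq> {x \<in> pts M. f x \<in> V}"
      if V: "openin (topo Q) V" "f p \<in> V" for V
    proof (intro exI conjI)
      let ?N = "{x \<in> topspace (subtopology (topo M) O'). f x \<in> V}"
      show "openin (topo M) ?N"
        using openin_continuous_map_preimage[OF c V(1)] openin_open_subtopology[OF O'(1)] by blast
      show "p \<in> ?N" using p O'(2) V(2) by simp
      show "?N \<subseteq> {x \<in> pts M. f x \<in> V}" by auto
    qed
    ultimately show ?thesis by blast
  qed
  show fc: "continuous_map (topo M) (topo Q) f"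
    unfolding continuous_map_def
  proof (intro conjI allI impI)
    show "f \<in> pts M \<rightarrow> pts Q" using cont by blast
    fix V assume V: "openin (topo Q) V"
    show "openin (topo M) {x \<in> pts M. f x \<in> V}"
      by (subst openin_subopen) (use cont V in simp)
  qed
  fix U L \<phi> V K \<psi>
  assume c: "(U, L, \<phi>) \<in> atlas M" and d: "(V, K, \<psi>) \<in> atlas Q"
  note C = is_chartD[OF charts_chart[OF charted_imp_charts[OF Mc] c]]
  have O: "openin (topo M) (U \<inter> f -` V)"
    using openin_chart_preimage[OF fc C(1) is_chartD(1)[OF charts_chart[OF Q d]]] .
  show "smooth_on L (\<phi> ` (U \<inter> f -` V)) (\<psi> \<circ> f \<circ> inv_into U \<phi>)"
  proof (rule smooth_on_local[OF C(2)])
    show "openin (top_of_set L) (\<phi> ` (U \<inter> f -` V))" using C(4)[OF O] by blast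
    fix x assume "x \<in> \<phi> ` (U \<inter> f -` V)"
    then obtain m where m: "m \<in> U" "f m \<in> V" "x = \<phi> m" by blast
    obtain O' where O': "openin (topo M) O'" "m \<in> O'" "smooth_map (submanifold M O') Q f"
      using loc[of m] m(1) C(7) by blast
    have max: "(U, L, \<phi>) \<in> max_atlas M" using c atlas_subset_max_atlas[OF M] by blast
    have "(U \<inter> O', L, \<phi>) \<in> max_atlas M"
      using max_atlas_restrict[OF charted_imp_charts[OF Mc] max O'(1)] .
    then have "(U \<inter> O' \<inter> O', L, \<phi>) \<in> atlas (submanifold M O')"
      by (rule atlas_submanifoldI) (use C(2,6) in auto)
    from smooth_map_in_charts[OF O'(3) this d]
    have s: "smooth_on L (\<phi> ` (U \<inter> O' \<inter> f -` V)) (\<psi> \<circ> f \<circ> inv_into (U \<inter> O') \<phi>)" by simp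
    have "openin (topo M) (U \<inter> O' \<inter> f -` V)" using O O'(1) by (metis Int_assoc Int_commute openin_Int)
    from C(4)[OF this] have op: "openin (top_of_set L) (\<phi> ` (U \<inter> O' \<inter> f -` V))" by blast
    have inj: "inj_on \<phi> (U \<inter> O')" using C(3) inj_on_subset by blast
    from s have "smooth_on L (\<phi> ` (U \<inter> O' \<inter> f -` V)) (\<psi> \<circ> f \<circ> inv_into U \<phi>)"
    proof (rule smooth_on_cong[OF op, rotated])
      fix y assume "y \<in> \<phi> ` (U \<inter> O' \<inter> f -` V)"
      then obtain z where "z \<in> U \<inter> O'" "y = \<phi> z" by blast
      then show "(\<psi> \<circ> f \<circ> inv_into (U \<inter> O') \<phi>) y = (\<psi> \<circ> f \<circ> inv_into U \<phi>) y"
        using inv_into_f_f[OF C(3)] inv_into_f_f[OF inj] by simp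
    qed
    then show "\<exists>W'. openin (top_of_set L) W' \<and> x \<in> W' \<and> W' \<subseteq> \<phi> ` (U \<inter> f -` V) \<and>
        smooth_on L W' (\<psi> \<circ> f \<circ> inv_into U \<phi>)"
      using op m O'(2) by (intro exI[of _ "\<phi> ` (U \<inter> O' \<inter> f -` V)"]) auto
  qed
qed

section \<open>Products\<close>

lemma product_manifold_simps [simp]:
  "topo (product_manifold M N) = prod_topology (topo M) (topo N)"
  by (simp add: product_manifold_def)

lemma atlas_productE:
  assumes "c \<in> atlas (product_manifold M N)"
  obtains U L \<phi> V K \<psi> where "c = (U \<times> V, L \<times> K, map_prod \<phi> \<psi>)"
    "(U, L, \<phi>) \<in> atlas M" "(V, K, \<psi>) \<in> atlas N"
  using assms by (auto simp: product_manifold_def)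

lemma atlas_productI:
  assumes "(U, L, \<phi>) \<in> atlas M" "(V, K, \<psi>) \<in> atlas N"
  shows "(U \<times> V, L \<times> K, map_prod \<phi> \<psi>) \<in> atlas (product_manifold M N)"
  unfolding product_manifold_def mfd.select_convs mem_Collect_eq using assms by blast

lemma is_chart_product:
  assumes "is_chart S (U, L, \<phi>)" "is_chart T (V, K, \<psi>)"
  shows "is_chart (prod_topology S T) (U \<times> V, L \<times> K, map_prod \<phi> \<psi>)"
proof -
  note U = is_chartD[OF assms(1)] and V = is_chartD[OF assms(2)]
  have top: "top_of_set (L \<times> K) = prod_topology (top_of_set L) (top_of_set K)"
    by (simp add: prod_topology_subtopology_eu)
  show ?thesis
    unfolding is_chart_iff
  proof (intro conjI allI impI)
    show "openin (prod_topology S T) (U \<times> V)" using U(1) V(1) by (simp add: openin_prod_Times_iff)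
    show "subspace (L \<times> K)" using U(2) V(2) by (rule subspace_Times)
    show "inj_on (map_prod \<phi> \<psi>) (U \<times> V)" using U(3) V(3) by (rule map_prod_inj_on)
    fix O' assume O': "openin (prod_topology S T) O'" "O' \<subseteq> U \<times> V"
    show "openin (top_of_set (L \<times> K)) (map_prod \<phi> \<psi> ` O')"
    proof (subst openin_subopen, intro ballI)
      fix y assume "y \<in> map_prod \<phi> \<psi> ` O'"
      then obtain a b where ab: "(a, b) \<in> O'" "y = (\<phi> a, \<psi> b)" by auto
      then obtain A B where AB: "openin S A" "openin T B" "a \<in> A" "b \<in> B" "A \<times> B \<subseteq> O'"
        using openin_prod_topology_alt[THEN iffD1, OF O'(1), rule_format, OF ab(1)]
        by (elim exE conjE) (rule that)
      have "A \<times> B \<subseteq> U \<times> V" using AB(5) O'(2) by blast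
      then have "A \<subseteq> U" "B \<subseteq> V" using AB(3,4) by blast+
      then have "openin (top_of_set (L \<times> K)) (\<phi> ` A \<times> \<psi> ` B)"
        unfolding top openin_prod_Times_iff
        using U(4)[OF AB(1)] V(4)[OF AB(2)] by blast
      moreover have "y \<in> \<phi> ` A \<times> \<psi> ` B" using ab(2) AB(3,4) by simp
      moreover have "\<phi> ` A \<times> \<psi> ` B \<subseteq> map_prod \<phi> \<psi> ` O'" using AB(5) by force
      ultimately show "\<exists>T. openin (top_of_set (L \<times> K)) T \<and> y \<in> T \<and> T \<subseteq> map_prod \<phi> \<psi> ` O'"
        by (intro exI[of _ "\<phi> ` A \<times> \<psi> ` B"] conjI)
    qed
  next
    fix W assume W: "openin (top_of_set (L \<times> K)) W"
    show "openin (prod_topology S T) (U \<times> V \<inter> map_prod \<phi> \<psi> -` W)"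
    proof (subst openin_subopen, intro ballI)
      fix z assume z: "z \<in> U \<times> V \<inter> map_prod \<phi> \<psi> -` W"
      then obtain a b where ab: "z = (a, b)" "a \<in> U" "b \<in> V" "(\<phi> a, \<psi> b) \<in> W" by auto
      then obtain A B where AB: "openin (top_of_set L) A" "openin (top_of_set K) B"
          "\<phi> a \<in> A" "\<psi> b \<in> B" "A \<times> B \<subseteq> W"
        using openin_prod_topology_alt[THEN iffD1, OF W[unfolded top], rule_format, OF ab(4)]
        by (elim exE conjE) (rule that)
      have "openin (prod_topology S T) ((U \<inter> \<phi> -` A) \<times> (V \<inter> \<psi> -` B))"
        unfolding openin_prod_Times_iff using U(5)[OF AB(1)] V(5)[OF AB(2)] by blast
      then show "\<exists>N. openin (prod_topology S T) N \<and> z \<in> N \<and> N \<subseteq> U \<times> V \<inter> map_prod \<phi> \<psi> -` W"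
        using ab AB(3-5) by (intro exI[of _ "(U \<inter> \<phi> -` A) \<times> (V \<inter> \<psi> -` B)"] conjI) auto
    qed
  qed
qed

lemma charted_product:
  assumes "charted M" "charted N"
  shows "charted (product_manifold M N)"
  unfolding charted_def charts_def
proof (intro conjI ballI)
  fix c assume "c \<in> atlas (product_manifold M N)"
  then obtain U L \<phi> V K \<psi> where "c = (U \<times> V, L \<times> K, map_prod \<phi> \<psi>)"
    "(U, L, \<phi>) \<in> atlas M" "(V, K, \<psi>) \<in> atlas N"
    by (rule atlas_productE)
  then show "is_chart (topo (product_manifold M N)) c"
    using is_chart_product[OF charts_chart[OF charted_imp_charts[OF assms(1)]]
        charts_chart[OF charted_imp_charts[OF assms(2)]]] by simp
next
  fix p assume "p \<in> pts (product_manifold M N)"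
  then obtain a b where ab: "p = (a, b)" "a \<in> pts M" "b \<in> pts N" by auto
  obtain U L \<phi> where "(U, L, \<phi>) \<in> atlas M" "a \<in> U"
    using charted_chart_at[OF assms(1) ab(2)] by metis
  moreover obtain V K \<psi> where "(V, K, \<psi>) \<in> atlas N" "b \<in> V"
    using charted_chart_at[OF assms(2) ab(3)] by metis
  ultimately show "\<exists>U L \<phi>. (U, L, \<phi>) \<in> atlas (product_manifold M N) \<and> p \<in> U"
    using atlas_productI ab(1) by blast
qed

lemma smooth_map_pair:
  assumes f: "smooth_map R M f" and g: "smooth_map R N g"
  shows "smooth_map R (product_manifold M N) (\<lambda>r. (f r, g r))"
proof (rule smooth_mapI)
  show "continuous_map (topo R) (topo (product_manifold M N)) (\<lambda>r. (f r, g r))"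
    using smooth_map_continuous[OF f] smooth_map_continuous[OF g] by (simp add: continuous_map_paired)
  fix U L \<phi> V' K' \<theta>
  assume c: "(U, L, \<phi>) \<in> atlas R" and d: "(V', K', \<theta>) \<in> atlas (product_manifold M N)"
  obtain A J \<psi> B K \<omega> where d': "(V', K', \<theta>) = (A \<times> B, J \<times> K, map_prod \<psi> \<omega>)"
    "(A, J, \<psi>) \<in> atlas M" "(B, K, \<omega>) \<in> atlas N"
    using d by (rule atlas_productE)
  have "smooth_on L (\<phi> ` (U \<inter> (\<lambda>r. (f r, g r)) -` (A \<times> B)))
      (\<lambda>x. ((\<psi> \<circ> f \<circ> inv_into U \<phi>) x, (\<omega> \<circ> g \<circ> inv_into U \<phi>) x))"
    by (rule smooth_on_Pair[OF smooth_on_mono[OF smooth_map_in_charts[OF f c d'(2)] order_refl]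
          smooth_on_mono[OF smooth_map_in_charts[OF g c d'(3)] order_refl]]) auto
  moreover have "(\<lambda>x. ((\<psi> \<circ> f \<circ> inv_into U \<phi>) x, (\<omega> \<circ> g \<circ> inv_into U \<phi>) x)) =
      map_prod \<psi> \<omega> \<circ> (\<lambda>r. (f r, g r)) \<circ> inv_into U \<phi>" by auto
  ultimately show "smooth_on L (\<phi> ` (U \<inter> (\<lambda>r. (f r, g r)) -` V')) (\<theta> \<circ> (\<lambda>r. (f r, g r)) \<circ> inv_into U \<phi>)"
    using d'(1) by simp
qed

lemma smooth_map_fst:
  assumes M: "smooth_manifold M" and N: "charted N"
  shows "smooth_map (product_manifold M N) M fst"
proof (rule smooth_mapI)
  have Mc: "charted M" using smooth_manifold_imp_charted[OF M] .
  show cont: "continuous_map (topo (product_manifold M N)) (topo M) fst" by (simp add: continuous_map_fst)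
  fix U' L' \<theta> A J \<psi>
  assume c: "(U', L', \<theta>) \<in> atlas (product_manifold M N)" and d: "(A, J, \<psi>) \<in> atlas M"
  obtain U L \<phi> V K \<omega> where c': "(U', L', \<theta>) = (U \<times> V, L \<times> K, map_prod \<phi> \<omega>)"
    "(U, L, \<phi>) \<in> atlas M" "(V, K, \<omega>) \<in> atlas N"
    using c by (rule atlas_productE)
  note C = is_chartD[OF charts_chart[OF charted_imp_charts[OF charted_product[OF Mc N]] c]]
  note U = is_chartD[OF charts_chart[OF charted_imp_charts[OF Mc] c'(2)]]
  note A = is_chartD[OF charts_chart[OF charted_imp_charts[OF Mc] d]]
  have op: "openin (top_of_set L') (\<theta> ` (U' \<inter> fst -` A))"
    using C(4)[OF openin_chart_preimage[OF cont C(1) A(1)]] by blast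
  have "smooth_on L' (\<theta> ` (U' \<inter> fst -` A)) (\<lambda>x. (\<psi> \<circ> inv_into U \<phi>) (fst x))"
  proof (rule smooth_on_compose[OF C(2) U(2) op, where f = fst and V = "\<phi> ` (U \<inter> A)"])
    show "smooth_on L (\<phi> ` (U \<inter> A)) (\<psi> \<circ> inv_into U \<phi>)"
      using smooth_map_in_charts[OF smooth_manifold_id[OF M] c'(2) d] by simp
    show "smooth_on L' (\<theta> ` (U' \<inter> fst -` A)) fst"
      by (intro smooth_on_bounded_linear bounded_linear_fst)
    show "fst ` \<theta> ` (U' \<inter> fst -` A) \<subseteq> \<phi> ` (U \<inter> A)" using c'(1) by auto
  qed (use U(6) in blast)
  then show "smooth_on L' (\<theta> ` (U' \<inter> fst -` A)) (\<psi> \<circ> fst \<circ> inv_into U' \<theta>)"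
  proof (rule smooth_on_cong[OF op, rotated])
    fix x assume "x \<in> \<theta> ` (U' \<inter> fst -` A)"
    then obtain z where z: "z \<in> U'" "x = \<theta> z" by blast
    then show "(\<psi> \<circ> inv_into U \<phi>) (fst x) = (\<psi> \<circ> fst \<circ> inv_into U' \<theta>) x"
      using C(3) U(3) c'(1) by auto
  qed
qed

lemma smooth_map_snd:
  assumes M: "charted M" and N: "smooth_manifold N"
  shows "smooth_map (product_manifold M N) N snd"
proof (rule smooth_mapI)
  have Nc: "charted N" using smooth_manifold_imp_charted[OF N] .
  show cont: "continuous_map (topo (product_manifold M N)) (topo N) snd" by (simp add: continuous_map_snd)
  fix U' L' \<theta> A J \<psi>
  assume c: "(U', L', \<theta>) \<in> atlas (product_manifold M N)" and d: "(A, J, \<psi>) \<in> atlas N"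
  obtain U L \<phi> V K \<omega> where c': "(U', L', \<theta>) = (U \<times> V, L \<times> K, map_prod \<phi> \<omega>)"
    "(U, L, \<phi>) \<in> atlas M" "(V, K, \<omega>) \<in> atlas N"
    using c by (rule atlas_productE)
  note C = is_chartD[OF charts_chart[OF charted_imp_charts[OF charted_product[OF M Nc]] c]]
  note V = is_chartD[OF charts_chart[OF charted_imp_charts[OF Nc] c'(3)]]
  note A = is_chartD[OF charts_chart[OF charted_imp_charts[OF Nc] d]]
  have op: "openin (top_of_set L') (\<theta> ` (U' \<inter> snd -` A))"
    using C(4)[OF openin_chart_preimage[OF cont C(1) A(1)]] by blast
  have "smooth_on L' (\<theta> ` (U' \<inter> snd -` A)) (\<lambda>x. (\<psi> \<circ> inv_into V \<omega>) (snd x))"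
  proof (rule smooth_on_compose[OF C(2) V(2) op, where f = snd and V = "\<omega> ` (V \<inter> A)"])
    show "smooth_on K (\<omega> ` (V \<inter> A)) (\<psi> \<circ> inv_into V \<omega>)"
      using smooth_map_in_charts[OF smooth_manifold_id[OF N] c'(3) d] by simp
    show "smooth_on L' (\<theta> ` (U' \<inter> snd -` A)) snd"
      by (intro smooth_on_bounded_linear bounded_linear_snd)
    show "snd ` \<theta> ` (U' \<inter> snd -` A) \<subseteq> \<omega> ` (V \<inter> A)" using c'(1) by auto
  qed (use V(6) in blast)
  then show "smooth_on L' (\<theta> ` (U' \<inter> snd -` A)) (\<psi> \<circ> snd \<circ> inv_into U' \<theta>)"
  proof (rule smooth_on_cong[OF op, rotated])
    fix x assume "x \<in> \<theta> ` (U' \<inter> snd -` A)"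
    then obtain z where z: "z \<in> U'" "x = \<theta> z" by blast
    then show "(\<psi> \<circ> inv_into V \<omega>) (snd x) = (\<psi> \<circ> snd \<circ> inv_into U' \<theta>) x"
      using C(3) V(3) c'(1) by auto
  qed
qed

lemma smooth_manifold_product:
  assumes M: "smooth_manifold M" and N: "smooth_manifold N"
  shows "smooth_manifold (product_manifold M N)"
proof (rule smooth_manifoldI)
  note c = smooth_manifold_imp_charted[OF M] smooth_manifold_imp_charted[OF N]
  show "charted (product_manifold M N)" using c by (rule charted_product)
  have "smooth_map (product_manifold M N) (product_manifold M N) (\<lambda>z. (fst z, snd z))"
    by (rule smooth_map_pair[OF smooth_map_fst[OF M c(2)] smooth_map_snd[OF c(1) N]])
  then show "smooth_map (product_manifold M N) (product_manifold M N) id"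
    by (simp add: id_def)
qed

section \<open>Submersions and fibre products\<close>

lemma linear_right_inverse_on:
  fixes A :: "'a::euclidean_space \<Rightarrow> 'b::euclidean_space"
  assumes "linear A" "subspace L"
  obtains R where "bounded_linear R" "range R \<subseteq> L" "\<And>w. w \<in> A ` L \<Longrightarrow> A (R w) = w"
proof -
  obtain R where R: "range R \<subseteq> L" "linear R" "\<forall>w\<in>A ` L. A (R w) = w"
    using real_vector.linear_exists_right_inverse_on[of A L] assms
    by (auto simp: linear_def[symmetric] subspace_def)
  with that show ?thesis using linear_conv_bounded_linear by blast
qed

text \<open>Let \<open>R\<close> be a right inverse of \<open>A\<close>.  The map \<open>y \<mapsto> F (x0 + R (y - F x0))\<close> has the identity as derivative
  at \<open>F x0\<close>.  If \<open>k\<close> is a local inverse of it, then \<open>y \<mapsto> x0 + R (k y - F x0)\<close> is a section of \<open>F\<close>.\<close>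

lemma local_section_euclidean:
  fixes F :: "'e::euclidean_space \<Rightarrow> 'f::euclidean_space"
  assumes L: "subspace L" and J: "subspace J" and W: "openin (top_of_set L) W"
    and F: "smooth_on L W F" "F ` W \<subseteq> J" and x0: "x0 \<in> W"
    and A: "(F has_derivative A) (at x0 within L)" "A ` L = J"
  obtains Y l where "openin (top_of_set J) Y" "F x0 \<in> Y" "smooth_on J Y l" "l ` Y \<subseteq> W"
    "\<forall>y\<in>Y. F (l y) = y"
proof -
  obtain R where R: "bounded_linear R" "range R \<subseteq> L" "\<And>w. w \<in> J \<Longrightarrow> A (R w) = w"
    using linear_right_inverse_on[OF has_derivative_linear[OF A(1)] L] A(2) by metis
  have x0L: "x0 \<in> L" and y0J: "F x0 \<in> J" using W openin_imp_subset x0 F(2) by blast+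
  define h where "h = (\<lambda>y. x0 + R (y - F x0))"
  have hL: "h y \<in> L" for y
    unfolding h_def using L x0L R(2) by (intro subspace_add) auto
  have h_eq: "h = (\<lambda>y. (x0 - R (F x0)) + R y)"
    by (simp add: h_def fun_eq_iff linear_diff[OF bounded_linear.linear[OF R(1)]])
  have h0: "h (F x0) = x0"
    by (simp add: h_def linear_0[OF bounded_linear.linear[OF R(1)]])
  have hsm: "smooth_on J S h" for S
    unfolding h_eq by (intro smooth_on_add smooth_on_const smooth_on_bounded_linear R(1))
  have hder: "(h has_derivative R) (at y within S)" for y S
    unfolding h_eq
    using has_derivative_add[OF has_derivative_const bounded_linear_imp_has_derivative[OF R(1)]] by simp
  define Y0 where "Y0 = J \<inter> h -` W"
  have Y0: "openin (top_of_set J) Y0"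
    unfolding Y0_def
    by (rule continuous_openin_preimage[OF smooth_on_imp_continuous_on[OF hsm] _ W]) (use hL in auto)
  have hY0: "h ` Y0 \<subseteq> W" by (auto simp: Y0_def)
  have y0: "F x0 \<in> Y0" using x0 y0J h0 by (simp add: Y0_def)
  have WL: "W \<subseteq> L" using W openin_imp_subset by blast
  have sm: "smooth_on J Y0 (\<lambda>y. F (h y))"
    by (rule smooth_on_compose[OF J L Y0 WL hsm hY0 F(1)])
  have im: "(\<lambda>y. F (h y)) ` Y0 \<subseteq> J" using hY0 F(2) by blast
  have "(F has_derivative A) (at (h (F x0)) within h ` J)"
    using has_derivative_subset[OF A(1)] hL h0 by (simp add: image_subsetI)
  from has_derivative_in_compose[OF hder this]
  have der: "((\<lambda>y. F (h y)) has_derivative (\<lambda>v. A (R v))) (at (F x0) within J)" .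
  obtain Y1 k where k: "openin (top_of_set J) Y1" "Y1 \<subseteq> Y0" "F x0 \<in> Y1"
    "openin (top_of_set J) ((\<lambda>y. F (h y)) ` Y1)" "smooth_on J ((\<lambda>y. F (h y)) ` Y1) k"
    "\<forall>y\<in>Y1. k (F (h y)) = y"
    by (rule local_diffeomorphism_subspace[OF J Y0 y0 sm im der R(3)])
  let ?Y = "(\<lambda>y. F (h y)) ` Y1"
  have kY: "k ` ?Y \<subseteq> Y0" using k(2,6) by auto
  show ?thesis
  proof (rule that[of ?Y "\<lambda>y. h (k y)"])
    show "F x0 \<in> ?Y" using k(3) h0 by (intro image_eqI[of _ _ "F x0"]) auto
    show "(\<lambda>y. h (k y)) ` ?Y \<subseteq> W" using hY0 kY by blast
    have "Y0 \<subseteq> J" by (auto simp: Y0_def)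
    then show "smooth_on J ?Y (\<lambda>y. h (k y))"
      by (rule smooth_on_compose[OF J J k(4) _ k(5) kY hsm])
    show "\<forall>y\<in>?Y. F (h (k y)) = y" using k(6) by auto
  qed (rule k(4))
qed

text \<open>Let \<open>R\<close> be a right inverse of \<open>C\<close>.  The map \<open>\<theta> z = z + R (H z - C z)\<close> has the identity as derivative at
  \<open>z0\<close> and satisfies \<open>C (\<theta> z) = H z\<close>, so that it carries the zero set of \<open>H\<close> to the kernel of \<open>C\<close>
  without a separate choice of a complement of that kernel.\<close>

lemma straighten_zero_set:
  fixes H :: "'e::euclidean_space \<Rightarrow> 'f::euclidean_space"
  assumes L: "subspace L" and J: "subspace J" and W: "openin (top_of_set L) W"
    and H: "smooth_on L W H" "H ` W \<subseteq> J" and z0: "z0 \<in> W"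
    and C: "(H has_derivative C) (at z0 within L)" "C ` L = J"
  obtains O' \<theta> g S where "openin (top_of_set L) O'" "O' \<subseteq> W" "z0 \<in> O'"
    "smooth_on L O' \<theta>" "openin (top_of_set L) (\<theta> ` O')"
    "smooth_on L (\<theta> ` O') g" "\<forall>z\<in>O'. g (\<theta> z) = z"
    "subspace S" "S \<subseteq> L" "\<forall>z\<in>O'. \<theta> z \<in> S \<longleftrightarrow> H z = 0"
proof -
  have linC: "linear C" using C(1) by (rule has_derivative_linear)
  have blC: "bounded_linear C" using C(1) by (rule has_derivative_bounded_linear)
  obtain R where R: "bounded_linear R" "range R \<subseteq> L" "\<And>w. w \<in> J \<Longrightarrow> C (R w) = w"
    using linear_right_inverse_on[OF linC L] C(2) by metis
  have linR: "linear R" using R(1) bounded_linear.linear by blast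
  have WL: "W \<subseteq> L" using W openin_imp_subset by blast
  let ?\<theta> = "\<lambda>z. z + R (H z - C z)"
  have sm: "smooth_on L W ?\<theta>"
    by (intro smooth_on_add smooth_on_linear_compose[OF R(1)] smooth_on_diff H(1)
        smooth_on_bounded_linear[OF blC] smooth_on_bounded_linear[OF bounded_linear_ident])
  have im: "?\<theta> ` W \<subseteq> L"
    using WL R(2) L by (auto intro!: subspace_add)
  have der: "(?\<theta> has_derivative (\<lambda>v. v + R (C v - C v))) (at z0 within L)"
    by (intro has_derivative_add has_derivative_diff has_derivative_ident C(1)
        bounded_linear.has_derivative[OF R(1)] bounded_linear_imp_has_derivative[OF blC])
  have der_id: "v + R (C v - C v) = v" for v
    using linear_0[OF linR] by simp
  obtain O' g where O': "openin (top_of_set L) O'" "O' \<subseteq> W" "z0 \<in> O'"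
    "openin (top_of_set L) (?\<theta> ` O')" "smooth_on L (?\<theta> ` O') g"
    "\<forall>z\<in>O'. g (?\<theta> z) = z"
    by (rule local_diffeomorphism_subspace[OF L W z0 sm im der der_id])
  show ?thesis
  proof (rule that[OF O'(1-3) _ O'(4-6), of "{z \<in> L. C z = 0}"])
    show "smooth_on L O' ?\<theta>" using sm by (rule smooth_on_mono) (use O'(2) in auto)
    show "subspace {z \<in> L. C z = 0}"
      unfolding subspace_def
      using subspace_0[OF L] subspace_add[OF L] subspace_scale[OF L]
      by (simp add: linear_0[OF linC] linear_add[OF linC] linear_scale[OF linC])
    show "\<forall>z\<in>O'. ?\<theta> z \<in> {z \<in> L. C z = 0} \<longleftrightarrow> H z = 0"
    proof
      fix z assume "z \<in> O'"
      then have z: "z \<in> W" "z \<in> L" using O'(2) WL by auto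
      have "H z \<in> J" "C z \<in> J" using H(2) C(2) z by blast+
      then have "H z - C z \<in> J" by (rule subspace_diff[OF J])
      then have "C (?\<theta> z) = H z" by (simp add: linear_add[OF linC] R(3))
      moreover have "?\<theta> z \<in> L" using im z by blast
      ultimately show "?\<theta> z \<in> {z \<in> L. C z = 0} \<longleftrightarrow> H z = 0" by simp
    qed
  qed auto
qed

lemma fibre_product_simps:
  "topo (fibre_product M N f g) =
    subtopology (prod_topology (topo M) (topo N)) {(p, q). p \<in> pts M \<and> q \<in> pts N \<and> f p = g q}"
  by (simp add: fibre_product_def)

lemma pts_fibre_product [simp]:
  "pts (fibre_product M N f g) = {(p, q). p \<in> pts M \<and> q \<in> pts N \<and> f p = g q}"
  by (auto simp: fibre_product_simps)

lemma submersion_in_charts: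
  assumes "submersion M N f" "(U, L, \<phi>) \<in> atlas M" "(V, K, \<psi>) \<in> atlas N" "p \<in> U" "f p \<in> V"
  obtains D where "(\<psi> \<circ> f \<circ> inv_into U \<phi> has_derivative D) (at (\<phi> p) within L)" "D ` L = K"
  using assms unfolding submersion_def by fastforce

text \<open>In charts the fibre product is the zero set of \<open>(x, y) \<mapsto> F x - G y\<close>, whose derivative is onto as soon
  as that of \<open>F\<close> or of \<open>G\<close> is.  Straightening this zero set gives a slice chart.\<close>

lemma charted_fibre_product:
  assumes M: "smooth_manifold M" and N: "smooth_manifold N" and X: "charted X"
    and f: "smooth_map M X f" and g: "smooth_map N X g"
    and sub: "submersion M X f \<or> submersion N X g"
  shows "charted (fibre_product M N f g)"
  unfolding charted_def
proof (intro conjI ballI)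
  show "charts (fibre_product M N f g)" unfolding fibre_product_def by (rule charts_submanifold)
  fix z assume z: "z \<in> pts (fibre_product M N f g)"
  then obtain p q where pq: "z = (p, q)" "p \<in> pts M" "q \<in> pts N" "f p = g q" by auto
  have Mc: "charted M" and Nc: "charted N" using M N smooth_manifold_imp_charted by blast+
  obtain U L \<phi> where U: "(U, L, \<phi>) \<in> atlas M" "p \<in> U" using charted_chart_at[OF Mc pq(2)] by metis
  obtain V K \<psi> where V: "(V, K, \<psi>) \<in> atlas N" "q \<in> V" using charted_chart_at[OF Nc pq(3)] by metis
  obtain Z J \<kappa> where Z: "(Z, J, \<kappa>) \<in> atlas X" "f p \<in> Z"
    using charted_chart_at[OF X smooth_map_closed[OF f pq(2)]] by metis
  note Uc = is_chartD[OF charts_chart[OF charted_imp_charts[OF Mc] U(1)]]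
  note Vc = is_chartD[OF charts_chart[OF charted_imp_charts[OF Nc] V(1)]]
  note Zc = is_chartD[OF charts_chart[OF charted_imp_charts[OF X] Z(1)]]
  let ?F = "\<kappa> \<circ> f \<circ> inv_into U \<phi>" and ?G = "\<kappa> \<circ> g \<circ> inv_into V \<psi>"
  let ?V = "\<phi> ` (U \<inter> f -` Z)" and ?W = "\<psi> ` (V \<inter> g -` Z)"
  have oV: "openin (top_of_set L) ?V"
    using Uc(4)[OF openin_chart_preimage[OF smooth_map_continuous[OF f] Uc(1) Zc(1)]] by blast
  have oW: "openin (top_of_set K) ?W"
    using Vc(4)[OF openin_chart_preimage[OF smooth_map_continuous[OF g] Vc(1) Zc(1)]] by blast
  have iF: "?F ` ?V \<subseteq> J" using Zc(6) Uc(3) by auto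
  have iG: "?G ` ?W \<subseteq> J" using Zc(6) Vc(3) by auto
  have pV: "\<phi> p \<in> ?V" and qW: "\<psi> q \<in> ?W" using U(2) V(2) Z(2) pq(4) by auto
  note smF = smooth_map_in_charts[OF f U(1) Z(1)] and smG = smooth_map_in_charts[OF g V(1) Z(1)]
  obtain A0 where "\<forall>x\<in>?V. (?F has_derivative A0 x) (at x within L)"
    by (rule smooth_on_derivative[OF Uc(2) oV smF])
  then obtain A1 where A1: "(?F has_derivative A1) (at (\<phi> p) within L)" "range A1 \<subseteq> J"
    using derivative_into_subspace[OF Zc(2) oV pV iF] pV by metis
  obtain B0 where "\<forall>x\<in>?W. (?G has_derivative B0 x) (at x within K)"
    by (rule smooth_on_derivative[OF Vc(2) oW smG])
  then obtain B1 where B1: "(?G has_derivative B1) (at (\<psi> q) within K)" "range B1 \<subseteq> J"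
    using derivative_into_subspace[OF Zc(2) oW qW iG] qW by metis
  obtain A B where A: "(?F has_derivative A) (at (\<phi> p) within L)" "A ` L \<subseteq> J"
    and B: "(?G has_derivative B) (at (\<psi> q) within K)" "B ` K \<subseteq> J"
    and surj: "A ` L = J \<or> B ` K = J"
  proof (cases "submersion M X f")
    case True
    obtain A where "(?F has_derivative A) (at (\<phi> p) within L)" "A ` L = J"
      using submersion_in_charts[OF True U(1) Z(1) U(2) Z(2)] by metis
    with B1 show ?thesis by (intro that[of A B1]) auto
  next
    case False
    then have "submersion N X g" using sub by blast
    then obtain B where "(?G has_derivative B) (at (\<psi> q) within K)" "B ` K = J"
      using submersion_in_charts[OF _ V(1) Z(1) V(2)] Z(2) pq(4) by metis
    with A1 show ?thesis by (intro that[of A1 B]) auto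
  qed
  let ?H = "\<lambda>z. ?F (fst z) - ?G (snd z)" and ?C = "\<lambda>v. A (fst v) - B (snd v)"
  have LK: "subspace (L \<times> K)" using Uc(2) Vc(2) by (rule subspace_Times)
  have VL: "?V \<subseteq> L" and WK: "?W \<subseteq> K" using Uc(6) Vc(6) by blast+
  have VW: "openin (top_of_set (L \<times> K)) (?V \<times> ?W)" using oV oW by (rule openin_Times)
  have zVW: "(\<phi> p, \<psi> q) \<in> ?V \<times> ?W" using pV qW by blast
  have smH: "smooth_on (L \<times> K) (?V \<times> ?W) ?H"
    by (intro smooth_on_diff
        smooth_on_compose[OF LK Uc(2) VW VL smooth_on_bounded_linear[OF bounded_linear_fst] _ smF]
        smooth_on_compose[OF LK Vc(2) VW WK smooth_on_bounded_linear[OF bounded_linear_snd] _ smG]) auto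
  have imH: "?H ` (?V \<times> ?W) \<subseteq> J"
    using iF iG by (auto intro!: subspace_diff[OF Zc(2)])
  have derF: "((\<lambda>z. ?F (fst z)) has_derivative (\<lambda>v. A (fst v))) (at (\<phi> p, \<psi> q) within L \<times> K)"
  proof (rule has_derivative_compose_subspace[OF VW zVW,
        where f = fst and D = fst and g = ?F and E = A and J = L])
    show "fst ` (?V \<times> ?W) \<subseteq> L" using VL by auto
    show "(fst has_derivative fst) (at (\<phi> p, \<psi> q) within L \<times> K)"
      by (rule bounded_linear_imp_has_derivative[OF bounded_linear_fst])
    show "(?F has_derivative A) (at (fst (\<phi> p, \<psi> q)) within L)"
      using A(1) by (simp only: fst_conv)
  qed
  have derG: "((\<lambda>z. ?G (snd z)) has_derivative (\<lambda>v. B (snd v))) (at (\<phi> p, \<psi> q) within L \<times> K)"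
  proof (rule has_derivative_compose_subspace[OF VW zVW,
        where f = snd and D = snd and g = ?G and E = B and J = K])
    show "snd ` (?V \<times> ?W) \<subseteq> K" using WK by auto
    show "(snd has_derivative snd) (at (\<phi> p, \<psi> q) within L \<times> K)"
      by (rule bounded_linear_imp_has_derivative[OF bounded_linear_snd])
    show "(?G has_derivative B) (at (snd (\<phi> p, \<psi> q)) within K)"
      using B(1) by (simp only: snd_conv)
  qed
  have derH: "(?H has_derivative ?C) (at (\<phi> p, \<psi> q) within L \<times> K)"
    using derF derG by (rule has_derivative_diff)
  have linA: "linear A" and linB: "linear B" using A(1) B(1) has_derivative_linear by blast+
  have surjC: "?C ` (L \<times> K) = J"
  proof
    show "?C ` (L \<times> K) \<subseteq> J" using A(2) B(2) by (auto intro!: subspace_diff[OF Zc(2)])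
    show "J \<subseteq> ?C ` (L \<times> K)"
      using surj
    proof
      assume *: "A ` L = J"
      show ?thesis
      proof
        fix w assume "w \<in> J"
        then obtain v where "v \<in> L" "w = A v" using * by blast
        then show "w \<in> ?C ` (L \<times> K)"
          using subspace_0[OF Vc(2)] by (intro image_eqI[of _ _ "(v, 0)"]) (simp_all add: linear_0[OF linB])
      qed
    next
      assume *: "B ` K = J"
      show ?thesis
      proof
        fix w assume "w \<in> J"
        then obtain v where "v \<in> K" "w = B v" using * by blast
        then show "w \<in> ?C ` (L \<times> K)"
          using subspace_0[OF Uc(2)] subspace_neg[OF Vc(2)]
          by (intro image_eqI[of _ _ "(0, - v)"]) (simp_all add: linear_0[OF linA] linear_neg[OF linB])
      qed
    qed
  qed
  obtain O' \<theta> h S where O': "openin (top_of_set (L \<times> K)) O'" "O' \<subseteq> ?V \<times> ?W" "(\<phi> p, \<psi> q) \<in> O'"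
    "smooth_on (L \<times> K) O' \<theta>" "openin (top_of_set (L \<times> K)) (\<theta> ` O')"
    "smooth_on (L \<times> K) (\<theta> ` O') h" "\<forall>z\<in>O'. h (\<theta> z) = z"
    and S: "subspace S" "S \<subseteq> L \<times> K" "\<forall>z\<in>O'. \<theta> z \<in> S \<longleftrightarrow> ?H z = 0"
    by (rule straighten_zero_set[OF LK Zc(2) VW smH imH zVW derH surjC])
  let ?P = "product_manifold M N" and ?\<phi> = "map_prod \<phi> \<psi>"
  have P: "smooth_manifold ?P" using M N by (rule smooth_manifold_product)
  have "(U \<times> V, L \<times> K, ?\<phi>) \<in> max_atlas ?P"
    using atlas_productI[OF U(1) V(1)] atlas_subset_max_atlas[OF P] by blast
  from max_atlas_reparametrize[OF charted_imp_charts[OF smooth_manifold_imp_charted[OF P]] this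
      O'(1) _ O'(4-6) O'(7)[rule_format]]
  have max: "(U \<times> V \<inter> ?\<phi> -` O', L \<times> K, \<theta> \<circ> ?\<phi>) \<in> max_atlas ?P" (is "(?U, _, _) \<in> _")
    using O'(2) by auto
  let ?T = "{(p, q). p \<in> pts M \<and> q \<in> pts N \<and> f p = g q}"
  have mem: "(\<theta> \<circ> ?\<phi>) (m, n) \<in> S \<longleftrightarrow> (m, n) \<in> ?T" if mn: "(m, n) \<in> ?U" for m n
  proof -
    have m: "m \<in> U" "n \<in> V" "(\<phi> m, \<psi> n) \<in> O'" using mn by auto
    then have "\<phi> m \<in> ?V" "\<psi> n \<in> ?W" using O'(2) by blast+
    then have "f m \<in> Z" "g n \<in> Z" using Uc(3) Vc(3) m by (auto dest: inj_onD)
    moreover have "?F (\<phi> m) = \<kappa> (f m)" "?G (\<psi> n) = \<kappa> (g n)" using Uc(3) Vc(3) m by simp_all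
    ultimately have "?F (\<phi> m) = ?G (\<psi> n) \<longleftrightarrow> f m = g n" using Zc(3) by (auto dest: inj_onD)
    then show ?thesis using bspec[OF S(3) m(3)] m Uc(7) Vc(7) by auto
  qed
  have slice: "(\<theta> \<circ> ?\<phi>) ` (?U \<inter> ?T) = (\<theta> \<circ> ?\<phi>) ` ?U \<inter> S"
  proof
    show "(\<theta> \<circ> ?\<phi>) ` (?U \<inter> ?T) \<subseteq> (\<theta> \<circ> ?\<phi>) ` ?U \<inter> S" using mem by blast
    show "(\<theta> \<circ> ?\<phi>) ` ?U \<inter> S \<subseteq> (\<theta> \<circ> ?\<phi>) ` (?U \<inter> ?T)"
    proof
      fix y assume y: "y \<in> (\<theta> \<circ> ?\<phi>) ` ?U \<inter> S"
      then obtain m n where "(m, n) \<in> ?U" "y = (\<theta> \<circ> ?\<phi>) (m, n)" by fast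
      then show "y \<in> (\<theta> \<circ> ?\<phi>) ` (?U \<inter> ?T)" using mem y by blast
    qed
  qed
  from atlas_submanifoldI[OF max S(1,2) slice]
  have "(?U \<inter> ?T, S, \<theta> \<circ> ?\<phi>) \<in> atlas (fibre_product M N f g)" by (simp only: fibre_product_def)
  moreover have "z \<in> ?U \<inter> ?T" using pq U(2) V(2) O'(3) by simp
  ultimately show "\<exists>U L \<phi>. (U, L, \<phi>) \<in> atlas (fibre_product M N f g) \<and> z \<in> U" by blast
qed

section \<open>Local sections\<close>

text \<open>An open subset \<open>W\<close> of a model space \<open>L\<close>, regarded as a manifold.  Charts and their inverses become
  smooth maps to and from such spaces, so that a map built in coordinates can be transported to a
  manifold by composition.\<close>

definition coordinate_space :: "'e::euclidean_space set \<Rightarrow> 'e set \<Rightarrow> ('e, 'e) mfd" where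
  "coordinate_space L W = \<lparr>topo = top_of_set W, atlas = {(W, L, \<lambda>x. x)}\<rparr>"

lemma coordinate_space_simps [simp]:
  "topo (coordinate_space L W) = top_of_set W"
  "atlas (coordinate_space L W) = {(W, L, \<lambda>x. x)}"
  by (simp_all add: coordinate_space_def)

lemma charted_coordinate_space:
  assumes "subspace L" "openin (top_of_set L) W"
  shows "charted (coordinate_space L W)"
proof -
  have "is_chart (top_of_set W) (W, L, \<lambda>x. x)"
    unfolding is_chart_iff
  proof (intro conjI allI impI)
    fix O' assume "openin (top_of_set W) O'"
    then show "openin (top_of_set L) ((\<lambda>x. x) ` O')" using openin_trans assms(2) by simp
  next
    fix V assume "openin (top_of_set L) V"
    then obtain T where "open T" "V = L \<inter> T" by (auto simp: openin_open)
    moreover have "W \<subseteq> L" using assms(2) openin_imp_subset by blast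
    ultimately have "W \<inter> (\<lambda>x. x) -` V = W \<inter> T" by blast
    then show "openin (top_of_set W) (W \<inter> (\<lambda>x. x) -` V)"
      using openin_open_Int[OF \<open>open T\<close>] by simp
  qed (use assms(1) in auto)
  then show ?thesis by (auto simp: charted_def charts_def)
qed

lemma smooth_map_coordinate_space:
  assumes "openin (top_of_set J) Y" "smooth_on J Y l" "l ` Y \<subseteq> W"
  shows "smooth_map (coordinate_space J Y) (coordinate_space L W) l"
proof (rule smooth_mapI)
  show "continuous_map (topo (coordinate_space J Y)) (topo (coordinate_space L W)) l"
    using smooth_on_imp_continuous_on[OF assms(2)] assms(3) by auto
  fix A B \<phi> A' B' \<psi>
  assume "(A, B, \<phi>) \<in> atlas (coordinate_space J Y)" "(A', B', \<psi>) \<in> atlas (coordinate_space L W)"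
  then have eq: "A = Y" "B = J" "\<phi> = (\<lambda>x. x)" "A' = W" "\<psi> = (\<lambda>x. x)" by auto
  have "(\<lambda>x. x) ` (Y \<inter> l -` W) = Y" using assms(3) by auto
  moreover have "smooth_on J Y ((\<lambda>x. x) \<circ> l \<circ> inv_into Y (\<lambda>x. x))"
    using assms(2)
  proof (rule smooth_on_cong[OF assms(1), rotated])
    fix x assume "x \<in> Y"
    then have "inv_into Y (\<lambda>x. x) x = x" using inv_into_f_f[of "\<lambda>x. x" Y x] by simp
    then show "l x = ((\<lambda>x. x) \<circ> l \<circ> inv_into Y (\<lambda>x. x)) x" by simp
  qed
  ultimately show "smooth_on B (\<phi> ` (A \<inter> l -` A')) (\<psi> \<circ> l \<circ> inv_into A \<phi>)"
    unfolding eq by simp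
qed

lemma smooth_map_chart:
  assumes X: "smooth_manifold X" and c: "(Z, J, \<kappa>) \<in> atlas X"
    and O: "openin (topo X) O'" "O' \<subseteq> Z"
  shows "smooth_map (submanifold X O') (coordinate_space J (\<kappa> ` O')) \<kappa>"
proof (rule smooth_mapI)
  have Xc: "charts X" using X smooth_manifold_imp_charted charted_imp_charts by blast
  note C = is_chartD[OF charts_chart[OF Xc c]]
  have oO: "openin (top_of_set J) (\<kappa> ` O')" using C(4)[OF O] .
  have OX: "O' \<subseteq> pts X" using O(1) openin_subset by blast
  show "continuous_map (topo (submanifold X O')) (topo (coordinate_space J (\<kappa> ` O'))) \<kappa>"
    unfolding continuous_map_def
  proof (intro conjI allI impI)
    show "\<kappa> \<in> pts (submanifold X O') \<rightarrow> pts (coordinate_space J (\<kappa> ` O'))" by auto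
    fix W assume "openin (topo (coordinate_space J (\<kappa> ` O'))) W"
    then have "openin (top_of_set J) W" using openin_trans[OF _ oO] by simp
    from C(5)[OF this] have "openin (topo X) (Z \<inter> \<kappa> -` W)" .
    moreover have "{x \<in> pts (submanifold X O'). \<kappa> x \<in> W} = (Z \<inter> \<kappa> -` W) \<inter> O'"
      using O(2) OX by auto
    ultimately show "openin (topo (submanifold X O')) {x \<in> pts (submanifold X O'). \<kappa> x \<in> W}"
      by (auto simp: openin_subtopology)
  qed
  fix U L \<phi> V K \<psi>
  assume d: "(U, L, \<phi>) \<in> atlas (submanifold X O')" "(V, K, \<psi>) \<in> atlas (coordinate_space J (\<kappa> ` O'))"
  then have eq: "V = \<kappa> ` O'" "\<psi> = (\<lambda>x. x)" by auto
  have "U \<subseteq> O'" using atlas_submanifoldE[OF d(1)] by blast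
  then have "U \<inter> \<kappa> -` V = U \<inter> id -` Z" using O(2) eq by auto
  then show "smooth_on L (\<phi> ` (U \<inter> \<kappa> -` V)) (\<psi> \<circ> \<kappa> \<circ> inv_into U \<phi>)"
    using smooth_map_in_charts[OF smooth_map_inclusion[OF Xc] d(1) c] by (simp add: eq comp_def)
qed

lemma smooth_map_chart_inverse:
  assumes M: "smooth_manifold M" and c: "(U, L, \<phi>) \<in> atlas M"
  shows "smooth_map (coordinate_space L (\<phi> ` U)) M (inv_into U \<phi>)"
proof (rule smooth_mapI)
  have Mc: "charts M" using M smooth_manifold_imp_charted charted_imp_charts by blast
  note C = is_chartD[OF charts_chart[OF Mc c]]
  have im: "\<phi> ` U \<inter> inv_into U \<phi> -` V = \<phi> ` (U \<inter> V)" for V using C(3) by auto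
  have op: "openin (top_of_set L) (\<phi> ` (U \<inter> V))" if "openin (topo M) V" for V
    using C(4)[of "U \<inter> V"] C(1) that by blast
  show "continuous_map (topo (coordinate_space L (\<phi> ` U))) (topo M) (inv_into U \<phi>)"
    unfolding continuous_map_def
  proof (intro conjI allI impI)
    show "inv_into U \<phi> \<in> pts (coordinate_space L (\<phi> ` U)) \<rightarrow> pts M"
      using C(7) inv_into_into[of _ \<phi> U] by auto
    fix V assume V: "openin (topo M) V"
    have "{x \<in> pts (coordinate_space L (\<phi> ` U)). inv_into U \<phi> x \<in> V} = \<phi> ` (U \<inter> V)"
      using im[of V] by auto
    then show "openin (topo (coordinate_space L (\<phi> ` U)))
        {x \<in> pts (coordinate_space L (\<phi> ` U)). inv_into U \<phi> x \<in> V}"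
      using openin_subset_trans[OF op[OF V] _ C(6)] by auto
  qed
  fix A B \<theta> V K \<psi>
  assume d: "(A, B, \<theta>) \<in> atlas (coordinate_space L (\<phi> ` U))" "(V, K, \<psi>) \<in> atlas M"
  then have eq: "A = \<phi> ` U" "B = L" "\<theta> = (\<lambda>x. x)" by auto
  have "smooth_on L (\<phi> ` (U \<inter> V)) (\<psi> \<circ> inv_into U \<phi>)"
    using smooth_map_in_charts[OF smooth_manifold_id[OF M] c d(2)] by simp
  then have "smooth_on L (\<phi> ` (U \<inter> V)) (\<psi> \<circ> inv_into U \<phi> \<circ> inv_into (\<phi> ` U) (\<lambda>x. x))"
  proof (rule smooth_on_cong[OF op[OF is_chartD(1)[OF charts_chart[OF Mc d(2)]]], rotated])
    fix x assume "x \<in> \<phi> ` (U \<inter> V)"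
    then have "x \<in> \<phi> ` U" by blast
    then have "inv_into (\<phi> ` U) (\<lambda>x. x) x = x"
      using inv_into_f_f[of "\<lambda>x. x" "\<phi> ` U" x] by simp
    then show "(\<psi> \<circ> inv_into U \<phi>) x = (\<psi> \<circ> inv_into U \<phi> \<circ> inv_into (\<phi> ` U) (\<lambda>x. x)) x" by simp
  qed
  then show "smooth_on B (\<theta> ` (A \<inter> inv_into U \<phi> -` V)) (\<psi> \<circ> inv_into U \<phi> \<circ> inv_into A \<theta>)"
    unfolding eq im by simp
qed

lemma submersion_local_section:
  assumes M: "smooth_manifold M" and X: "smooth_manifold X" and f: "submersion M X f"
    and p: "p \<in> pts M"
  obtains O' s where "openin (topo X) O'" "f p \<in> O'" "smooth_map (submanifold X O') M s"
    "\<forall>x\<in>O'. f (s x) = x"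
proof -
  have fs: "smooth_map M X f" using f by (simp add: submersion_def)
  have Mc: "charted M" and Xc: "charted X" using M X smooth_manifold_imp_charted by blast+
  obtain U L \<phi> where U: "(U, L, \<phi>) \<in> atlas M" "p \<in> U" using charted_chart_at[OF Mc p] by metis
  obtain Z J \<kappa> where Z: "(Z, J, \<kappa>) \<in> atlas X" "f p \<in> Z"
    using charted_chart_at[OF Xc smooth_map_closed[OF fs p]] by metis
  note Uc = is_chartD[OF charts_chart[OF charted_imp_charts[OF Mc] U(1)]]
  note Zc = is_chartD[OF charts_chart[OF charted_imp_charts[OF Xc] Z(1)]]
  let ?F = "\<kappa> \<circ> f \<circ> inv_into U \<phi>" and ?V = "\<phi> ` (U \<inter> f -` Z)"
  have oV: "openin (top_of_set L) ?V"
    using Uc(4)[OF openin_chart_preimage[OF smooth_map_continuous[OF fs] Uc(1) Zc(1)]] by blast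
  have iF: "?F ` ?V \<subseteq> J" using Zc(6) Uc(3) by auto
  have pV: "\<phi> p \<in> ?V" using U(2) Z(2) by auto
  obtain A where A: "(?F has_derivative A) (at (\<phi> p) within L)" "A ` L = J"
    using submersion_in_charts[OF f U(1) Z(1) U(2) Z(2)] by metis
  obtain Y l where Y: "openin (top_of_set J) Y" "?F (\<phi> p) \<in> Y" "smooth_on J Y l" "l ` Y \<subseteq> ?V"
    "\<forall>y\<in>Y. ?F (l y) = y"
    by (rule local_section_euclidean[OF Uc(2) Zc(2) oV smooth_map_in_charts[OF fs U(1) Z(1)] iF pV A])
  define O' where "O' = Z \<inter> \<kappa> -` Y"
  have oO: "openin (topo X) O'" unfolding O'_def by (rule Zc(5)[OF Y(1)])
  have imO: "\<kappa> ` O' \<subseteq> Y" "O' \<subseteq> Z" by (auto simp: O'_def)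
  have okO: "openin (top_of_set J) (\<kappa> ` O')" using Zc(4)[OF oO imO(2)] .
  have lO: "l ` (\<kappa> ` O') \<subseteq> ?V" using imO(1) Y(4) by blast
  have "?V \<subseteq> \<phi> ` U" by blast
  then have lU: "l ` (\<kappa> ` O') \<subseteq> \<phi> ` U" using lO by (rule order_trans[rotated])
  have 1: "smooth_map (submanifold X O') (coordinate_space J (\<kappa> ` O')) \<kappa>"
    by (rule smooth_map_chart[OF X Z(1) oO imO(2)])
  have 2: "smooth_map (coordinate_space J (\<kappa> ` O')) (coordinate_space L (\<phi> ` U)) l"
    by (rule smooth_map_coordinate_space[OF okO smooth_on_mono[OF Y(3) order_refl imO(1)] lU])
  have cJ: "charted (coordinate_space J (\<kappa> ` O'))" and cL: "charted (coordinate_space L (\<phi> ` U))"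
    using charted_coordinate_space Zc(2) okO Uc(2) Uc(4)[OF Uc(1)] by blast+
  have "smooth_map (submanifold X O') M (inv_into U \<phi> \<circ> (l \<circ> \<kappa>))"
    by (rule smooth_map_compose[OF charts_submanifold cL charted_imp_charts[OF Mc]
          smooth_map_compose[OF charts_submanifold cJ charted_imp_charts[OF cL] 1 2]
          smooth_map_chart_inverse[OF M U(1)]])
  moreover have "f (inv_into U \<phi> (l (\<kappa> x))) = x" if x: "x \<in> O'" for x
  proof -
    have kx: "\<kappa> x \<in> Y" "x \<in> Z" using x by (auto simp: O'_def)
    then obtain m where m: "m \<in> U" "f m \<in> Z" "l (\<kappa> x) = \<phi> m" using Y(4) by blast
    have "?F (l (\<kappa> x)) = \<kappa> x" using Y(5) kx(1) by blast
    then have "\<kappa> (f m) = \<kappa> x" using m Uc(3) by simp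
    then have "f m = x" using Zc(3) m(2) kx(2) by (auto dest: inj_onD)
    then show ?thesis using m Uc(3) by simp
  qed
  moreover have "f p \<in> O'" using Y(2) U(2) Z(2) Uc(3) by (simp add: O'_def)
  ultimately show ?thesis using that[OF oO, of "inv_into U \<phi> \<circ> (l \<circ> \<kappa>)"] by simp
qed

text \<open>By the chain rule the derivatives of \<open>i\<close> and \<open>j\<close> in charts are inverse to each other, so that of \<open>i\<close> is
  onto the model space of \<open>N\<close>.  The case of interest is the target map of a Lie groupoid, which is the
  source map after inversion.\<close>

lemma submersion_compose_diffeomorphism:
  assumes M: "smooth_manifold M" and N: "smooth_manifold N" and X: "charted X"
    and f: "submersion N X f" and i: "smooth_map M N i" and j: "smooth_map N M j"
    and ji: "\<And>p. p \<in> pts M \<Longrightarrow> j (i p) = p" and ij: "\<And>q. q \<in> pts N \<Longrightarrow> i (j q) = q"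
    and t: "\<And>p. p \<in> pts M \<Longrightarrow> t p = f (i p)"
  shows "submersion M X t"
proof -
  have Mc: "charted M" and Nc: "charted N" using M N smooth_manifold_imp_charted by blast+
  have fs: "smooth_map N X f" using f by (simp add: submersion_def)
  have Mch: "charts M" and Nch: "charts N" and Xch: "charts X"
    using Mc Nc X charted_imp_charts by blast+
  have ts: "smooth_map M X t"
    by (rule smooth_map_cong[OF Mch Xch smooth_map_compose[OF Mch Nc Xch i fs]]) (simp add: t)
  have "\<exists>D. (\<psi> \<circ> t \<circ> inv_into U \<phi> has_derivative D) (at (\<phi> p) within L) \<and> D ` L = K"
    if c: "(U, L, \<phi>) \<in> atlas M" and d: "(V, K, \<psi>) \<in> atlas X" and p: "p \<in> U" "t p \<in> V"
    for U L \<phi> V K \<psi> p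
  proof -
    note Uc = is_chartD[OF charts_chart[OF Mch c]]
    have pM: "p \<in> pts M" using p(1) Uc(7) by blast
    obtain W J \<kappa> where W: "(W, J, \<kappa>) \<in> atlas N" "i p \<in> W"
      using charted_chart_at[OF Nc smooth_map_closed[OF i pM]] by metis
    note Wc = is_chartD[OF charts_chart[OF Nch W(1)]]
    let ?i = "\<kappa> \<circ> i \<circ> inv_into U \<phi>" and ?j = "\<phi> \<circ> j \<circ> inv_into W \<kappa>"
    let ?S = "\<phi> ` (U \<inter> i -` W)" and ?T = "\<kappa> ` (W \<inter> j -` U)"
    have oS: "openin (top_of_set L) ?S"
      using Uc(4)[OF openin_chart_preimage[OF smooth_map_continuous[OF i] Uc(1) Wc(1)]] by blast
    have oT: "openin (top_of_set J) ?T"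
      using Wc(4)[OF openin_chart_preimage[OF smooth_map_continuous[OF j] Wc(1) Uc(1)]] by blast
    have pS: "\<phi> p \<in> ?S" and pT: "\<kappa> (i p) \<in> ?T" using p(1) W(2) ji[OF pM] by auto
    have iS: "?i ` ?S \<subseteq> J" and jT: "?j ` ?T \<subseteq> L" using Uc(3,6) Wc(3,6) by auto
    have ip: "?i (\<phi> p) = \<kappa> (i p)" and jp: "?j (\<kappa> (i p)) = \<phi> p"
      using p(1) W(2) Uc(3) Wc(3) ji[OF pM] by simp_all
    obtain I0 where "\<forall>x\<in>?S. (?i has_derivative I0 x) (at x within L)"
      by (rule smooth_on_derivative[OF Uc(2) oS smooth_map_in_charts[OF i c W(1)]])
    then obtain I where I: "(?i has_derivative I) (at (\<phi> p) within L)" "range I \<subseteq> J"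
      using derivative_into_subspace[OF Wc(2) oS pS iS] pS by metis
    obtain I0' where "\<forall>x\<in>?T. (?j has_derivative I0' x) (at x within J)"
      by (rule smooth_on_derivative[OF Wc(2) oT smooth_map_in_charts[OF j W(1) c]])
    then obtain I' where I': "(?j has_derivative I') (at (\<kappa> (i p)) within J)" "range I' \<subseteq> L"
      using derivative_into_subspace[OF Uc(2) oT pT jT] pT by metis
    have "((\<lambda>x. ?i (?j x)) has_derivative (\<lambda>v. I (I' v))) (at (\<kappa> (i p)) within J)"
      by (rule has_derivative_compose_subspace[OF oT pT jT I'(1), of ?i])
        (use I(1) jp in simp)
    then have idd: "((\<lambda>x. x) has_derivative (\<lambda>v. I (I' v))) (at (\<kappa> (i p)) within J)"
    proof (rule has_derivative_cong_openin[OF oT pT, rotated])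
      fix y assume "y \<in> ?T"
      then obtain n where n: "n \<in> W" "j n \<in> U" "y = \<kappa> n" by blast
      then show "?i (?j y) = y" using Uc(3) Wc(3,7) ij by (simp add: subset_iff)
    qed
    have "\<kappa> (i p) \<in> J" using Wc(6) W(2) by blast
    from has_derivative_subspace_unique[OF Wc(2) this _ idd has_derivative_ident]
    have II': "I (I' v) = v" if "v \<in> J" for v using that by simp
    have IL: "I ` L = J"
    proof
      show "I ` L \<subseteq> J" using I(2) by blast
      show "J \<subseteq> I ` L"
      proof
        fix v assume "v \<in> J"
        then have "v = I (I' v)" using II' by simp
        moreover have "I' v \<in> L" using I'(2) by blast
        ultimately show "v \<in> I ` L" by (rule image_eqI)
      qed
    qed
    obtain D where D: "(\<psi> \<circ> f \<circ> inv_into W \<kappa> has_derivative D) (at (\<kappa> (i p)) within J)" "D ` J = K"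
      using submersion_in_charts[OF f W(1) d W(2)] p(2) t[OF pM] by metis
    have "((\<lambda>x. (\<psi> \<circ> f \<circ> inv_into W \<kappa>) (?i x)) has_derivative (\<lambda>v. D (I v))) (at (\<phi> p) within L)"
      by (rule has_derivative_compose_subspace[OF oS pS iS I(1), of "\<psi> \<circ> f \<circ> inv_into W \<kappa>"])
        (use D(1) ip in simp)
    then have "(\<psi> \<circ> t \<circ> inv_into U \<phi> has_derivative (\<lambda>v. D (I v))) (at (\<phi> p) within L)"
    proof (rule has_derivative_cong_openin[OF oS pS, rotated])
      fix y assume "y \<in> ?S"
      then obtain m where m: "m \<in> U" "i m \<in> W" "y = \<phi> m" by blast
      then have "t m = f (i m)" using t Uc(7) by blast
      then show "(\<psi> \<circ> f \<circ> inv_into W \<kappa>) (?i y) = (\<psi> \<circ> t \<circ> inv_into U \<phi>) y"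
        using m Uc(3) Wc(3) by simp
    qed
    moreover have "(\<lambda>v. D (I v)) ` L = K" using IL D(2) by (simp add: image_image[symmetric])
    ultimately show ?thesis by blast
  qed
  with ts show ?thesis unfolding submersion_def by fast
qed

section \<open>Maps into and out of fibre products\<close>

lemma charts_fibre_product: "charts (fibre_product M N f g)"
  unfolding fibre_product_def by (rule charts_submanifold)

lemma smooth_map_into_fibre_product:
  assumes R: "charts R" and M: "smooth_manifold M" and N: "smooth_manifold N"
    and a: "smooth_map R M a" and b: "smooth_map R N b"
    and ab: "\<And>r. r \<in> pts R \<Longrightarrow> f (a r) = g (b r)"
  shows "smooth_map R (fibre_product M N f g) (\<lambda>r. (a r, b r))"
  unfolding fibre_product_def
proof (rule smooth_map_into_submanifold[OF R _ smooth_map_pair[OF a b]])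
  show "charted (product_manifold M N)"
    by (rule smooth_manifold_imp_charted[OF smooth_manifold_product[OF M N]])
  show "(\<lambda>r. (a r, b r)) ` pts R \<subseteq> {(p, q). p \<in> pts M \<and> q \<in> pts N \<and> f p = g q}"
    using ab smooth_map_closed[OF a] smooth_map_closed[OF b] by auto
qed

lemma smooth_map_fibre_product_projections:
  assumes M: "smooth_manifold M" and N: "smooth_manifold N"
  shows "smooth_map (fibre_product M N f g) M fst" "smooth_map (fibre_product M N f g) N snd"
proof -
  note c = smooth_manifold_imp_charted[OF M] smooth_manifold_imp_charted[OF N]
  note P = smooth_manifold_imp_charted[OF smooth_manifold_product[OF M N]]
  show "smooth_map (fibre_product M N f g) M fst"
    unfolding fibre_product_def
    by (rule smooth_map_from_submanifold[OF P charted_imp_charts[OF c(1)] smooth_map_fst[OF M c(2)]])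
  show "smooth_map (fibre_product M N f g) N snd"
    unfolding fibre_product_def
    by (rule smooth_map_from_submanifold[OF P charted_imp_charts[OF c(2)] smooth_map_snd[OF c(1) N]])
qed

section \<open>Lie groupoids and the division map of a principal bundle\<close>

lemma (in groupoid) ginv_ginv:
  assumes g: "g \<in> pts (Arr G)"
  shows "ginv G (ginv G g) = g"
proof -
  let ?k = "ginv G g"
  have k: "?k \<in> pts (Arr G)" "ginv G ?k \<in> pts (Arr G)" using g ginv_closed by blast+
  have "ginv G ?k = mul G (ginv G ?k) (unt G (src G g))"
    using mul_unt[OF k(2)] src_ginv[OF k(1)] tgt_ginv[OF g] by simp
  also have "\<dots> = mul G (ginv G ?k) (mul G ?k g)" by (simp add: ginv_mul[OF g])
  also have "\<dots> = mul G (mul G (ginv G ?k) ?k) g"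
    using mul_assoc[OF k(2) k(1) g] src_ginv[OF k(1)] src_ginv[OF g] by simp
  also have "\<dots> = mul G (unt G (tgt G g)) g"
    by (simp add: ginv_mul[OF k(1)] src_ginv[OF g])
  also have "\<dots> = g" by (rule unt_mul[OF g])
  finally show ?thesis .
qed

lemma (in groupoid) ginv_unt:
  assumes x: "x \<in> pts (Obj G)"
  shows "ginv G (unt G x) = unt G x"
proof -
  note u = unt_closed[OF x]
  have "ginv G (unt G x) = mul G (ginv G (unt G x)) (unt G x)"
    using mul_unt[OF ginv_closed[OF u]] src_ginv[OF u] tgt_unt[OF x] by simp
  also have "\<dots> = unt G x" using ginv_mul[OF u] src_unt[OF x] by simp
  finally show ?thesis .
qed

context lie_groupoid
begin

lemma tgt_submersion: "submersion (Arr G) (Obj G) (tgt G)"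
proof (rule submersion_compose_diffeomorphism[OF Arr_manifold Arr_manifold _ _ ginv_smooth ginv_smooth])
  show "charted (Obj G)" using Obj_manifold smooth_manifold_imp_charted by blast
  show "submersion (Arr G) (Obj G) (src G)"
    using src_submersion by (simp add: surjective_submersion_def)
qed (simp_all add: ginv_ginv src_ginv)

lemma charted_right_action_domain:
  assumes "smooth_manifold P" "smooth_map P (Obj G) \<epsilon>"
  shows "charted (fibre_product P (Arr G) \<epsilon> (tgt G))"
  using charted_fibre_product[OF assms(1) Arr_manifold _ assms(2) tgt_smooth] tgt_submersion
    Obj_manifold smooth_manifold_imp_charted by blast

end

text \<open>The quotient \<open>p\<^sup>-\<^sup>1 q\<close> of two points of the same fibre.\<close>

definition division ::
    "('h, 'e::euclidean_space, 'y, 'f::euclidean_space) groupoid \<Rightarrow> ('p \<Rightarrow> 'y) \<Rightarrow> ('p \<Rightarrow> 'h \<Rightarrow> 'p) \<Rightarrow>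
     'p \<Rightarrow> 'p \<Rightarrow> 'h" where
  "division H \<epsilon> act p q = (THE h. h \<in> pts (Arr H) \<and> tgt H h = \<epsilon> p \<and> act p h = q)"

context principal_bundle
begin

lemma ract_closed:
  assumes "p \<in> pts P" "h \<in> pts (Arr H)" "tgt H h = \<epsilon> p"
  shows "ract p h \<in> pts P"
  using smooth_map_closed[OF act_smooth, of "(p, h)"] assms by simp

lemma division_eq:
  assumes p: "p \<in> pts P" and h: "h \<in> pts (Arr H)" "tgt H h = \<epsilon> p"
  shows "division H \<epsilon> ract p (ract p h) = h"
  unfolding division_def
proof (rule the_equality)
  fix k assume k: "k \<in> pts (Arr H) \<and> tgt H k = \<epsilon> p \<and> ract p k = ract p h"
  have "inj_on (\<lambda>(p, h). (p, ract p h)) (pts (fibre_product P (Arr H) \<epsilon> (tgt H)))"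
    using principal by (simp add: diffeomorphism_def bij_betw_def)
  from inj_onD[OF this, of "(p, k)" "(p, h)"] show "k = h" using k p h by simp
qed (use h in simp)

lemma ex_ract_eq:
  assumes "p \<in> pts P" "q \<in> pts P" "\<pi> p = \<pi> q"
  obtains h where "h \<in> pts (Arr H)" "tgt H h = \<epsilon> p" "ract p h = q"
proof -
  have "(\<lambda>(p, h). (p, ract p h)) ` pts (fibre_product P (Arr H) \<epsilon> (tgt H)) = pts (fibre_product P P \<pi> \<pi>)"
    using principal by (simp add: diffeomorphism_def bij_betw_def)
  moreover have "(p, q) \<in> pts (fibre_product P P \<pi> \<pi>)" using assms by simp
  ultimately have "(p, q) \<in> (\<lambda>(p, h). (p, ract p h)) ` pts (fibre_product P (Arr H) \<epsilon> (tgt H))"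
    by blast
  then show ?thesis using that by auto
qed

lemma division:
  assumes "p \<in> pts P" "q \<in> pts P" "\<pi> p = \<pi> q"
  shows "division H \<epsilon> ract p q \<in> pts (Arr H)" "tgt H (division H \<epsilon> ract p q) = \<epsilon> p"
    "ract p (division H \<epsilon> ract p q) = q"
proof -
  obtain h where "h \<in> pts (Arr H)" "tgt H h = \<epsilon> p" "ract p h = q"
    using ex_ract_eq[OF assms] .
  then show "division H \<epsilon> ract p q \<in> pts (Arr H)" "tgt H (division H \<epsilon> ract p q) = \<epsilon> p"
    "ract p (division H \<epsilon> ract p q) = q"
    using division_eq[OF assms(1)] by auto
qed

text \<open>The quotient is the second component of the inverse of the diffeomorphism \<open>(p, h) \<mapsto> (p, p h)\<close>.\<close>

lemma smooth_map_division:
  assumes "lie_groupoid H"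
  shows "smooth_map (fibre_product P P \<pi> \<pi>) (Arr H) (\<lambda>(p, q). division H \<epsilon> ract p q)"
proof -
  interpret H: lie_groupoid H by (rule assms)
  let ?D = "fibre_product P (Arr H) \<epsilon> (tgt H)" and ?E = "fibre_product P P \<pi> \<pi>"
  let ?f = "\<lambda>(p, h). (p, ract p h)"
  have Hc: "charts (Arr H)" using smooth_manifold_imp_charted[OF H.Arr_manifold] charted_imp_charts by blast
  have inv: "smooth_map ?E ?D (inv_into (pts ?D) ?f)" and bij: "bij_betw ?f (pts ?D) (pts ?E)"
    using principal by (auto simp: diffeomorphism_def)
  have "smooth_map ?E (Arr H) (snd \<circ> inv_into (pts ?D) ?f)"
    by (rule smooth_map_compose[OF charts_fibre_product
          H.charted_right_action_domain[OF total_manifold mom_smooth] Hc inv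
          smooth_map_fibre_product_projections(2)[OF total_manifold H.Arr_manifold]])
  then show ?thesis
  proof (rule smooth_map_cong[OF charts_fibre_product Hc])
    fix z assume z: "z \<in> pts ?E"
    then obtain p q where pq: "z = (p, q)" "p \<in> pts P" "q \<in> pts P" "\<pi> p = \<pi> q" by auto
    let ?h = "division H \<epsilon> ract p q"
    have mem: "(p, ?h) \<in> pts ?D" and val: "?f (p, ?h) = z" using division[OF pq(2-4)] pq by simp_all
    from inv_into_f_f[OF bij_betw_imp_inj_on[OF bij] mem]
    have "inv_into (pts ?D) ?f z = (p, ?h)" unfolding val .
    then show "(snd \<circ> inv_into (pts ?D) ?f) z = (case z of (p, q) \<Rightarrow> division H \<epsilon> ract p q)"
      using pq(1) by simp
  qed
qed

end

section \<open>Morphisms and gauge transformations\<close>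

lemma (in hs_morphism) lact_closed:
  assumes "g \<in> pts (Arr G)" "p \<in> pts (Tot P)" "src G g = proj P p"
  shows "lact P g p \<in> pts (Tot P)"
  using smooth_map_closed[OF left.act_smooth, of "(g, p)"] assms by simp

definition gauge_of ::
    "('h, 'e::euclidean_space, 'y, 'f::euclidean_space) groupoid \<Rightarrow>
     ('p, 'd1::euclidean_space, 'g, 'x, 'h, 'y) hs_bundle \<Rightarrow>
     ('q, 'd2::euclidean_space, 'g, 'x, 'h, 'y) hs_bundle \<Rightarrow> ('p \<Rightarrow> 'q) \<Rightarrow> 'p \<times> 'q \<Rightarrow> 'h" where
  "gauge_of H P1 P2 \<sigma> = (\<lambda>(p, q)\<in>pts (odot P1 P2). division H (mom P2) (ract P2) q (\<sigma> p))"

text \<open>The value does not depend on the point \<open>q\<close> that is chosen over the base point of \<open>p\<close>, provided that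
  \<open>K\<close> is a gauge transformation (\<open>gauge_ract_independent\<close> below).\<close>

definition mor_of ::
    "('p, 'd1::euclidean_space, 'g, 'x, 'h, 'y) hs_bundle \<Rightarrow>
     ('q, 'd2::euclidean_space, 'g, 'x, 'h, 'y) hs_bundle \<Rightarrow> ('p \<times> 'q \<Rightarrow> 'h) \<Rightarrow> 'p \<Rightarrow> 'q" where
  "mor_of P1 P2 K = (\<lambda>p\<in>pts (Tot P1).
     let q = SOME q. q \<in> pts (Tot P2) \<and> proj P2 q = proj P1 p in ract P2 q (K (p, q)))"

locale hs_pair =
  G: lie_groupoid G + H: lie_groupoid H + P1: hs_morphism G H P1 + P2: hs_morphism G H P2
  for G :: "('g, 'eg::euclidean_space, 'x, 'ex::euclidean_space) groupoid"
    and H :: "('h, 'eh::euclidean_space, 'y, 'ey::euclidean_space) groupoid"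
    and P1 :: "('p, 'd1::euclidean_space, 'g, 'x, 'h, 'y) hs_bundle"
    and P2 :: "('q, 'd2::euclidean_space, 'g, 'x, 'h, 'y) hs_bundle"
begin

lemma pts_odot: "pts (odot P1 P2) =
    {(p, q). p \<in> pts (Tot P1) \<and> q \<in> pts (Tot P2) \<and> proj P1 p = proj P2 q}"
  by (simp add: odot_def)

lemma charted_manifolds: "charted (Tot P1)" "charted (Tot P2)" "charted (Arr H)" "charted (Obj G)"
  using P1.total_manifold P2.total_manifold H.Arr_manifold G.Obj_manifold smooth_manifold_imp_charted
  by blast+

lemma proj_submersions: "submersion (Tot P1) (Obj G) (proj P1)" "submersion (Tot P2) (Obj G) (proj P2)"
  "smooth_map (Tot P1) (Obj G) (proj P1)" "smooth_map (Tot P2) (Obj G) (proj P2)"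
  using P1.proj_submersion P2.proj_submersion by (auto simp: surjective_submersion_def submersion_def)

lemma charted_odot: "charted (odot P1 P2)"
  unfolding odot_def
  using charted_fibre_product[OF P1.total_manifold P2.total_manifold charted_manifolds(4)
      proj_submersions(3,4)] proj_submersions(1) by blast

lemma ex_P2_over:
  assumes "p \<in> pts (Tot P1)"
  obtains q where "q \<in> pts (Tot P2)" "proj P2 q = proj P1 p"
proof -
  have "proj P1 p \<in> proj P2 ` pts (Tot P2)"
    using P2.proj_submersion smooth_map_closed[OF proj_submersions(3) assms]
    by (simp add: surjective_submersion_def)
  then obtain q where "q \<in> pts (Tot P2)" "proj P1 p = proj P2 q" by blast
  with that show ?thesis by simp
qed

lemma hs_morD:
  assumes "\<sigma> \<in> hs_mor G H P1 P2"
  shows "\<sigma> \<in> extensional (pts (Tot P1))" "smooth_map (Tot P1) (Tot P2) \<sigma>"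
    "\<And>p. p \<in> pts (Tot P1) \<Longrightarrow> \<sigma> p \<in> pts (Tot P2)"
    "\<And>p. p \<in> pts (Tot P1) \<Longrightarrow> proj P2 (\<sigma> p) = proj P1 p"
    "\<And>p. p \<in> pts (Tot P1) \<Longrightarrow> mom P2 (\<sigma> p) = mom P1 p"
    "\<And>p h. p \<in> pts (Tot P1) \<Longrightarrow> h \<in> pts (Arr H) \<Longrightarrow> tgt H h = mom P1 p \<Longrightarrow>
      \<sigma> (ract P1 p h) = ract P2 (\<sigma> p) h"
    "\<And>p g. p \<in> pts (Tot P1) \<Longrightarrow> g \<in> pts (Arr G) \<Longrightarrow> src G g = proj P1 p \<Longrightarrow>
      \<sigma> (lact P1 g p) = lact P2 g (\<sigma> p)"
proof -
  show s: "smooth_map (Tot P1) (Tot P2) \<sigma>" using assms by (simp add: hs_mor_def)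
  show "\<sigma> p \<in> pts (Tot P2)" if "p \<in> pts (Tot P1)" for p using smooth_map_closed[OF s that] .
qed (use assms in \<open>simp_all add: hs_mor_def\<close>)

lemma hs_gaugeD:
  assumes "K \<in> hs_gauge G H P1 P2"
  shows "K \<in> extensional (pts (odot P1 P2))" "smooth_map (odot P1 P2) (Arr H) K"
    "\<And>p q. (p, q) \<in> pts (odot P1 P2) \<Longrightarrow> K (p, q) \<in> pts (Arr H)"
    "\<And>p q. (p, q) \<in> pts (odot P1 P2) \<Longrightarrow> src H (K (p, q)) = mom P1 p"
    "\<And>p q. (p, q) \<in> pts (odot P1 P2) \<Longrightarrow> tgt H (K (p, q)) = mom P2 q"
    "\<And>p q h1 h2. (p, q) \<in> pts (odot P1 P2) \<Longrightarrow> h1 \<in> pts (Arr H) \<Longrightarrow> h2 \<in> pts (Arr H) \<Longrightarrow>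
      tgt H h1 = mom P1 p \<Longrightarrow> tgt H h2 = mom P2 q \<Longrightarrow>
      K (ract P1 p h1, ract P2 q h2) = mul H (mul H (ginv H h2) (K (p, q))) h1"
    "\<And>p q g. (p, q) \<in> pts (odot P1 P2) \<Longrightarrow> g \<in> pts (Arr G) \<Longrightarrow> src G g = proj P1 p \<Longrightarrow>
      K (lact P1 g p, lact P2 g q) = K (p, q)"
proof -
  show s: "smooth_map (odot P1 P2) (Arr H) K" using assms by (simp add: hs_gauge_def)
  show "K (p, q) \<in> pts (Arr H)" if "(p, q) \<in> pts (odot P1 P2)" for p q
    using smooth_map_closed[OF s that] .
qed (use assms in \<open>auto simp: hs_gauge_def\<close>)

lemma gauge_of_apply:
  assumes \<sigma>: "\<sigma> \<in> hs_mor G H P1 P2" and pq: "(p, q) \<in> pts (odot P1 P2)"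
  shows "gauge_of H P1 P2 \<sigma> (p, q) \<in> pts (Arr H)" "tgt H (gauge_of H P1 P2 \<sigma> (p, q)) = mom P2 q"
    "ract P2 q (gauge_of H P1 P2 \<sigma> (p, q)) = \<sigma> p" "src H (gauge_of H P1 P2 \<sigma> (p, q)) = mom P1 p"
proof -
  let ?h = "gauge_of H P1 P2 \<sigma> (p, q)"
  have m: "p \<in> pts (Tot P1)" "q \<in> pts (Tot P2)" "proj P1 p = proj P2 q" using pq by (auto simp: pts_odot)
  have eq: "?h = division H (mom P2) (ract P2) q (\<sigma> p)" using pq by (simp add: gauge_of_def)
  show h: "?h \<in> pts (Arr H)" "tgt H ?h = mom P2 q" "ract P2 q ?h = \<sigma> p"
    unfolding eq using P2.division[OF m(2) hs_morD(3)[OF \<sigma> m(1)]] hs_morD(4)[OF \<sigma> m(1)] m(3) by simp_all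
  show "src H ?h = mom P1 p"
    using P2.mom_act[OF m(2) h(1)] h(2,3) hs_morD(5)[OF \<sigma> m(1)] by simp
qed

text \<open>Identities for \<open>gauge_of H P1 P2 \<sigma>\<close> are proved by letting both sides act on \<open>q\<close>: an arrow that takes
  \<open>q\<close> to \<open>\<sigma> p\<close> is the value at \<open>(p, q)\<close>.\<close>

lemma gauge_of_unique:
  assumes \<sigma>: "\<sigma> \<in> hs_mor G H P1 P2" and pq: "(p, q) \<in> pts (odot P1 P2)"
    and h: "h \<in> pts (Arr H)" "tgt H h = mom P2 q" "ract P2 q h = \<sigma> p"
  shows "gauge_of H P1 P2 \<sigma> (p, q) = h"
  using P2.division_eq[of q h] h pq by (simp add: gauge_of_def pts_odot)

text \<open>The map is the composite \<open>(p, q) \<mapsto> (q, \<sigma> p) \<mapsto> q\<^sup>-\<^sup>1 (\<sigma> p)\<close> through the fibre product of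
  \<open>P2\<close> with itself.\<close>

lemma gauge_of_smooth:
  assumes \<sigma>: "\<sigma> \<in> hs_mor G H P1 P2"
  shows "smooth_map (odot P1 P2) (Arr H) (gauge_of H P1 P2 \<sigma>)"
proof -
  note ch = charted_manifolds[THEN charted_imp_charts] charted_odot[THEN charted_imp_charts]
  note proj = smooth_map_fibre_product_projections[OF P1.total_manifold P2.total_manifold,
      of "proj P1" "proj P2", folded odot_def]
  have 1: "smooth_map (odot P1 P2) (Tot P2) (\<sigma> \<circ> fst)"
    by (rule smooth_map_compose[OF ch(5) charted_manifolds(1) ch(2) proj(1) hs_morD(2)[OF \<sigma>]])
  have 2: "smooth_map (odot P1 P2) (fibre_product (Tot P2) (Tot P2) (proj P2) (proj P2))
      (\<lambda>z. (snd z, (\<sigma> \<circ> fst) z))"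
    by (rule smooth_map_into_fibre_product[OF ch(5) P2.total_manifold P2.total_manifold proj(2) 1])
      (use hs_morD(4)[OF \<sigma>] in \<open>auto simp: pts_odot\<close>)
  have "charted (fibre_product (Tot P2) (Tot P2) (proj P2) (proj P2))"
    using charted_fibre_product[OF P2.total_manifold P2.total_manifold charted_manifolds(4)
        proj_submersions(4,4)] proj_submersions(2) by blast
  from smooth_map_compose[OF ch(5) this ch(3) 2 P2.smooth_map_division[OF H.lie_groupoid_axioms]]
  show ?thesis
    by (rule smooth_map_cong[OF ch(5) ch(3)]) (auto simp: gauge_of_def)
qed

text \<open>For the equivariance under \<open>H\<close>, the arrow \<open>h2\<^sup>-\<^sup>1 K(p, q) h1\<close> takes \<open>q h2\<close> to
  \<open>q K(p, q) h1 = (\<sigma> p) h1 = \<sigma> (p h1)\<close>; for the invariance under \<open>G\<close>, the arrow \<open>K(p, q)\<close> takes \<open>g q\<close> to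
  \<open>g (q K(p, q)) = g (\<sigma> p) = \<sigma> (g p)\<close>.\<close>

lemma gauge_of_in_hs_gauge:
  assumes \<sigma>: "\<sigma> \<in> hs_mor G H P1 P2"
  shows "gauge_of H P1 P2 \<sigma> \<in> hs_gauge G H P1 P2"
proof -
  let ?K = "gauge_of H P1 P2 \<sigma>"
  have "?K (ract P1 p h1, ract P2 q h2) = mul H (mul H (ginv H h2) (?K (p, q))) h1"
    if pq: "(p, q) \<in> pts (odot P1 P2)" and h1: "h1 \<in> pts (Arr H)" "tgt H h1 = mom P1 p"
      and h2: "h2 \<in> pts (Arr H)" "tgt H h2 = mom P2 q" for p q h1 h2
  proof (rule gauge_of_unique[OF \<sigma>])
    have m: "p \<in> pts (Tot P1)" "q \<in> pts (Tot P2)" "proj P1 p = proj P2 q" using pq by (auto simp: pts_odot)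
    note k = gauge_of_apply[OF \<sigma> pq]
    note i = H.ginv_closed[OF h2(1)] H.src_ginv[OF h2(1)] H.tgt_ginv[OF h2(1)]
    have ik: "mul H (ginv H h2) (?K (p, q)) \<in> pts (Arr H)"
      "src H (mul H (ginv H h2) (?K (p, q))) = mom P1 p"
      "tgt H (mul H (ginv H h2) (?K (p, q))) = src H h2"
      using H.mul_closed[OF i(1) k(1)] H.src_mul[OF i(1) k(1)] H.tgt_mul[OF i(1) k(1)] i(2,3) k h2(2)
      by simp_all
    show "mul H (mul H (ginv H h2) (?K (p, q))) h1 \<in> pts (Arr H)"
      using H.mul_closed[OF ik(1) h1(1)] ik h1(2) by simp
    show "(ract P1 p h1, ract P2 q h2) \<in> pts (odot P1 P2)"
      using m h1 h2 P1.ract_closed P2.ract_closed P1.proj_act P2.proj_act by (simp add: pts_odot)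
    show "tgt H (mul H (mul H (ginv H h2) (?K (p, q))) h1) = mom P2 (ract P2 q h2)"
      using H.tgt_mul[OF ik(1) h1(1)] ik h1(2) P2.mom_act[OF m(2) h2(1)] h2(2) by simp
    have assoc: "mul H h2 (mul H (mul H (ginv H h2) (?K (p, q))) h1) = mul H (?K (p, q)) h1"
    proof -
      have "mul H h2 (mul H (mul H (ginv H h2) (?K (p, q))) h1)
          = mul H (mul H h2 (mul H (ginv H h2) (?K (p, q)))) h1"
        using H.mul_assoc[OF h2(1) ik(1) h1(1)] ik h1(2) by simp
      also have "mul H h2 (mul H (ginv H h2) (?K (p, q))) = mul H (mul H h2 (ginv H h2)) (?K (p, q))"
        using H.mul_assoc[OF h2(1) i(1) k(1)] i k h2 by simp
      also have "\<dots> = ?K (p, q)"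
        using H.mul_ginv[OF h2(1)] H.unt_mul[OF k(1)] k(2) h2(2) by simp
      finally show ?thesis .
    qed
    have "ract P2 (ract P2 q h2) (mul H (mul H (ginv H h2) (?K (p, q))) h1)
        = ract P2 q (mul H (?K (p, q)) h1)"
      unfolding assoc[symmetric]
      by (rule P2.act_act[OF m(2) h2(1)])
        (use H.mul_closed[OF ik(1) h1(1)] H.tgt_mul[OF ik(1) h1(1)] ik h1(2) h2(2) in auto)
    also have "\<dots> = ract P2 (ract P2 q (?K (p, q))) h1"
      using P2.act_act[OF m(2) k(1) h1(1)] k h1(2) by simp
    also have "\<dots> = \<sigma> (ract P1 p h1)" using hs_morD(6)[OF \<sigma> m(1) h1] k(3) by simp
    finally show "ract P2 (ract P2 q h2) (mul H (mul H (ginv H h2) (?K (p, q))) h1) = \<sigma> (ract P1 p h1)" .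
  qed
  moreover have "?K (lact P1 g p, lact P2 g q) = ?K (p, q)"
    if pq: "(p, q) \<in> pts (odot P1 P2)" and g: "g \<in> pts (Arr G)" "src G g = proj P1 p" for p q g
  proof (rule gauge_of_unique[OF \<sigma>])
    have m: "p \<in> pts (Tot P1)" "q \<in> pts (Tot P2)" "proj P1 p = proj P2 q" using pq by (auto simp: pts_odot)
    have gq: "src G g = proj P2 q" using g(2) m(3) by simp
    note k = gauge_of_apply[OF \<sigma> pq]
    show "?K (p, q) \<in> pts (Arr H)" by (rule k(1))
    show "(lact P1 g p, lact P2 g q) \<in> pts (odot P1 P2)"
      using m g gq P1.lact_closed P2.lact_closed P1.left.mom_act P2.left.mom_act by (simp add: pts_odot)
    show "tgt H (?K (p, q)) = mom P2 (lact P2 g q)" using k(2) P2.mom_lact[OF g(1) m(2) gq] by simp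
    show "ract P2 (lact P2 g q) (?K (p, q)) = \<sigma> (lact P1 g p)"
      using P2.lact_ract[OF g(1) m(2) k(1) gq k(2)] k(3) hs_morD(7)[OF \<sigma> m(1) g] by simp
  qed
  ultimately show ?thesis
    using gauge_of_smooth[OF \<sigma>] gauge_of_apply[OF \<sigma>]
    unfolding hs_gauge_def by (auto simp: gauge_of_def)
qed

text \<open>If \<open>q' = q h\<close>, then equivariance with a unit on the first factor gives \<open>K(p, q h) = h\<^sup>-\<^sup>1 K(p, q)\<close>, and
  the two occurrences of \<open>h\<close> cancel in \<open>(q h) (h\<^sup>-\<^sup>1 K(p, q))\<close>.\<close>

lemma gauge_ract_independent:
  assumes K: "K \<in> hs_gauge G H P1 P2" and q: "(p, q) \<in> pts (odot P1 P2)" and q': "(p, q') \<in> pts (odot P1 P2)"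
  shows "ract P2 q' (K (p, q')) = ract P2 q (K (p, q))"
proof -
  have m: "p \<in> pts (Tot P1)" "q \<in> pts (Tot P2)" "proj P1 p = proj P2 q"
    "q' \<in> pts (Tot P2)" "proj P1 p = proj P2 q'" using q q' by (auto simp: pts_odot)
  obtain h where h: "h \<in> pts (Arr H)" "tgt H h = mom P2 q" "ract P2 q h = q'"
    using P2.ex_ract_eq[OF m(2,4)] m(3,5) by metis
  note k = hs_gaugeD(3-5)[OF K q]
  have x: "mom P1 p \<in> pts (Obj H)" using smooth_map_closed[OF P1.mom_smooth m(1)] .
  note u = H.unt_closed[OF x] H.tgt_unt[OF x]
  note i = H.ginv_closed[OF h(1)] H.src_ginv[OF h(1)] H.tgt_ginv[OF h(1)]
  have ik: "mul H (ginv H h) (K (p, q)) \<in> pts (Arr H)"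
    "src H (mul H (ginv H h) (K (p, q))) = mom P1 p"
    "tgt H (mul H (ginv H h) (K (p, q))) = src H h"
    using H.mul_closed[OF i(1) k(1)] H.src_mul[OF i(1) k(1)] H.tgt_mul[OF i(1) k(1)] i(2,3) k h(2)
    by simp_all
  have "K (p, q') = mul H (mul H (ginv H h) (K (p, q))) (unt H (mom P1 p))"
    using hs_gaugeD(6)[OF K q u(1) h(1) u(2) h(2)] P1.act_unt[OF m(1)] h(3) by simp
  also have "\<dots> = mul H (ginv H h) (K (p, q))" using H.mul_unt[OF ik(1)] ik(2) by simp
  finally have "ract P2 q' (K (p, q')) = ract P2 (ract P2 q h) (mul H (ginv H h) (K (p, q)))"
    using h(3) by simp
  also have "\<dots> = ract P2 q (mul H h (mul H (ginv H h) (K (p, q))))"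
    using P2.act_act[OF m(2) h(1) ik(1)] ik(3) h(2) by simp
  also have "mul H h (mul H (ginv H h) (K (p, q))) = mul H (mul H h (ginv H h)) (K (p, q))"
    using H.mul_assoc[OF h(1) i(1) k(1)] i k h by simp
  also have "\<dots> = K (p, q)"
    using H.mul_ginv[OF h(1)] H.unt_mul[OF k(1)] k(3) h(2) by simp
  finally show ?thesis .
qed

lemma mor_of_apply:
  assumes K: "K \<in> hs_gauge G H P1 P2" and q: "(p, q) \<in> pts (odot P1 P2)"
  shows "mor_of P1 P2 K p = ract P2 q (K (p, q))"
proof -
  let ?q = "SOME q. q \<in> pts (Tot P2) \<and> proj P2 q = proj P1 p"
  have m: "p \<in> pts (Tot P1)" using q by (simp add: pts_odot)
  have "q \<in> pts (Tot P2) \<and> proj P2 q = proj P1 p" using q by (simp add: pts_odot)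
  then have "?q \<in> pts (Tot P2) \<and> proj P2 ?q = proj P1 p" by (rule someI)
  then have "(p, ?q) \<in> pts (odot P1 P2)" using m by (simp add: pts_odot)
  from gauge_ract_independent[OF K q this] show ?thesis using m by (simp add: mor_of_def Let_def)
qed

text \<open>Over an open set on which the projection of \<open>P2\<close> has a smooth section \<open>s\<close>, independence of the choice
  allows \<open>q = s(x)\<close> for \<open>p\<close> over \<open>x\<close>.  The map becomes the composite
  \<open>p \<mapsto> (p, s(x)) \<mapsto> (s(x), K(p, s(x))) \<mapsto> s(x) K(p, s(x))\<close>.\<close>

lemma mor_of_smooth:
  assumes K: "K \<in> hs_gauge G H P1 P2"
  shows "smooth_map (Tot P1) (Tot P2) (mor_of P1 P2 K)"
proof (rule smooth_map_local[OF P1.total_manifold])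
  note ch = charted_manifolds[THEN charted_imp_charts] charted_odot[THEN charted_imp_charts]
  show "charts (Tot P2)" by (rule ch(2))
  fix p assume p: "p \<in> pts (Tot P1)"
  obtain q where q: "q \<in> pts (Tot P2)" "proj P2 q = proj P1 p" using ex_P2_over[OF p] .
  have X: "smooth_manifold (Obj G)" using G.Obj_manifold by blast
  obtain V s where V: "openin (topo (Obj G)) V" "proj P2 q \<in> V" and
    s: "smooth_map (submanifold (Obj G) V) (Tot P2) s" "\<forall>x\<in>V. proj P2 (s x) = x"
    by (rule submersion_local_section[OF P2.total_manifold X proj_submersions(2) q(1)])
  define U where "U = {p \<in> pts (Tot P1). proj P1 p \<in> V}"
  have U: "openin (topo (Tot P1)) U"
    unfolding U_def using openin_continuous_map_preimage[OF smooth_map_continuous[OF proj_submersions(3)] V(1)] .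
  let ?R = "submanifold (Tot P1) U"
  have R: "charts ?R" by (rule charts_submanifold)
  have ptsR: "pts ?R = U" by (auto simp: U_def)
  have pi: "smooth_map ?R (submanifold (Obj G) V) (proj P1)"
    by (rule smooth_map_into_submanifold[OF R charted_manifolds(4)
          smooth_map_from_submanifold[OF charted_manifolds(1) ch(4) proj_submersions(3)]])
      (auto simp: U_def)
  let ?s = "s \<circ> proj P1"
  have sp: "smooth_map ?R (Tot P2) ?s"
    by (rule smooth_map_compose[OF R charted_open_submanifold[OF X V(1)] ch(2) pi s(1)])
  have over: "(p', ?s p') \<in> pts (odot P1 P2)" if "p' \<in> U" for p'
    using smooth_map_closed[OF sp, of p'] ptsR that s(2) by (auto simp: U_def pts_odot)
  have "smooth_map ?R (odot P1 P2) (\<lambda>r. (id r, ?s r))"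
    unfolding odot_def
    by (rule smooth_map_into_fibre_product[OF R P1.total_manifold P2.total_manifold
          smooth_map_inclusion[OF ch(1)] sp]) (use over ptsR in \<open>auto simp: pts_odot\<close>)
  from smooth_map_compose[OF R charted_odot ch(3) this hs_gaugeD(2)[OF K]]
  have Ks: "smooth_map ?R (Arr H) (K \<circ> (\<lambda>r. (id r, ?s r)))" .
  have "smooth_map ?R (fibre_product (Tot P2) (Arr H) (mom P2) (tgt H))
      (\<lambda>r. (?s r, (K \<circ> (\<lambda>r. (id r, ?s r))) r))"
    by (rule smooth_map_into_fibre_product[OF R P2.total_manifold H.Arr_manifold sp Ks])
      (use hs_gaugeD(5)[OF K over] ptsR in simp)
  from smooth_map_compose[OF R H.charted_right_action_domain[OF P2.total_manifold P2.mom_smooth]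
      ch(2) this P2.act_smooth]
  have "smooth_map ?R (Tot P2) (mor_of P1 P2 K)"
    by (rule smooth_map_cong[OF R ch(2)]) (use mor_of_apply[OF K over] ptsR in simp)
  moreover have "p \<in> U" using p q V(2) by (simp add: U_def)
  ultimately show "\<exists>O'. openin (topo (Tot P1)) O' \<and> p \<in> O' \<and>
      smooth_map (submanifold (Tot P1) O') (Tot P2) (mor_of P1 P2 K)"
    using U by blast
qed

text \<open>Each condition at \<open>p\<close> is checked with a suitable representative: the same \<open>q\<close> for \<open>p h\<close>, and \<open>g q\<close> for
  \<open>g p\<close>.\<close>

lemma mor_of_in_hs_mor:
  assumes K: "K \<in> hs_gauge G H P1 P2"
  shows "mor_of P1 P2 K \<in> hs_mor G H P1 P2"
proof -
  let ?\<sigma> = "mor_of P1 P2 K"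
  have main: "proj P2 (?\<sigma> p) = proj P1 p \<and> mom P2 (?\<sigma> p) = mom P1 p \<and>
      (\<forall>h\<in>pts (Arr H). tgt H h = mom P1 p \<longrightarrow> ?\<sigma> (ract P1 p h) = ract P2 (?\<sigma> p) h) \<and>
      (\<forall>g\<in>pts (Arr G). src G g = proj P1 p \<longrightarrow> ?\<sigma> (lact P1 g p) = lact P2 g (?\<sigma> p))"
    if p: "p \<in> pts (Tot P1)" for p
  proof -
    obtain q where q: "q \<in> pts (Tot P2)" "proj P2 q = proj P1 p" using ex_P2_over[OF p] .
    have pq: "(p, q) \<in> pts (odot P1 P2)" using p q by (simp add: pts_odot)
    note k = hs_gaugeD(3-5)[OF K pq] and \<sigma>p = mor_of_apply[OF K pq]
    have y: "mom P2 q \<in> pts (Obj H)" using smooth_map_closed[OF P2.mom_smooth q(1)] .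
    have "proj P2 (?\<sigma> p) = proj P1 p" using \<sigma>p P2.proj_act[OF q(1) k(1)] k(3) q(2) by simp
    moreover have "mom P2 (?\<sigma> p) = mom P1 p" using \<sigma>p P2.mom_act[OF q(1) k(1)] k(2,3) by simp
    moreover have "?\<sigma> (ract P1 p h) = ract P2 (?\<sigma> p) h"
      if h: "h \<in> pts (Arr H)" "tgt H h = mom P1 p" for h
    proof -
      have "(ract P1 p h, q) \<in> pts (odot P1 P2)"
        using p q h P1.ract_closed P1.proj_act by (simp add: pts_odot)
      then have "?\<sigma> (ract P1 p h) = ract P2 q (K (ract P1 p h, q))" by (rule mor_of_apply[OF K])
      also have "K (ract P1 p h, q) = mul H (mul H (ginv H (unt H (mom P2 q))) (K (p, q))) h"
        using hs_gaugeD(6)[OF K pq h(1) H.unt_closed[OF y] h(2) H.tgt_unt[OF y]] P2.act_unt[OF q(1)] by simp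
      also have "\<dots> = mul H (K (p, q)) h"
        using H.ginv_unt[OF y] H.unt_mul[OF k(1)] k(3) by simp
      also have "ract P2 q \<dots> = ract P2 (ract P2 q (K (p, q))) h"
        using P2.act_act[OF q(1) k(1) h(1)] k h(2) by simp
      finally show ?thesis using \<sigma>p by simp
    qed
    moreover have "?\<sigma> (lact P1 g p) = lact P2 g (?\<sigma> p)"
      if g: "g \<in> pts (Arr G)" "src G g = proj P1 p" for g
    proof -
      have gq: "src G g = proj P2 q" using g(2) q(2) by simp
      have "(lact P1 g p, lact P2 g q) \<in> pts (odot P1 P2)"
        using p q g gq P1.lact_closed P2.lact_closed P1.left.mom_act P2.left.mom_act
        by (simp add: pts_odot)
      then have "?\<sigma> (lact P1 g p) = ract P2 (lact P2 g q) (K (lact P1 g p, lact P2 g q))"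
        by (rule mor_of_apply[OF K])
      also have "\<dots> = ract P2 (lact P2 g q) (K (p, q))" using hs_gaugeD(7)[OF K pq g] by simp
      also have "\<dots> = lact P2 g (ract P2 q (K (p, q)))"
        by (rule P2.lact_ract[OF g(1) q(1) k(1) gq k(3)])
      finally show ?thesis using \<sigma>p by simp
    qed
    ultimately show ?thesis by blast
  qed
  have "?\<sigma> \<in> extensional (pts (Tot P1))" by (simp add: mor_of_def)
  then show ?thesis
    using main mor_of_smooth[OF K] unfolding hs_mor_def by simp
qed

lemma bij_betw_gauge_of: "bij_betw (gauge_of H P1 P2) (hs_mor G H P1 P2) (hs_gauge G H P1 P2)"
proof (rule bij_betw_byWitness[where f' = "mor_of P1 P2"])
  show "\<forall>\<sigma>\<in>hs_mor G H P1 P2. mor_of P1 P2 (gauge_of H P1 P2 \<sigma>) = \<sigma>"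
  proof
    fix \<sigma> assume \<sigma>: "\<sigma> \<in> hs_mor G H P1 P2"
    show "mor_of P1 P2 (gauge_of H P1 P2 \<sigma>) = \<sigma>"
    proof (rule extensionalityI[of _ "pts (Tot P1)"])
      show "mor_of P1 P2 (gauge_of H P1 P2 \<sigma>) \<in> extensional (pts (Tot P1))" by (simp add: mor_of_def)
      show "\<sigma> \<in> extensional (pts (Tot P1))" by (rule hs_morD(1)[OF \<sigma>])
      fix p assume p: "p \<in> pts (Tot P1)"
      obtain q where q: "q \<in> pts (Tot P2)" "proj P2 q = proj P1 p" using ex_P2_over[OF p] .
      have pq: "(p, q) \<in> pts (odot P1 P2)" using p q by (simp add: pts_odot)
      show "mor_of P1 P2 (gauge_of H P1 P2 \<sigma>) p = \<sigma> p"
        using mor_of_apply[OF gauge_of_in_hs_gauge[OF \<sigma>] pq] gauge_of_apply(3)[OF \<sigma> pq] by simp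
    qed
  qed
  show "\<forall>K\<in>hs_gauge G H P1 P2. gauge_of H P1 P2 (mor_of P1 P2 K) = K"
  proof
    fix K assume K: "K \<in> hs_gauge G H P1 P2"
    show "gauge_of H P1 P2 (mor_of P1 P2 K) = K"
    proof (rule extensionalityI[of _ "pts (odot P1 P2)"])
      show "gauge_of H P1 P2 (mor_of P1 P2 K) \<in> extensional (pts (odot P1 P2))" by (simp add: gauge_of_def)
      show "K \<in> extensional (pts (odot P1 P2))" by (rule hs_gaugeD(1)[OF K])
      fix z assume z: "z \<in> pts (odot P1 P2)"
      obtain p q where pq: "z = (p, q)" by fastforce
      show "gauge_of H P1 P2 (mor_of P1 P2 K) z = K z"
        unfolding pq
        by (rule gauge_of_unique[OF mor_of_in_hs_mor[OF K]])
          (use z pq hs_gaugeD(3,5)[OF K] mor_of_apply[OF K] in simp_all)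
    qed
  qed
qed (use gauge_of_in_hs_gauge mor_of_in_hs_mor in blast)+

end

theorem theorem6p9:
  fixes G :: "('g, 'eg::euclidean_space, 'x, 'ex::euclidean_space) groupoid"
    and H :: "('h, 'eh::euclidean_space, 'y, 'ey::euclidean_space) groupoid"
    and P1 :: "('p, 'd1::euclidean_space, 'g, 'x, 'h, 'y) hs_bundle"
    and P2 :: "('q, 'd2::euclidean_space, 'g, 'x, 'h, 'y) hs_bundle"
  assumes "lie_groupoid G" and "lie_groupoid H"
    and "hs_morphism G H P1" and "hs_morphism G H P2"
  shows "\<exists>\<Phi>. bij_betw \<Phi> (hs_mor G H P1 P2) (hs_gauge G H P1 P2)"
proof -
  interpret hs_pair G H P1 P2
    using assms by (rule hs_pair.intro)
  show ?thesis using bij_betw_gauge_of by blast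
qed

end
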